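(* Let $G\subset\operatorname{Diff}(\mathbb R^d,0)$ be a commutative finitely generated subgroup of germs of $C^\infty$-smooth self-maps (finitely generated in the sense given in the context), and let $X,Y\subseteq(\mathbb R^d,0)$ be any pair of finitely presented $C^\infty$-smooth subvarieties. Then the finite values of the intersection multiplicity $\mu(g)=\mu(g^{-1}(X),Y)$, $g\in G$, are bounded: there exists $m\in\mathbb N$, depending on $G$, $X$, $Y$, such that for all $g\in G$, $\mu(g)<+\infty$ implies $\mu(g)\le m$.
   Context: $\operatorname{Diff}(\mathbb R^d,0)$ is the group of germs of invertible $C^\infty$-smooth self-maps of $(\mathbb R^d,0)$ fixing the origin; $\mathscr E(\mathbb R^d,0)$ is the algebra of germs at the origin of $C^\infty$-smooth real functions. A subgroup $G\subset\operatorname{Diff}(\mathbb R^d,0)$ is finitely generated if there are finitely many germs $F_1,\dots,F_p\in\operatorname{Diff}(\mathbb R^d,0)$ and finitely many germs of $C^\infty$-smooth vector fields $v_1,\dots,v_q$ vanishing at the origin ($p=0$ or $q=0$ allowed) such that $G$ consists of all finite compositions of the maps $F_i^{\pm1}$ and the flow maps $\mathrm e^{tv_j}$, $t\in\mathbb R$. A finitely presented $C^\infty$-smooth subvariety $X$ is the germ of the zero locus of a finitely generated ideal $I_X\subseteq\mathscr E(\mathbb R^d,0)$, and is considered together with this ideal. The preimage $g^{-1}(X)$ corresponds to the ideal $g^*I_X=\{f\circ g:f\in I_X\}$. The intersection multiplicity is $\mu(X,Y)=\dim_{\mathbb R}\mathscr E(\mathbb R^d,0)/\langle I_X,I_Y\rangle\in\mathbb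 N\cup\{+\infty\}$, where $\langle I_X,I_Y\rangle$ is the ideal generated jointly by $I_X$ and $I_Y$. *)

theory Defs
  imports "HOL-Analysis.Analysis" "HOL-Library.Extended_Nat"
    "HOL-Algebra.Generated_Groups" "HOL-Algebra.QuotRing" "HOL-Algebra.Embedded_Algebras"
begin

section \<open>Smooth functions\<close>

primrec higher_differentiable_on ::
  "'a::real_normed_vector set \<Rightarrow> ('a \<Rightarrow> 'b::real_normed_vector) \<Rightarrow> nat \<Rightarrow> bool" where
  "higher_differentiable_on S f 0 \<longleftrightarrow> continuous_on S f"
| "higher_differentiable_on S f (Suc n) \<longleftrightarrow>
     (\<forall>x\<in>S. f differentiable (at x)) \<and>
     (\<forall>v. higher_differentiable_on S (\<lambda>x. frechet_derivative f (at x) v) n)"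

text \<open>For open \<open>S\<close> in a finite-dimensional space this is the class of \<open>C\<close>-infinity functions on \<open>S\<close>:
  all iterated directional derivatives exist and are continuous.\<close>

definition smooth_on :: "'a::real_normed_vector set \<Rightarrow> ('a \<Rightarrow> 'b::real_normed_vector) \<Rightarrow> bool" where
  "smooth_on S f \<longleftrightarrow> (\<forall>n. higher_differentiable_on S f n)"

definition smooth_near_0 :: "('a::real_normed_vector \<Rightarrow> 'b::real_normed_vector) \<Rightarrow> bool" where
  "smooth_near_0 f \<longleftrightarrow> (\<exists>U. open U \<and> 0 \<in> U \<and> smooth_on U f)"


section \<open>Germs at the origin\<close>

definition eq_near_0 :: "('a::{topological_space,zero} \<Rightarrow> 'b) \<Rightarrow> ('a \<Rightarrow> 'b) \<Rightarrow> bool" where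
  "eq_near_0 f g \<longleftrightarrow> (\<forall>\<^sub>F x in nhds 0. f x = g x)"

quotient_type (overloaded) ('a, 'b) germ = "'a::{topological_space,zero} \<Rightarrow> 'b" / eq_near_0
  morphisms rep_germ germ_of
proof (rule equivpI)
  show "reflp (eq_near_0 :: ('a \<Rightarrow> 'b) \<Rightarrow> _)"
    by (simp add: reflp_def eq_near_0_def)
  show "symp (eq_near_0 :: ('a \<Rightarrow> 'b) \<Rightarrow> _)"
    by (simp add: symp_def eq_near_0_def eq_commute)
  show "transp (eq_near_0 :: ('a \<Rightarrow> 'b) \<Rightarrow> _)"
    by (auto simp: transp_def eq_near_0_def elim: eventually_elim2)
qed

instantiation germ :: ("{topological_space,zero}", comm_ring_1) comm_ring_1
begin

lift_definition zero_germ :: "('a, 'b) germ" is "\<lambda>_. 0" .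
lift_definition one_germ :: "('a, 'b) germ" is "\<lambda>_. 1" .
lift_definition plus_germ :: "('a, 'b) germ \<Rightarrow> ('a, 'b) germ \<Rightarrow> ('a, 'b) germ"
  is "\<lambda>f g x. f x + g x"
  by (auto simp: eq_near_0_def elim: eventually_elim2)
lift_definition minus_germ :: "('a, 'b) germ \<Rightarrow> ('a, 'b) germ \<Rightarrow> ('a, 'b) germ"
  is "\<lambda>f g x. f x - g x"
  by (auto simp: eq_near_0_def elim: eventually_elim2)
lift_definition times_germ :: "('a, 'b) germ \<Rightarrow> ('a, 'b) germ \<Rightarrow> ('a, 'b) germ"
  is "\<lambda>f g x. f x * g x"
  by (auto simp: eq_near_0_def elim: eventually_elim2)
lift_definition uminus_germ :: "('a, 'b) germ \<Rightarrow> ('a, 'b) germ"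
  is "\<lambda>f x. - f x"
  by (auto simp: eq_near_0_def elim: eventually_mono)

instance
  by standard (transfer; auto simp: eq_near_0_def algebra_simps dest: eventually_nhds_x_imp_x)+

end

text \<open>Composition respects germs only if the inner germ is continuous at the origin and fixes it,
  i.e. tends to \<open>0\<close> along \<open>nhds 0\<close>. It is only ever applied to such inner germs; all others
  are sent to a dummy value.\<close>

lift_definition germ_comp ::
  "('b::{topological_space,zero}, 'c) germ \<Rightarrow> ('a::{topological_space,zero}, 'b) germ \<Rightarrow> ('a, 'c) germ"
  is "\<lambda>f g. if filterlim g (nhds 0) (nhds 0) then f \<circ> g else (\<lambda>_. undefined)"
proof -
  fix f f' :: "'b \<Rightarrow> 'c" and g g' :: "'a \<Rightarrow> 'b"
  assume f: "eq_near_0 f f'" and g: "eq_near_0 g g'"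
  have iff: "filterlim g (nhds 0) (nhds 0) \<longleftrightarrow> filterlim g' (nhds 0) (nhds 0)"
    using g by (intro filterlim_cong) (auto simp: eq_near_0_def)
  have "\<forall>\<^sub>F x in nhds 0. f (g x) = f' (g' x)" if "filterlim g (nhds 0) (nhds 0)"
  proof -
    have "\<forall>\<^sub>F x in nhds 0. f (g x) = f' (g x)"
      using f that unfolding eq_near_0_def filterlim_iff by blast
    then show ?thesis
      using g unfolding eq_near_0_def by eventually_elim simp
  qed
  then show "eq_near_0
      (if filterlim g (nhds 0) (nhds 0) then f \<circ> g else (\<lambda>_. undefined))
      (if filterlim g' (nhds 0) (nhds 0) then f' \<circ> g' else (\<lambda>_. undefined))"
    using iff by (auto simp: eq_near_0_def)
qed


section \<open>The algebra of function germs and the group of germs of diffeomorphisms\<close>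

definition smooth_germ_ring :: "(real ^ 'n, real) germ ring" (\<open>\<E>\<close>) where
  "\<E> = \<lparr>carrier = germ_of ` {f. smooth_near_0 f}, monoid.mult = (*), one = 1, ring.zero = 0, add = (+)\<rparr>"

definition smooth_germs_fix_0 :: "(real ^ 'n, real ^ 'n) germ set" where
  "smooth_germs_fix_0 = germ_of ` {f. smooth_near_0 f \<and> f 0 = 0}"

definition Diff_0 :: "(real ^ 'n, real ^ 'n) germ monoid" where
  "Diff_0 = units_of \<lparr>carrier = smooth_germs_fix_0, monoid.mult = germ_comp, one = germ_of (\<lambda>x. x)\<rparr>"


section \<open>Flows and finitely generated groups of germs\<close>

text \<open>\<open>is_flow_germ v t F\<close>: the germ \<open>F\<close> is the time-\<open>t\<close> flow map of the vector field germ \<open>v\<close>.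
  The trajectories are required to stay in an open set \<open>W\<close> on which the chosen representative
  of \<open>v\<close> is smooth, so that they are unique and \<open>F\<close> depends on the germ of \<open>v\<close> only.\<close>

definition is_flow_germ ::
  "(real ^ 'n, real ^ 'n) germ \<Rightarrow> real \<Rightarrow> (real ^ 'n, real ^ 'n) germ \<Rightarrow> bool" where
  "is_flow_germ v t F \<longleftrightarrow>
     (\<exists>w W U \<phi>. v = germ_of w \<and> open W \<and> smooth_on W w \<and> open U \<and> 0 \<in> U \<and>
        (\<forall>x\<in>U. \<phi> 0 x = x \<and>
          (\<forall>s\<in>closed_segment 0 t. \<phi> s x \<in> W \<and>
             ((\<lambda>s. \<phi> s x) has_vector_derivative w (\<phi> s x)) (at s within closed_segment 0 t))) \<and>
        F = germ_of (\<phi> t))"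

text \<open>Vector fields vanishing at the origin are identified with their coordinate maps, hence with
  elements of \<open>smooth_germs_fix_0\<close>. Since the inverse of a time-\<open>t\<close> flow map is
  the time-\<open>(-t)\<close> flow map, \<^const>\<open>generate\<close> yields exactly the finite compositions of the
  elements of \<open>A\<close>, their inverses and the flow maps of the elements of \<open>V\<close>.\<close>

definition finitely_generated :: "(real ^ 'n, real ^ 'n) germ set \<Rightarrow> bool" where
  "finitely_generated G \<longleftrightarrow>
     (\<exists>A V. finite A \<and> A \<subseteq> carrier Diff_0 \<and> finite V \<and> V \<subseteq> smooth_germs_fix_0 \<and>
        G = generate Diff_0 (A \<union> {F. \<exists>v\<in>V. \<exists>t. is_flow_germ v t F}))"


section \<open>Subvarieties and intersection multiplicity\<close>

text \<open>A subvariety consists of a set \<open>X\<close>, of which only the germ at the origin matters, together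
  with an ideal \<open>I\<close> whose zero locus it is near the origin.\<close>

definition fp_smooth_subvariety :: "(real ^ 'n) set \<Rightarrow> (real ^ 'n, real) germ set \<Rightarrow> bool" where
  "fp_smooth_subvariety X I \<longleftrightarrow>
     (\<exists>S. finite S \<and> (\<forall>f\<in>S. smooth_near_0 f) \<and> I = Idl\<^bsub>\<E>\<^esub> (germ_of ` S) \<and>
        (\<forall>\<^sub>F x in nhds 0. x \<in> X \<longleftrightarrow> (\<forall>f\<in>S. f x = 0)))"

definition pullback ::
  "(real ^ 'n, real ^ 'n) germ \<Rightarrow> (real ^ 'n, real) germ set \<Rightarrow> (real ^ 'n, real) germ set" where
  "pullback g I = (\<lambda>f. germ_comp f g) ` I"

text \<open>The dimension is taken over the copy of the reals formed by the classes of the constant germs.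
  For the zero quotient ring, where this copy is \<open>{0}\<close>, the library's dimension is still \<open>0\<close>.\<close>

definition intersection_multiplicity ::
  "(real ^ 'n, real) germ set \<Rightarrow> (real ^ 'n, real) germ set \<Rightarrow> enat" where
  "intersection_multiplicity I J =
     (let L = Idl\<^bsub>\<E>\<^esub> (I \<union> J);
          Q = \<E> Quot L;
          K = range (\<lambda>c. L +>\<^bsub>\<E>\<^esub> germ_of (\<lambda>_. c))
      in if ring.finite_dimension Q K (carrier Q) then enat (ring.dim Q K (carrier Q)) else \<infinity>)"

end

theory Submission
  imports Defs "HOL-Library.Function_Algebras" "HOL-Computational_Algebra.Polynomial"
    "HOL-Computational_Algebra.Fundamental_Theorem_Algebra"
begin

text \<open>The argument is Noetherian. Modulo germs vanishing to order \<open>k\<close>, pullback by a power of a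
  diffeomorphism or by a flow map acts through exponential polynomials in the exponent or in the
  time. Their exponents are generated by the eigenvalues of the linear part alone, because a germ of
  order \<open>j\<close> is a sum of \<open>j\<close>-fold products of coordinates up to higher order. Hence, for all \<open>k\<close> at
  once, the coefficients of the pullback by \<open>g \<in> G\<close> lie in one finitely generated, so Noetherian,
  algebra of functions on \<open>G\<close>. If \<open>\<mu>(g)\<close> is finite, then \<open>\<mu>(h) \<le> k\<close> holds, for a suitable \<open>k\<close>,
  wherever a certain determinant in this algebra, nonzero at \<open>g\<close>, does not vanish at \<open>h\<close>. Finitely
  many of these determinants have the same common zeros as all of them, which bounds \<open>\<mu>\<close>.\<close>

section \<open>Functions of class C-infinity\<close>

text \<open>The order up to which germs must be known for a finite multiplicity to be visible
  depends on \<open>g\<close>, so no single space of jets suffices: one coefficient algebra has to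
  serve all \<open>k\<close>, and this is what the control of the exponents achieves. Commutativity
  lets every element of \<open>G\<close> be written as a composition of factors in a fixed order,
  one from each of finitely many monoids: powers of a generator or of its inverse, and forward flows
  of \<open>v\<close> or of \<open>-v\<close>. Without it the argument would bound neither the
  number of factors nor the number of generators of the algebra. The truncation order comes from the
  multiplicity: if \<open>k\<close> germs span modulo an ideal and the germs of order
  \<open>k + 1\<close>, then the orders from \<open>0\<close> to \<open>k\<close> cannot all
  contribute new directions, and Nakayama's lemma puts all germs of some order at most
  \<open>k\<close> into the ideal. Thus a nonvanishing determinant of jets controls the full
  quotient, flat germs included.\<close>

lemma higher_differentiable_on_cong:
  assumes "open S" "\<And>x. x \<in> S \<Longrightarrow> f x = g x"
  shows "higher_differentiable_on S f n \<longleftrightarrow> higher_differentiable_on S g n"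
  using assms(2)
proof (induction n arbitrary: f g)
  case 0
  then show ?case by (auto intro: continuous_on_cong[THEN iffD1])
next
  case (Suc n)
  have *: "(f has_derivative D) (at x) \<longleftrightarrow> (g has_derivative D) (at x)" if "x \<in> S" for x D
    using has_derivative_transform_within_open[OF _ assms(1) that, of f D UNIV g]
      has_derivative_transform_within_open[OF _ assms(1) that, of g D UNIV f] Suc.prems by auto
  then have "f differentiable (at x) \<longleftrightarrow> g differentiable (at x)"
    and "frechet_derivative f (at x) = frechet_derivative g (at x)" if "x \<in> S" for x
    using that by (simp_all add: differentiable_def frechet_derivative_def)
  then show ?case
    using Suc.IH[of "\<lambda>x. frechet_derivative f (at x) v" "\<lambda>x. frechet_derivative g (at x) v" for v]
    by auto
qed

lemma higher_differentiable_on_SucD: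
  "higher_differentiable_on S f (Suc n) \<Longrightarrow> higher_differentiable_on S f n"
proof (induction n arbitrary: f)
  case 0
  then show ?case
    by (auto intro!: continuous_at_imp_continuous_on differentiable_imp_continuous_within)
qed auto

lemma higher_differentiable_on_continuous:
  "higher_differentiable_on S f n \<Longrightarrow> continuous_on S f"
proof (induction n)
  case (Suc n)
  then show ?case using higher_differentiable_on_SucD by blast
qed simp

lemma higher_differentiable_on_subset:
  "higher_differentiable_on S f n \<Longrightarrow> T \<subseteq> S \<Longrightarrow> higher_differentiable_on T f n"
  by (induction n arbitrary: f) (auto intro: continuous_on_subset)

text \<open>Any explicit formula \<open>D\<close> may stand in for the chosen
  \<open>frechet_derivative\<close>. The closure properties below are inductions through this rule,
  with \<open>D\<close> taken from the sum, product or chain rule.\<close>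

lemma higher_differentiable_on_SucI:
  assumes "open S" "\<And>x. x \<in> S \<Longrightarrow> (f has_derivative D x) (at x)"
    and "\<And>v. higher_differentiable_on S (\<lambda>x. D x v) n"
  shows "higher_differentiable_on S f (Suc n)"
proof -
  have "frechet_derivative f (at x) = D x" if "x \<in> S" for x
    using frechet_derivative_at[OF assms(2)[OF that]] by simp
  then have "higher_differentiable_on S (\<lambda>x. frechet_derivative f (at x) v) n" for v
    using higher_differentiable_on_cong[OF assms(1), of "\<lambda>x. frechet_derivative f (at x) v" "\<lambda>x. D x v" n]
      assms(3) by auto
  then show ?thesis using assms(2) by (auto simp: differentiable_def)
qed

lemma higher_differentiable_on_has_derivative:
  "higher_differentiable_on S f (Suc n) \<Longrightarrow> x \<in> S \<Longrightarrow>
    (f has_derivative frechet_derivative f (at x)) (at x)"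
  by (simp add: frechet_derivative_works)

lemma higher_differentiable_on_const: "higher_differentiable_on S (\<lambda>_. c) n"
  by (induction n arbitrary: c) auto

lemma higher_differentiable_on_bounded_linear_comp:
  assumes "open S" "bounded_linear L"
  shows "higher_differentiable_on S f n \<Longrightarrow> higher_differentiable_on S (\<lambda>x. L (f x)) n"
proof (induction n arbitrary: f)
  case 0
  then show ?case using bounded_linear.continuous_on[OF assms(2)] by auto
next
  case (Suc n)
  show ?case
  proof (rule higher_differentiable_on_SucI[OF assms(1)])
    show "((\<lambda>x. L (f x)) has_derivative (\<lambda>v. L (frechet_derivative f (at x) v))) (at x)" if "x \<in> S" for x
      by (rule bounded_linear.has_derivative[OF assms(2)
            higher_differentiable_on_has_derivative[OF Suc.prems that]])
  qed (use Suc in auto)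
qed

lemma higher_differentiable_on_bounded_linear:
  assumes "open S" "bounded_linear L"
  shows "higher_differentiable_on S L n"
proof (cases n)
  case 0
  then show ?thesis using bounded_linear.continuous_on[OF assms(2) continuous_on_id] by auto
next
  case (Suc m)
  then show ?thesis
    using higher_differentiable_on_SucI[OF assms(1), of L "\<lambda>_. L" m]
      bounded_linear_imp_has_derivative[OF assms(2)] higher_differentiable_on_const by blast
qed

lemma higher_differentiable_on_add:
  assumes "open S"
  shows "higher_differentiable_on S f n \<Longrightarrow> higher_differentiable_on S g n \<Longrightarrow>
    higher_differentiable_on S (\<lambda>x. f x + g x) n"
proof (induction n arbitrary: f g)
  case 0
  then show ?case by (auto intro: continuous_on_add)
next
  case (Suc n)
  show ?case
  proof (rule higher_differentiable_on_SucI[OF assms(1)])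
    show "((\<lambda>x. f x + g x) has_derivative
        (\<lambda>v. frechet_derivative f (at x) v + frechet_derivative g (at x) v)) (at x)" if "x \<in> S" for x
      by (intro has_derivative_add higher_differentiable_on_has_derivative[OF Suc.prems(1) that]
          higher_differentiable_on_has_derivative[OF Suc.prems(2) that])
  qed (use Suc in auto)
qed

lemma higher_differentiable_on_sum:
  assumes "open S" "\<And>i. i \<in> I \<Longrightarrow> higher_differentiable_on S (f i) n"
  shows "higher_differentiable_on S (\<lambda>x. \<Sum>i\<in>I. f i x) n"
  using assms(2)
  by (induction I rule: infinite_finite_induct)
    (auto intro: higher_differentiable_on_add[OF assms(1)] higher_differentiable_on_const)

lemma higher_differentiable_on_bilinear:
  assumes "open S" "bounded_bilinear pr"
  shows "higher_differentiable_on S f n \<Longrightarrow> higher_differentiable_on S g n \<Longrightarrow>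
    higher_differentiable_on S (\<lambda>x. pr (f x) (g x)) n"
proof (induction n arbitrary: f g)
  case 0
  then show ?case using bounded_bilinear.continuous_on[OF assms(2)] by auto
next
  case (Suc n)
  show ?case
  proof (rule higher_differentiable_on_SucI[OF assms(1)])
    show "((\<lambda>x. pr (f x) (g x)) has_derivative
        (\<lambda>v. pr (f x) (frechet_derivative g (at x) v) + pr (frechet_derivative f (at x) v) (g x))) (at x)"
      if "x \<in> S" for x
      by (rule bounded_bilinear.FDERIV[OF assms(2) higher_differentiable_on_has_derivative[OF Suc.prems(1) that]
          higher_differentiable_on_has_derivative[OF Suc.prems(2) that]])
  next
    fix v
    show "higher_differentiable_on S
        (\<lambda>x. pr (f x) (frechet_derivative g (at x) v) + pr (frechet_derivative f (at x) v) (g x)) n"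
      by (rule higher_differentiable_on_add[OF assms(1)]; rule Suc.IH)
        (use Suc.prems higher_differentiable_on_SucD in auto)
  qed
qed

lemma higher_differentiable_on_compose:
  fixes f :: "'b::euclidean_space \<Rightarrow> 'c::real_normed_vector"
  assumes "open S" "open T" "g ` S \<subseteq> T"
  shows "higher_differentiable_on T f n \<Longrightarrow> higher_differentiable_on S g n \<Longrightarrow>
    higher_differentiable_on S (\<lambda>x. f (g x)) n"
proof (induction n arbitrary: f)
  case 0
  then show ?case using assms(3) by (auto intro: continuous_on_compose2)
next
  case (Suc n)
  \<comment> \<open>The chain rule is expanded in a basis: each summand contains a derivative of
    \<open>f\<close> in a fixed direction \<open>b\<close>, to which the induction hypothesis
    applies, whereas the direction given by the derivative of \<open>g\<close> varies with
    \<open>x\<close>.\<close>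
  let ?D = "\<lambda>x v. \<Sum>b\<in>Basis. (frechet_derivative g (at x) v \<bullet> b) *\<^sub>R frechet_derivative f (at (g x)) b"
  show ?case
  proof (rule higher_differentiable_on_SucI[OF assms(1)])
    fix x assume x: "x \<in> S"
    have f: "(f has_derivative frechet_derivative f (at (g x))) (at (g x))"
      using higher_differentiable_on_has_derivative[OF Suc.prems(1)] x assms(3) by blast
    then have lin: "linear (frechet_derivative f (at (g x)))"
      by (rule has_derivative_linear)
    have "((\<lambda>x. f (g x)) has_derivative (\<lambda>v. frechet_derivative f (at (g x)) (frechet_derivative g (at x) v))) (at x)"
      using has_derivative_compose[OF higher_differentiable_on_has_derivative[OF Suc.prems(2) x] f] .
    moreover have "frechet_derivative f (at (g x)) (frechet_derivative g (at x) v) = ?D x v" for v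
      using linear_sum[OF lin, of "\<lambda>b. (frechet_derivative g (at x) v \<bullet> b) *\<^sub>R b" Basis]
      by (simp add: euclidean_representation linear_scale[OF lin])
    ultimately show "((\<lambda>x. f (g x)) has_derivative ?D x) (at x)" by simp
  next
    fix v
    have g: "higher_differentiable_on S (\<lambda>x. frechet_derivative g (at x) v) n"
      and f: "higher_differentiable_on T (\<lambda>x. frechet_derivative f (at x) b) n" for b
      using Suc.prems by auto
    show "higher_differentiable_on S (\<lambda>x. ?D x v) n"
      by (intro higher_differentiable_on_sum[OF assms(1)]
          higher_differentiable_on_bilinear[OF assms(1) bounded_bilinear_scaleR]
          higher_differentiable_on_bounded_linear_comp[OF assms(1) bounded_linear_inner_left] g
          Suc.IH[OF f] higher_differentiable_on_SucD[OF Suc.prems(2)])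
  qed
qed

lemma higher_differentiable_on_inverse:
  fixes f :: "'a::real_normed_vector \<Rightarrow> 'b::real_normed_field"
  assumes "open S" "\<And>x. x \<in> S \<Longrightarrow> f x \<noteq> 0"
  shows "higher_differentiable_on S f n \<Longrightarrow> higher_differentiable_on S (\<lambda>x. inverse (f x)) n"
proof (induction n)
  case 0
  then show ?case using assms(2) by (auto intro: continuous_on_inverse)
next
  case (Suc n)
  show ?case
  proof (rule higher_differentiable_on_SucI[OF assms(1)])
    show "((\<lambda>x. inverse (f x)) has_derivative
        (\<lambda>v. - (inverse (f x) * frechet_derivative f (at x) v * inverse (f x)))) (at x)" if "x \<in> S" for x
      by (rule Deriv.has_derivative_inverse[OF assms(2)[OF that]
            higher_differentiable_on_has_derivative[OF Suc.prems that]])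
  next
    fix v
    note ih = Suc.IH[OF higher_differentiable_on_SucD[OF Suc.prems]]
    have "higher_differentiable_on S (\<lambda>x. frechet_derivative f (at x) v) n"
      using Suc.prems by auto
    then show "higher_differentiable_on S (\<lambda>x. - (inverse (f x) * frechet_derivative f (at x) v * inverse (f x))) n"
      by (intro higher_differentiable_on_bounded_linear_comp[OF assms(1) bounded_linear_minus[OF bounded_linear_ident]]
          higher_differentiable_on_bilinear[OF assms(1) bounded_bilinear_mult] ih)
  qed
qed

text \<open>Makes the quotients in Hadamard's lemma smooth. The factor \<open>t ^ j\<close> serves
  the induction: differentiating \<open>g (t *\<^sub>R x)\<close> with respect to \<open>x\<close>
  produces one more factor \<open>t\<close>.\<close>

lemma higher_differentiable_on_integral:
  fixes g :: "'a::euclidean_space \<Rightarrow> 'b::banach"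
  assumes "r > 0"
  shows "higher_differentiable_on (ball 0 r) g n \<Longrightarrow>
    higher_differentiable_on (ball 0 r) (\<lambda>x. integral {0..1} (\<lambda>t. t ^ j *\<^sub>R g (t *\<^sub>R x))) n"
proof (induction n arbitrary: g j)
  have in_ball: "t *\<^sub>R x \<in> ball 0 r" if "x \<in> ball 0 r" "t \<in> {0..1}" for t :: real and x :: 'a
    using that mult_right_mono[of t 1 "norm x"] by (auto simp: dist_norm)
  have cont: "continuous_on (ball 0 r \<times> cbox 0 1) (\<lambda>(x,t). t ^ j *\<^sub>R h (t *\<^sub>R x))"
    if "continuous_on (ball 0 r) h" for h :: "'a \<Rightarrow> 'c::real_normed_vector" and j
    using in_ball
    by (auto simp: split_beta intro!: continuous_intros continuous_on_compose2[OF that])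
  {
    case 0
    then have "continuous_on (ball 0 r) (\<lambda>x. integral (cbox 0 1) (\<lambda>t. t ^ j *\<^sub>R g (t *\<^sub>R x)))"
      by (intro integral_continuous_on_param cont) auto
    then show ?case by simp
  next
    case (Suc n)
    \<comment> \<open>The Leibniz rule asks for the derivative as a continuous map into the bounded
      linear maps; in finite dimension this continuity can be checked on one vector at a
      time.\<close>
    define D where "D y = Blinfun (frechet_derivative g (at y))" for y
    have g: "(g has_derivative frechet_derivative g (at y)) (at y)" if "y \<in> ball 0 r" for y
      by (rule higher_differentiable_on_has_derivative[OF Suc.prems that])
    have D: "blinfun_apply (D y) = frechet_derivative g (at y)" if "y \<in> ball 0 r" for y
      unfolding D_def by (rule bounded_linear_Blinfun_apply[OF has_derivative_bounded_linear[OF g[OF that]]])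
    have contD: "continuous_on (ball 0 r) D"
    proof (rule continuous_on_blinfun_componentwise)
      fix i :: 'a
      have "continuous_on (ball 0 r) (\<lambda>x. frechet_derivative g (at x) i)"
        using Suc.prems by (auto intro: higher_differentiable_on_continuous)
      then show "continuous_on (ball 0 r) (\<lambda>x. blinfun_apply (D x) i)"
        by (rule continuous_on_eq) (simp add: D)
    qed
    let ?fx = "\<lambda>x t. t ^ Suc j *\<^sub>R D (t *\<^sub>R x)"
    have contg: "continuous_on (ball 0 r) g"
      using higher_differentiable_on_continuous[OF Suc.prems] .
    have integ: "(\<lambda>t. t ^ j *\<^sub>R h (t *\<^sub>R x)) integrable_on cbox 0 1"
      if "continuous_on (ball 0 r) h" "x \<in> ball 0 r" for h :: "'a \<Rightarrow> 'c::banach" and x j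
      by (intro integrable_continuous continuous_intros continuous_on_compose2[OF that(1)])
        (use that in_ball in auto)
    show ?case
    proof (rule higher_differentiable_on_SucI)
      fix x :: 'a assume x: "x \<in> ball 0 r"
      have "((\<lambda>x. integral (cbox 0 1) (\<lambda>t. t ^ j *\<^sub>R g (t *\<^sub>R x))) has_derivative
          blinfun_apply (integral (cbox 0 1) (?fx x))) (at x within ball 0 r)"
      proof (rule leibniz_rule[where U = "ball 0 r"])
        fix x :: 'a and t :: real assume x: "x \<in> ball 0 r" and t: "t \<in> cbox 0 1"
        have "((\<lambda>x. g (t *\<^sub>R x)) has_derivative (\<lambda>v. frechet_derivative g (at (t *\<^sub>R x)) (t *\<^sub>R v))) (at x within ball 0 r)"
          by (rule has_derivative_at_withinI, rule has_derivative_compose[OF _ g])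
            (use x t in_ball in \<open>auto intro!: derivative_eq_intros\<close>)
        then have "((\<lambda>x. t ^ j *\<^sub>R g (t *\<^sub>R x)) has_derivative
            (\<lambda>v. t ^ j *\<^sub>R frechet_derivative g (at (t *\<^sub>R x)) (t *\<^sub>R v))) (at x within ball 0 r)"
          by (rule has_derivative_scaleR_right)
        moreover have "(\<lambda>v. t ^ j *\<^sub>R frechet_derivative g (at (t *\<^sub>R x)) (t *\<^sub>R v)) = blinfun_apply (?fx x t)"
          using x t in_ball
          by (auto simp: D[symmetric] blinfun.scaleR_left blinfun.scaleR_right mult.commute)
        ultimately show "((\<lambda>x. t ^ j *\<^sub>R g (t *\<^sub>R x)) has_derivative blinfun_apply (?fx x t)) (at x within ball 0 r)"
          by simp
      qed (use x integ contg cont[OF contD, of "Suc j"] in auto)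
      moreover have "blinfun_apply (integral (cbox 0 1) (?fx x)) v =
          integral {0..1} (\<lambda>t. t ^ Suc j *\<^sub>R frechet_derivative g (at (t *\<^sub>R x)) v)" for v
      proof -
        have "blinfun_apply (integral (cbox 0 1) (?fx x)) v = integral (cbox 0 1) ((\<lambda>b. blinfun_apply b v) \<circ> (?fx x))"
          by (rule integral_linear[symmetric, OF integ[OF contD x]])
            (rule blinfun.bounded_linear_left)
        also have "\<dots> = integral {0..1} (\<lambda>t. t ^ Suc j *\<^sub>R frechet_derivative g (at (t *\<^sub>R x)) v)"
          using x in_ball by (auto intro!: integral_cong simp: blinfun.scaleR_left D)
        finally show ?thesis .
      qed
      then have "blinfun_apply (integral (cbox 0 1) (?fx x)) =
          (\<lambda>v. integral {0..1} (\<lambda>t. t ^ Suc j *\<^sub>R frechet_derivative g (at (t *\<^sub>R x)) v))"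
        by auto
      ultimately show "((\<lambda>x. integral {0..1} (\<lambda>t. t ^ j *\<^sub>R g (t *\<^sub>R x))) has_derivative
          (\<lambda>v. integral {0..1} (\<lambda>t. t ^ Suc j *\<^sub>R frechet_derivative g (at (t *\<^sub>R x)) v))) (at x)"
        using x at_within_open[OF x open_ball] by (simp only: cbox_interval)
    next
      fix v
      have "higher_differentiable_on (ball 0 r) (\<lambda>x. frechet_derivative g (at x) v) n"
        using Suc.prems by auto
      then show "higher_differentiable_on (ball 0 r)
          (\<lambda>x. integral {0..1} (\<lambda>t. t ^ Suc j *\<^sub>R frechet_derivative g (at (t *\<^sub>R x)) v)) n"
        by (rule Suc.IH)
    qed simp
  }
qed

section \<open>Functions smooth near the origin, and Hadamard's lemma\<close>

lemma smooth_near_0I: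
  assumes "open U" "0 \<in> U" "\<And>n. higher_differentiable_on U f n"
  shows "smooth_near_0 f"
  using assms by (auto simp: smooth_near_0_def smooth_on_def)

lemma smooth_near_0E:
  assumes "smooth_near_0 f"
  obtains r where "r > 0" "\<And>n. higher_differentiable_on (ball 0 r) f n"
proof -
  obtain U where U: "open U" "0 \<in> U" "\<And>n. higher_differentiable_on U f n"
    using assms by (auto simp: smooth_near_0_def smooth_on_def)
  obtain r where "r > 0" "ball 0 r \<subseteq> U" using U(1,2) open_contains_ball by blast
  then show ?thesis using that U(3) higher_differentiable_on_subset by blast
qed

lemma smooth_near_0E2:
  fixes f :: "'a::real_normed_vector \<Rightarrow> 'b::real_normed_vector" and g :: "'a \<Rightarrow> 'c::real_normed_vector"
  assumes "smooth_near_0 f" "smooth_near_0 g"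
  obtains r where "r > 0" "\<And>n. higher_differentiable_on (ball 0 r) f n"
    "\<And>n. higher_differentiable_on (ball 0 r) g n"
proof -
  obtain r s where rs: "r > 0" "\<And>n. higher_differentiable_on (ball 0 r) f n"
    "s > 0" "\<And>n. higher_differentiable_on (ball 0 s) g n"
    by (meson smooth_near_0E assms)
  have "ball (0::'a) (min r s) \<subseteq> ball 0 r" "ball (0::'a) (min r s) \<subseteq> ball 0 s" by auto
  then show ?thesis
    using rs(1,3) higher_differentiable_on_subset[OF rs(2)] higher_differentiable_on_subset[OF rs(4)]
    by (intro that[of "min r s"]) simp_all
qed

lemma smooth_near_0_const: "smooth_near_0 (\<lambda>_. c)"
  using smooth_near_0I[of UNIV] higher_differentiable_on_const by blast

lemma smooth_near_0_bounded_linear: "bounded_linear L \<Longrightarrow> smooth_near_0 L"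
  using smooth_near_0I[of UNIV] higher_differentiable_on_bounded_linear by blast

lemma smooth_near_0_bounded_linear_comp:
  "bounded_linear L \<Longrightarrow> smooth_near_0 f \<Longrightarrow> smooth_near_0 (\<lambda>x. L (f x))"
  by (erule smooth_near_0E, rule smooth_near_0I[of "ball 0 _"])
    (auto intro: higher_differentiable_on_bounded_linear_comp)

lemma smooth_near_0_add:
  "smooth_near_0 f \<Longrightarrow> smooth_near_0 g \<Longrightarrow> smooth_near_0 (\<lambda>x. f x + g x)"
  by (erule (1) smooth_near_0E2, rule smooth_near_0I[of "ball 0 _"])
    (auto intro: higher_differentiable_on_add)

lemma smooth_near_0_bilinear:
  "bounded_bilinear pr \<Longrightarrow> smooth_near_0 f \<Longrightarrow> smooth_near_0 g \<Longrightarrow> smooth_near_0 (\<lambda>x. pr (f x) (g x))"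
  by (erule (1) smooth_near_0E2, rule smooth_near_0I[of "ball 0 _"])
    (auto intro: higher_differentiable_on_bilinear)

lemmas smooth_near_0_mult = smooth_near_0_bilinear[OF bounded_bilinear_mult]

lemma smooth_near_0_sum:
  "(\<And>i. i \<in> I \<Longrightarrow> smooth_near_0 (f i)) \<Longrightarrow> smooth_near_0 (\<lambda>x. \<Sum>i\<in>I. f i x)"
  by (induction I rule: infinite_finite_induct) (auto intro: smooth_near_0_add smooth_near_0_const)

lemma smooth_near_0_cong:
  assumes "smooth_near_0 f" "eq_near_0 f g"
  shows "smooth_near_0 g"
proof -
  obtain r where r: "r > 0" "\<And>n. higher_differentiable_on (ball 0 r) f n"
    using assms(1) smooth_near_0E by blast
  obtain S where S: "open S" "0 \<in> S" "\<And>x. x \<in> S \<Longrightarrow> f x = g x"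
    using assms(2) unfolding eq_near_0_def eventually_nhds by blast
  show ?thesis
  proof (rule smooth_near_0I[of "ball 0 r \<inter> S"])
    fix n
    have "higher_differentiable_on (ball 0 r \<inter> S) f n"
      using r(2) by (rule higher_differentiable_on_subset) simp
    then show "higher_differentiable_on (ball 0 r \<inter> S) g n"
      using higher_differentiable_on_cong[of "ball 0 r \<inter> S" f g n] S by auto
  qed (use r S in auto)
qed

lemma smooth_near_0_isCont: "smooth_near_0 f \<Longrightarrow> isCont f 0"
proof (erule smooth_near_0E)
  fix r :: real assume "r > 0" and "\<And>n. higher_differentiable_on (ball 0 r) f n"
  from this(1) this(2)[of 0] show "isCont f 0"
    using higher_differentiable_on_continuous[of "ball 0 r" f 0]
      continuous_on_eq_continuous_at[OF open_ball, of 0 r f] by simp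
qed

lemma smooth_near_0_filterlim:
  assumes "smooth_near_0 f" "f 0 = 0"
  shows "filterlim f (nhds 0) (nhds 0)"
proof -
  have "(f \<longlongrightarrow> f 0) (nhds 0)"
    using smooth_near_0_isCont[OF assms(1)] by (simp add: isCont_def tendsto_at_iff_tendsto_nhds)
  then show ?thesis by (simp add: assms(2))
qed

lemma smooth_near_0_compose:
  fixes f :: "'b::euclidean_space \<Rightarrow> 'c::real_normed_vector"
  assumes "smooth_near_0 f" "smooth_near_0 g" "g 0 = 0"
  shows "smooth_near_0 (\<lambda>x. f (g x))"
proof -
  obtain r s where rs: "r > 0" "\<And>n. higher_differentiable_on (ball 0 r) f n"
    "s > 0" "\<And>n. higher_differentiable_on (ball 0 s) g n"
    by (meson smooth_near_0E assms(1,2))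
  have "\<forall>\<^sub>F x in nhds 0. g x \<in> ball 0 r"
    using smooth_near_0_filterlim[OF assms(2,3)]
      eventually_nhds_in_open[OF open_ball centre_in_ball[THEN iffD2, OF rs(1)]]
    unfolding filterlim_iff by blast
  then obtain S where S: "open S" "0 \<in> S" "\<And>x. x \<in> S \<Longrightarrow> g x \<in> ball 0 r"
    unfolding eventually_nhds by blast
  show ?thesis
  proof (rule smooth_near_0I[of "ball 0 s \<inter> S"])
    fix n
    have "higher_differentiable_on (ball 0 s \<inter> S) g n"
      using rs(4) by (rule higher_differentiable_on_subset) simp
    then show "higher_differentiable_on (ball 0 s \<inter> S) (\<lambda>x. f (g x)) n"
      using S by (intro higher_differentiable_on_compose[OF _ open_ball _ rs(2)]) auto
  qed (use rs S in auto)
qed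

lemma smooth_near_0_inverse:
  fixes f :: "'a::real_normed_vector \<Rightarrow> 'b::real_normed_field"
  assumes "smooth_near_0 f" "f 0 \<noteq> 0"
  shows "smooth_near_0 (\<lambda>x. inverse (f x))" "\<forall>\<^sub>F x in nhds 0. f x \<noteq> 0"
proof -
  obtain r where r: "r > 0" "\<And>n. higher_differentiable_on (ball 0 r) f n"
    using assms(1) smooth_near_0E by blast
  have "f \<midarrow>0\<rightarrow> f 0" using smooth_near_0_isCont[OF assms(1)] by (simp add: isCont_def)
  then have "\<forall>\<^sub>F x in at 0. f x \<noteq> 0" using assms(2) by (rule tendsto_imp_eventually_ne)
  then show *: "\<forall>\<^sub>F x in nhds 0. f x \<noteq> 0"
    using assms(2) by (simp add: eventually_nhds_conv_at)
  then obtain S where S: "open S" "0 \<in> S" "\<And>x. x \<in> S \<Longrightarrow> f x \<noteq> 0"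
    unfolding eventually_nhds by blast
  show "smooth_near_0 (\<lambda>x. inverse (f x))"
  proof (rule smooth_near_0I[of "ball 0 r \<inter> S"])
    fix n
    have "higher_differentiable_on (ball 0 r \<inter> S) f n"
      using r(2) by (rule higher_differentiable_on_subset) simp
    then show "higher_differentiable_on (ball 0 r \<inter> S) (\<lambda>x. inverse (f x)) n"
      using S by (intro higher_differentiable_on_inverse) auto
  qed (use r S in auto)
qed

lemma smooth_near_0_frechet:
  assumes "smooth_near_0 f"
  shows "smooth_near_0 (\<lambda>x. frechet_derivative f (at x) v)"
proof -
  obtain r where r: "r > 0" "\<And>n. higher_differentiable_on (ball 0 r) f n"
    using assms smooth_near_0E by blast
  then show ?thesis
    by (intro smooth_near_0I[of "ball 0 r"]) (use r(2)[of "Suc n" for n] in simp_all)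
qed

lemma smooth_near_0_has_derivative:
  assumes "smooth_near_0 f"
  shows "\<forall>\<^sub>F x in nhds 0. (f has_derivative frechet_derivative f (at x)) (at x)"
proof -
  obtain r where r: "r > 0" "\<And>n. higher_differentiable_on (ball 0 r) f n"
    using assms smooth_near_0E by blast
  show ?thesis
    using eventually_nhds_in_open[OF open_ball centre_in_ball[THEN iffD2, OF r(1)]]
    by (rule eventually_mono) (rule higher_differentiable_on_has_derivative[OF r(2)[of "Suc 0"]])
qed

text \<open>The fundamental theorem of calculus along the segment from \<open>0\<close> to
  \<open>x\<close>: \<open>y b\<close> is the average over that segment of the derivative in
  direction \<open>b\<close>, and averaging preserves smoothness.\<close>

lemma smooth_near_0_hadamard:
  fixes f :: "'a::euclidean_space \<Rightarrow> 'b::{real_normed_field, banach}"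
  assumes "smooth_near_0 f"
  shows "\<exists>y. (\<forall>b. smooth_near_0 (y b)) \<and>
    (\<forall>\<^sub>F x in nhds 0. f x = f 0 + (\<Sum>b\<in>Basis. (x \<bullet> b) *\<^sub>R y b x))"
proof -
  obtain r where r: "r > 0" "\<And>n. higher_differentiable_on (ball 0 r) f n"
    using assms smooth_near_0E by blast
  define y where "y b x = integral {0..1} (\<lambda>t. t ^ 0 *\<^sub>R frechet_derivative f (at (t *\<^sub>R x)) b)" for b x
  have D: "higher_differentiable_on (ball 0 r) (\<lambda>x. frechet_derivative f (at x) b) n" for b n
    using r(2)[of "Suc n"] by auto
  have "smooth_near_0 (y b)" for b
    unfolding y_def
    by (intro smooth_near_0I[of "ball 0 r"] higher_differentiable_on_integral r(1) D)
      (use r(1) in auto)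
  moreover have eq: "f x = f 0 + (\<Sum>b\<in>Basis. (x \<bullet> b) *\<^sub>R y b x)" if x: "x \<in> ball 0 r" for x
  proof -
    have in_ball: "t *\<^sub>R x \<in> ball 0 r" if "t \<in> {0..1}" for t :: real
      using that x mult_right_mono[of t 1 "norm x"] by (auto simp: dist_norm)
    have f: "(f has_derivative frechet_derivative f (at y)) (at y)" if "y \<in> ball 0 r" for y
      by (rule higher_differentiable_on_has_derivative[OF r(2)[of "Suc 0"] that])
    have cont: "continuous_on {0..1} (\<lambda>t. frechet_derivative f (at (t *\<^sub>R x)) b)" for b
      by (rule continuous_on_compose2[OF higher_differentiable_on_continuous[OF D]])
        (use in_ball in \<open>auto intro!: continuous_intros\<close>)
    have eqz: "frechet_derivative f (at z) x = (\<Sum>b\<in>Basis. (x \<bullet> b) *\<^sub>R frechet_derivative f (at z) b)"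
      if "z \<in> ball 0 r" for z
    proof -
      have lin: "linear (frechet_derivative f (at z))" using f[OF that] by (rule has_derivative_linear)
      show ?thesis
        using linear_sum[OF lin, of "\<lambda>b. (x \<bullet> b) *\<^sub>R b" Basis]
        by (simp add: euclidean_representation linear_scale[OF lin])
    qed
    have "((\<lambda>t. f (t *\<^sub>R x)) has_vector_derivative frechet_derivative f (at (t *\<^sub>R x)) x) (at t within {0..1})"
      if t: "t \<in> {0..1}" for t
    proof -
      have lin: "linear (frechet_derivative f (at (t *\<^sub>R x)))" using f[OF in_ball[OF t]] by (rule has_derivative_linear)
      have "((\<lambda>t. f (t *\<^sub>R x)) has_derivative (\<lambda>s. frechet_derivative f (at (t *\<^sub>R x)) (s *\<^sub>R x))) (at t within {0..1})"
        by (rule has_derivative_compose[of "\<lambda>s. s *\<^sub>R x", OF _ f[OF in_ball[OF t]]]) (auto intro!: derivative_eq_intros)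
      then show ?thesis by (simp add: has_vector_derivative_def linear_scale[OF lin])
    qed
    then have "((\<lambda>t. frechet_derivative f (at (t *\<^sub>R x)) x) has_integral f (1 *\<^sub>R x) - f (0 *\<^sub>R x)) {0..1}"
      by (intro fundamental_theorem_of_calculus) auto
    then have "f x - f 0 = integral {0..1} (\<lambda>t. frechet_derivative f (at (t *\<^sub>R x)) x)"
      by (simp add: integral_unique)
    also have "\<dots> = integral {0..1} (\<lambda>t. \<Sum>b\<in>Basis. (x \<bullet> b) *\<^sub>R frechet_derivative f (at (t *\<^sub>R x)) b)"
      using in_ball by (intro integral_cong eqz) auto
    also have "\<dots> = (\<Sum>b\<in>Basis. (x \<bullet> b) *\<^sub>R y b x)"
      unfolding y_def
      by (subst integral_sum) (auto intro!: integrable_continuous_interval continuous_intros cont)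
    finally show ?thesis by (simp add: algebra_simps)
  qed
  moreover have "\<forall>\<^sub>F x in nhds 0. f x = f 0 + (\<Sum>b\<in>Basis. (x \<bullet> b) *\<^sub>R y b x)"
    using eventually_nhds_in_open[OF open_ball centre_in_ball[THEN iffD2, OF r(1)]]
    by (rule eventually_mono) (rule eq)
  ultimately show ?thesis by blast
qed

section \<open>Smooth germs and their order of vanishing\<close>

lemma germ_of_eq_iff: "germ_of f = germ_of g \<longleftrightarrow> (\<forall>\<^sub>F x in nhds 0. f x = g x)"
  by (simp add: germ.abs_eq_iff eq_near_0_def)

lemma germ_of_add: "germ_of f + germ_of g = germ_of (\<lambda>x. f x + g x)"
  by (simp add: plus_germ.abs_eq)

lemma germ_of_mult: "germ_of f * germ_of g = germ_of (\<lambda>x. f x * g x)"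
  by (simp add: times_germ.abs_eq)

lemma germ_of_minus: "germ_of f - germ_of g = germ_of (\<lambda>x. f x - g x)"
  by (simp add: minus_germ.abs_eq)

lemma germ_of_0: "germ_of (\<lambda>_. 0) = 0" and germ_of_1: "germ_of (\<lambda>_. 1) = 1"
  by (simp_all add: zero_germ.abs_eq one_germ.abs_eq)

lemma germ_of_sum: "(\<Sum>i\<in>I. germ_of (f i)) = germ_of (\<lambda>x. \<Sum>i\<in>I. f i x)"
  by (induction I rule: infinite_finite_induct) (auto simp: germ_of_0 germ_of_add)

definition smooth_germs :: "('a::real_normed_vector, 'b::real_normed_vector) germ set" where
  "smooth_germs = germ_of ` {f. smooth_near_0 f}"

text \<open>The \<open>k\<close>-th power of the maximal ideal, as \<open>vanishing_hadamard\<close>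
  and \<open>wmono_vanishing\<close> show. With a growth bound as its definition, products,
  pullbacks and real parts become estimates in which no derivative occurs.\<close>

definition vanishing :: "nat \<Rightarrow> ('a::real_normed_vector, 'b::real_normed_field) germ set" where
  "vanishing k = germ_of ` {f. smooth_near_0 f \<and> (\<exists>C. \<forall>\<^sub>F x in nhds 0. norm (f x) \<le> C * norm x ^ k)}"

definition const :: "'b \<Rightarrow> ('a::real_normed_vector, 'b) germ" where
  "const c = germ_of (\<lambda>_. c)"

definition coord :: "'n \<Rightarrow> (real ^ 'n, 'b::real_normed_field) germ" where
  "coord i = germ_of (\<lambda>x. of_real (x $ i))"

text \<open>Monomials are indexed by words, so that permuted words give the same germ. The
  redundancy makes it easy to split off one letter; unique coefficients are recovered later by
  \<open>independent_spanning_words\<close>.\<close>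

definition wmono :: "'n list \<Rightarrow> (real ^ 'n, 'b::real_normed_field) germ" where
  "wmono l = prod_list (map coord l)"

lemma smooth_germsE:
  assumes "F \<in> smooth_germs"
  obtains f where "F = germ_of f" "smooth_near_0 f"
  using assms by (auto simp: smooth_germs_def)

lemma germ_of_in_smooth_germs_iff: "germ_of f \<in> smooth_germs \<longleftrightarrow> smooth_near_0 f"
  by (auto simp: smooth_germs_def germ.abs_eq_iff intro: smooth_near_0_cong)
    (metis (mono_tags, lifting) eq_near_0_def eventually_mono smooth_near_0_cong)

lemma smooth_germs_add: "F \<in> smooth_germs \<Longrightarrow> G \<in> smooth_germs \<Longrightarrow> F + G \<in> smooth_germs"
  by (auto elim!: smooth_germsE simp: germ_of_add germ_of_in_smooth_germs_iff intro: smooth_near_0_add)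

lemma smooth_germs_mult:
  "F \<in> smooth_germs \<Longrightarrow> G \<in> smooth_germs \<Longrightarrow> F * G \<in> (smooth_germs :: (_, 'b::real_normed_field) germ set)"
  by (auto elim!: smooth_germsE simp: germ_of_mult germ_of_in_smooth_germs_iff intro: smooth_near_0_mult)

lemma smooth_germs_const: "const c \<in> smooth_germs"
  by (simp add: const_def germ_of_in_smooth_germs_iff smooth_near_0_const)

lemma const_add: "const (a + b) = const a + const b"
  and const_mult: "const (a * b) = const a * const b"
  and const_minus: "const (a - b) = const a - const b"
  and const_uminus: "const (- a) = - const a"
  and const_0: "const 0 = 0" and const_1: "const 1 = 1"
  by (simp_all add: const_def germ_of_add germ_of_mult germ_of_minus germ_of_0 germ_of_1 uminus_germ.abs_eq)

lemma const_sum: "const (\<Sum>i\<in>I. f i) = (\<Sum>i\<in>I. const (f i))"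
  by (induction I rule: infinite_finite_induct) (auto simp: const_0 const_add)

lemma smooth_germs_0: "0 \<in> smooth_germs" and smooth_germs_1: "1 \<in> smooth_germs"
  by (metis const_0 const_1 smooth_germs_const)+

lemma smooth_germs_uminus: "F \<in> smooth_germs \<Longrightarrow> - F \<in> (smooth_germs :: (_, 'b::real_normed_field) germ set)"
  using smooth_germs_mult[OF smooth_germs_const[of "-1"], of F] by (simp add: const_uminus const_1)

lemma smooth_germs_diff:
  "F \<in> smooth_germs \<Longrightarrow> G \<in> smooth_germs \<Longrightarrow> F - G \<in> (smooth_germs :: (_, 'b::real_normed_field) germ set)"
  using smooth_germs_add[OF _ smooth_germs_uminus] by fastforce

lemma smooth_germs_sum: "(\<And>i. i \<in> I \<Longrightarrow> F i \<in> smooth_germs) \<Longrightarrow> (\<Sum>i\<in>I. F i) \<in> smooth_germs"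
  by (induction I rule: infinite_finite_induct) (auto intro: smooth_germs_add smooth_germs_0)

lemma smooth_near_0_coord: "smooth_near_0 (\<lambda>x. of_real (x $ i))"
  by (intro smooth_near_0_bounded_linear bounded_linear_compose[OF bounded_linear_of_real bounded_linear_vec_nth])

lemma smooth_germs_coord: "coord i \<in> smooth_germs"
  by (simp add: coord_def germ_of_in_smooth_germs_iff smooth_near_0_coord)

lemma smooth_germs_wmono: "wmono l \<in> smooth_germs"
  by (induction l) (auto simp: wmono_def intro: smooth_germs_1 smooth_germs_mult smooth_germs_coord)

lemmas smooth_germs_intros = smooth_germs_add smooth_germs_mult smooth_germs_const smooth_germs_0
  smooth_germs_1 smooth_germs_uminus smooth_germs_diff smooth_germs_sum smooth_germs_coord smooth_germs_wmono

lemma vanishingE: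
  assumes "F \<in> vanishing k"
  obtains f C where "F = germ_of f" "smooth_near_0 f" "\<forall>\<^sub>F x in nhds 0. norm (f x) \<le> C * norm x ^ k"
  using assms by (auto simp: vanishing_def)

lemma vanishingI:
  "smooth_near_0 f \<Longrightarrow> \<forall>\<^sub>F x in nhds 0. norm (f x) \<le> C * norm x ^ k \<Longrightarrow> germ_of f \<in> vanishing k"
  by (auto simp: vanishing_def)

lemma germ_of_vanishingD:
  assumes "germ_of f \<in> vanishing k"
  shows "\<exists>C. \<forall>\<^sub>F x in nhds 0. norm (f x) \<le> C * norm x ^ k"
proof -
  obtain g C where g: "germ_of f = germ_of g" "\<forall>\<^sub>F x in nhds 0. norm (g x) \<le> C * norm x ^ k"
    using assms by (auto elim: vanishingE)
  from g(1) have "\<forall>\<^sub>F x in nhds 0. f x = g x" by (simp add: germ_of_eq_iff)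
  with g(2) have "\<forall>\<^sub>F x in nhds 0. norm (f x) \<le> C * norm x ^ k" by eventually_elim simp
  then show ?thesis ..
qed

lemma vanishing_smooth: "F \<in> vanishing k \<Longrightarrow> F \<in> smooth_germs"
  by (auto simp: vanishing_def smooth_germs_def)

lemma vanishing_zero_eq: "vanishing 0 = smooth_germs"
proof (intro equalityI subsetI)
  fix F :: "('a, 'b) germ" assume "F \<in> smooth_germs"
  then obtain f where f: "F = germ_of f" "smooth_near_0 f" by (rule smooth_germsE)
  have "\<forall>\<^sub>F x in nhds 0. dist (f x) (f 0) < 1"
    using tendstoD[OF smooth_near_0_isCont[OF f(2), unfolded isCont_def], of 1]
    by (simp add: eventually_nhds_conv_at)
  then have "\<forall>\<^sub>F x in nhds 0. norm (f x) \<le> (norm (f 0) + 1) * norm x ^ 0"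
  proof eventually_elim
    case (elim x)
    then show ?case using norm_triangle_ineq2[of "f x" "f 0"] by (simp add: dist_norm)
  qed
  then show "F \<in> vanishing 0" using f by (auto intro: vanishingI)
qed (rule vanishing_smooth)

lemma vanishing_add:
  assumes "F \<in> vanishing k" "G \<in> vanishing k"
  shows "F + G \<in> vanishing k"
proof -
  obtain f C where f: "F = germ_of f" "smooth_near_0 f" "\<forall>\<^sub>F x in nhds 0. norm (f x) \<le> C * norm x ^ k"
    using assms(1) by (rule vanishingE)
  obtain g D where g: "G = germ_of g" "smooth_near_0 g" "\<forall>\<^sub>F x in nhds 0. norm (g x) \<le> D * norm x ^ k"
    using assms(2) by (rule vanishingE)
  have "\<forall>\<^sub>F x in nhds 0. norm (f x + g x) \<le> (C + D) * norm x ^ k"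
    using f(3) g(3)
  proof eventually_elim
    case (elim x)
    then show ?case using norm_triangle_ineq[of "f x" "g x"] by (simp add: distrib_right)
  qed
  then show ?thesis using f(1,2) g(1,2) by (auto simp: germ_of_add intro: vanishingI smooth_near_0_add)
qed

lemma vanishing_mult:
  assumes "F \<in> vanishing j" "G \<in> vanishing k"
  shows "F * G \<in> vanishing (j + k)"
proof -
  obtain f C where f: "F = germ_of f" "smooth_near_0 f" "\<forall>\<^sub>F x in nhds 0. norm (f x) \<le> C * norm x ^ j"
    using assms(1) by (rule vanishingE)
  obtain g D where g: "G = germ_of g" "smooth_near_0 g" "\<forall>\<^sub>F x in nhds 0. norm (g x) \<le> D * norm x ^ k"
    using assms(2) by (rule vanishingE)
  have "\<forall>\<^sub>F x in nhds 0. norm (f x * g x) \<le> (C * D) * norm x ^ (j + k)"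
    using f(3) g(3)
  proof eventually_elim
    case (elim x)
    then have "norm (f x) * norm (g x) \<le> (C * norm x ^ j) * (D * norm x ^ k)"
      by (intro mult_mono) (auto intro: order_trans[OF norm_ge_zero])
    then show ?case by (simp add: norm_mult power_add mult_ac)
  qed
  then show ?thesis using f(1,2) g(1,2) by (auto simp: germ_of_mult intro: vanishingI smooth_near_0_mult)
qed

lemma vanishing_smooth_mult: "F \<in> smooth_germs \<Longrightarrow> G \<in> vanishing k \<Longrightarrow> F * G \<in> vanishing k"
  using vanishing_mult[of F 0 G k] by (simp add: vanishing_zero_eq)

lemma vanishing_mult_smooth: "F \<in> vanishing k \<Longrightarrow> G \<in> smooth_germs \<Longrightarrow> F * G \<in> vanishing k"
  using vanishing_smooth_mult[of G F k] by (simp add: mult.commute)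

lemma vanishing_0: "0 \<in> vanishing k"
  unfolding germ_of_0[symmetric] by (rule vanishingI[where C = 0]) (auto intro: smooth_near_0_const)

lemma vanishing_uminus: "F \<in> vanishing k \<Longrightarrow> - F \<in> vanishing k"
  using vanishing_smooth_mult[OF smooth_germs_const[of "-1"], of F k] by (simp add: const_uminus const_1)

lemma vanishing_diff: "F \<in> vanishing k \<Longrightarrow> G \<in> vanishing k \<Longrightarrow> F - G \<in> vanishing k"
  using vanishing_add[OF _ vanishing_uminus] by fastforce

lemma vanishing_sum: "(\<And>i. i \<in> I \<Longrightarrow> F i \<in> vanishing k) \<Longrightarrow> (\<Sum>i\<in>I. F i) \<in> vanishing k"
  by (induction I rule: infinite_finite_induct) (auto intro: vanishing_add vanishing_0)

lemma vanishing_antimono: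
  assumes "j \<le> k" shows "vanishing k \<subseteq> vanishing j"
proof
  fix F :: "('a, 'b) germ" assume "F \<in> vanishing k"
  then obtain f C where f: "F = germ_of f" "smooth_near_0 f" "\<forall>\<^sub>F x in nhds 0. norm (f x) \<le> C * norm x ^ k"
    by (rule vanishingE)
  have "\<forall>\<^sub>F x in nhds (0::'a). x \<in> ball 0 1"
    by (rule eventually_nhds_in_open) auto
  with f(3) have "\<forall>\<^sub>F x in nhds 0. norm (f x) \<le> \<bar>C\<bar> * norm x ^ j"
  proof eventually_elim
    case (elim x)
    have "C * norm x ^ k \<le> \<bar>C\<bar> * norm x ^ j"
      using elim(2) assms by (intro mult_mono power_decreasing) auto
    then show ?case using elim(1) by linarith
  qed
  then show "F \<in> vanishing j" using f by (auto intro: vanishingI)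
qed

lemma coord_vanishing: "coord i \<in> vanishing 1"
  unfolding coord_def
  by (rule vanishingI[where C = 1, OF smooth_near_0_coord]) (auto simp: component_le_norm_cart)

lemma wmono_vanishing: "wmono l \<in> vanishing (length l)"
proof (induction l)
  case Nil
  then show ?case by (simp add: wmono_def vanishing_zero_eq smooth_germs_1)
next
  case (Cons i l)
  then show ?case using vanishing_mult[OF coord_vanishing[of i], of "wmono l" "length l"] by (simp add: wmono_def)
qed

text \<open>The ring of germs is local, the ingredient of Nakayama's lemma: a germ with nonzero
  value at the origin is nonzero nearby, and its reciprocal is smooth.\<close>

lemma smooth_germ_inverse:
  assumes "F \<in> vanishing 1" "c \<noteq> 0"
  shows "\<exists>G\<in>smooth_germs. G * (const c + F) = 1"
proof -
  obtain f C where f: "F = germ_of f" "smooth_near_0 f" "\<forall>\<^sub>F x in nhds 0. norm (f x) \<le> C * norm x ^ 1"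
    using assms(1) by (rule vanishingE)
  \<comment> \<open>The bound holds at the origin itself, where its right-hand side is zero.\<close>
  have "f 0 = 0" using eventually_nhds_x_imp_x[OF f(3)] by simp
  then have nz: "c + f 0 \<noteq> 0" using assms(2) by simp
  have s: "smooth_near_0 (\<lambda>x. c + f x)" using f(2) by (intro smooth_near_0_add smooth_near_0_const)
  have "\<forall>\<^sub>F x in nhds 0. inverse (c + f x) * (c + f x) = 1"
    using smooth_near_0_inverse(2)[OF s nz] by eventually_elim simp
  then have "germ_of (\<lambda>x. inverse (c + f x)) * (const c + F) = 1"
    by (simp add: f(1) const_def germ_of_add germ_of_mult germ_of_1[symmetric] germ_of_eq_iff)
  then show ?thesis using smooth_near_0_inverse(1)[OF s nz] germ_of_in_smooth_germs_iff by blast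
qed

lemma smooth_germ_hadamard:
  fixes F :: "(real ^ 'n, 'b::{real_normed_field, banach}) germ"
  assumes "F \<in> smooth_germs"
  shows "\<exists>c y. (\<forall>i. y i \<in> smooth_germs) \<and> F = const c + (\<Sum>i\<in>UNIV. coord i * y i)"
proof -
  obtain f where f: "F = germ_of f" "smooth_near_0 f" using assms by (rule smooth_germsE)
  obtain y where y: "\<And>b. smooth_near_0 (y b)"
    "\<forall>\<^sub>F x in nhds 0. f x = f 0 + (\<Sum>b\<in>Basis. (x \<bullet> b) *\<^sub>R y b x)"
    using smooth_near_0_hadamard[OF f(2)] by blast
  have "(\<Sum>b\<in>Basis. (x \<bullet> b) *\<^sub>R y b x) = (\<Sum>i\<in>UNIV. of_real (x $ i) * y (axis i 1) x)" for x
  proof -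
    have B: "(Basis :: (real ^ 'n) set) = (\<lambda>i. axis i 1) ` UNIV"
      by (auto simp: Basis_vec_def)
    have inj: "inj (\<lambda>i::'n. axis i (1::real))" by (simp add: inj_on_def axis_eq_axis)
    show ?thesis
      by (simp add: B sum.reindex[OF inj] inner_axis scaleR_conv_of_real)
  qed
  then have "F = const (f 0) + (\<Sum>i\<in>UNIV. coord i * germ_of (y (axis i 1)))"
    using y(2) by (simp add: f(1) const_def coord_def germ_of_mult germ_of_sum germ_of_add germ_of_eq_iff)
  then show ?thesis
    using y(1) by (intro exI[of _ "f 0"] exI[of _ "\<lambda>i. germ_of (y (axis i 1))"])
      (auto simp: germ_of_in_smooth_germs_iff)
qed

section \<open>Taylor expansion over words in the coordinates\<close>

abbreviation words :: "nat \<Rightarrow> 'n::finite list set" where "words k \<equiv> {l. length l = k}"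

abbreviation short_words :: "nat \<Rightarrow> 'n::finite list set" where "short_words k \<equiv> {l. length l < k}"

lemma finite_words: "finite (words k)"
  using finite_lists_length_eq[OF finite[of UNIV], of k] by simp

lemma finite_short_words: "finite (short_words k)"
  using finite_lists_length_le[OF finite[of UNIV], of k] by (rule finite_subset[rotated]) auto

lemma sum_words_Suc: "(\<Sum>l\<in>words (Suc k). g l) = (\<Sum>l\<in>words k. \<Sum>i\<in>UNIV. g (i # l))"
  for g :: "'n::finite list \<Rightarrow> 'a::comm_monoid_add"
proof -
  have "words (Suc k) = (\<lambda>(l, i). i # l) ` (words k \<times> (UNIV :: 'n set))"
    by (force simp: length_Suc_conv)
  then have "(\<Sum>l\<in>words (Suc k). g l) = sum (g \<circ> (\<lambda>(l, i). i # l)) (words k \<times> UNIV)"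
    by (simp add: sum.reindex inj_on_def split_beta prod_eq_iff)
  also have "\<dots> = (\<Sum>l\<in>words k. \<Sum>i\<in>UNIV. g (i # l))"
    by (simp add: sum.cartesian_product split_beta)
  finally show ?thesis .
qed

text \<open>Hadamard's lemma is applied again to each remainder germ \<open>y l\<close>: its value
  at the origin becomes the coefficient of \<open>l\<close>, and each coordinate that it splits off
  is prepended to \<open>l\<close>.\<close>

lemma smooth_germ_taylor:
  fixes F :: "(real ^ 'n, 'b::{real_normed_field, banach}) germ"
  assumes "F \<in> smooth_germs"
  shows "\<exists>c y. (\<forall>l. y l \<in> smooth_germs) \<and>
    F = (\<Sum>l\<in>short_words k. const (c l) * wmono l) + (\<Sum>l\<in>words k. wmono l * y l)"
proof (induction k)
  case 0
  show ?case using assms by (intro exI[of _ "\<lambda>_. 0"] exI[of _ "\<lambda>_. F"]) (simp add: wmono_def)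
next
  case (Suc k)
  then obtain c y where y: "\<And>l. y l \<in> smooth_germs"
    "F = (\<Sum>l\<in>short_words k. const (c l) * wmono l) + (\<Sum>l\<in>words k. wmono l * y l)" by blast
  have "\<forall>l. \<exists>d z. (\<forall>i. z i \<in> smooth_germs) \<and> y l = const d + (\<Sum>i\<in>UNIV. coord i * z i)"
    using smooth_germ_hadamard y(1) by blast
  then obtain d z where z: "\<And>l i. z l i \<in> smooth_germs"
    "\<And>l. y l = const (d l) + (\<Sum>i\<in>UNIV. coord i * z l i)" by metis
  have "short_words (Suc k) = short_words k \<union> (words k :: 'n list set)" by auto
  then have split: "(\<Sum>l\<in>short_words (Suc k). g l) = (\<Sum>l\<in>short_words k. g l) + (\<Sum>l\<in>words k. g l)"
    for g :: "'n list \<Rightarrow> (real ^ 'n, 'b) germ"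
    by (simp only:) (rule sum.union_disjoint, auto simp: finite_words finite_short_words)
  let ?c = "\<lambda>l. if length l < k then c l else d l"
  have "(\<Sum>l\<in>words k. wmono l * y l) = (\<Sum>l\<in>words k. const (d l) * wmono l) +
      (\<Sum>l\<in>words (Suc k). wmono l * z (tl l) (hd l))"
    unfolding sum_words_Suc sum.distrib[symmetric]
    by (intro sum.cong) (auto simp: z(2) wmono_def algebra_simps sum_distrib_left)
  moreover have "(\<Sum>l\<in>short_words k. const (c l) * wmono l) = (\<Sum>l\<in>short_words k. const (?c l) * wmono l)"
    and "(\<Sum>l\<in>words k. const (d l) * wmono l) = (\<Sum>l\<in>words k. const (?c l) * wmono l)"
    by (auto intro: sum.cong)
  ultimately have "F = (\<Sum>l\<in>short_words (Suc k). const (?c l) * wmono l) +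
      (\<Sum>l\<in>words (Suc k). wmono l * z (tl l) (hd l))"
    by (simp only: y(2) split add.assoc)
  then show ?case
    using z(1) by (intro exI[of _ ?c] exI[of _ "\<lambda>l. z (tl l) (hd l)"] conjI allI)
qed

text \<open>The limit at \<open>0\<close> gives \<open>a 0 = 0\<close>; cancelling \<open>t\<close>
  then lowers both the degree and the exponent of the bound. Only positive \<open>t\<close> are
  considered, so that \<open>t\<close> can be cancelled in the inequality.\<close>

lemma small_poly_zero:
  fixes a :: "nat \<Rightarrow> 'b::real_normed_field"
  assumes "\<forall>\<^sub>F t in at_right 0. norm (\<Sum>j<k. of_real t ^ j * a j) \<le> C * t ^ k" "j < k"
  shows "a j = 0"
  using assms
proof (induction k arbitrary: a j)
  case (Suc k)
  have split: "(\<Sum>j<Suc k. of_real t ^ j * a j) = a 0 + of_real t * (\<Sum>j<k. of_real t ^ j * a (Suc j))" for t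
    unfolding sum.lessThan_Suc_shift by (simp add: sum_distrib_left mult.assoc)
  have "((\<lambda>t. norm (\<Sum>j<Suc k. of_real t ^ j * a j)) \<longlongrightarrow> norm (\<Sum>j<Suc k. of_real 0 ^ j * a j)) (at_right 0)"
    by (intro tendsto_intros)
  moreover have "((\<lambda>t. C * t ^ Suc k) \<longlongrightarrow> C * 0 ^ Suc k) (at_right 0)"
    by (intro tendsto_intros)
  ultimately have "norm (\<Sum>j<Suc k. of_real 0 ^ j * a j) \<le> C * 0 ^ Suc k"
    using Suc.prems(1) by (intro tendsto_le[OF trivial_limit_at_right_real]) auto
  then have a0: "a 0 = 0" unfolding split by simp
  have "\<forall>\<^sub>F t in at_right 0. norm (\<Sum>j<k. of_real t ^ j * a (Suc j)) \<le> C * t ^ k"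
    using Suc.prems(1) eventually_at_right_less[of 0]
  proof eventually_elim
    case (elim t)
    then have "t * norm (\<Sum>j<k. of_real t ^ j * a (Suc j)) \<le> t * (C * t ^ k)"
      unfolding split by (simp add: a0 norm_mult mult_ac)
    then show ?case using elim(2) by (simp add: mult_le_cancel_left)
  qed
  then have "a (Suc j) = 0" if "j < k" for j using Suc.IH[of "\<lambda>j. a (Suc j)"] that by blast
  then show ?case using a0 Suc.prems(2) by (cases j) auto
qed simp

lemma wmono_germ_of: "wmono l = germ_of (\<lambda>x. \<Prod>i\<leftarrow>l. of_real (x $ i))"
  by (induction l) (auto simp: wmono_def germ_of_1 coord_def germ_of_mult)

text \<open>On the ray through \<open>x\<close> the sum is a polynomial in \<open>t\<close> whose
  coefficients are the homogeneous parts at \<open>x\<close>, and \<open>small_poly_zero\<close>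
  applies. The conclusion concerns the germ and not the coefficients \<open>c l\<close>, because
  distinct words may denote the same monomial.\<close>

lemma small_poly_germ_zero:
  fixes c :: "'n::finite list \<Rightarrow> 'b::real_normed_field"
  assumes "(\<Sum>l\<in>short_words k. const (c l) * wmono l) \<in> (vanishing k :: (real ^ 'n, 'b) germ set)"
  shows "(\<Sum>l\<in>short_words k. const (c l) * wmono l) = (0 :: (real ^ 'n, 'b) germ)"
proof -
  let ?m = "\<lambda>l (x::real^'n). \<Prod>i\<leftarrow>l. of_real (x $ i) :: 'b"
  let ?p = "\<lambda>x. \<Sum>l\<in>short_words k. c l * ?m l x"
  have eq: "(\<Sum>l\<in>short_words k. const (c l) * wmono l) = germ_of ?p"
    by (simp add: wmono_germ_of const_def germ_of_mult germ_of_sum)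
  have "germ_of ?p \<in> vanishing k" using assms unfolding eq .
  from germ_of_vanishingD[OF this]
  obtain C where C: "\<forall>\<^sub>F x in nhds 0. norm (?p x) \<le> C * norm x ^ k" ..
  have "?p x = 0" for x
  proof -
    define a where "a j = (\<Sum>l\<in>words j. c l * ?m l x)" for j
    have scale: "?m l (t *\<^sub>R x) = of_real t ^ length l * ?m l x" for t l
      by (induction l) (auto simp: mult_ac)
    have p: "?p (t *\<^sub>R x) = (\<Sum>j<k. of_real t ^ j * a j)" for t
    proof -
      have "short_words k = (\<Union>j\<in>{..<k}. words j :: 'n list set)" by auto
      then have "?p (t *\<^sub>R x) = (\<Sum>j<k. \<Sum>l\<in>words j. c l * ?m l (t *\<^sub>R x))"
        by (simp only:) (rule sum.UNION_disjoint, auto simp: finite_words)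
      also have "\<dots> = (\<Sum>j<k. of_real t ^ j * a j)"
        unfolding a_def scale sum_distrib_left by (intro sum.cong) auto
      finally show ?thesis .
    qed
    have "filterlim (\<lambda>t. t *\<^sub>R x) (nhds (0 *\<^sub>R x)) (at_right 0)" by (intro tendsto_intros)
    then have "\<forall>\<^sub>F t in at_right 0. norm (?p (t *\<^sub>R x)) \<le> C * norm (t *\<^sub>R x) ^ k"
      using C unfolding filterlim_iff scaleR_zero_left by blast
    then have "\<forall>\<^sub>F t in at_right 0. norm (\<Sum>j<k. of_real t ^ j * a j) \<le> (C * norm x ^ k) * t ^ k"
      unfolding p using eventually_at_right_less[of 0]
      by eventually_elim (simp add: power_mult_distrib mult_ac)
    then have "a j = 0" if "j < k" for j using small_poly_zero that by blast
    then show ?thesis using p[of 1] by simp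
  qed
  then have "germ_of ?p = 0" by (simp add: germ_of_0)
  then show ?thesis unfolding eq .
qed

text \<open>The Taylor polynomial of \<open>F\<close> is the difference of \<open>F\<close> and a
  remainder of order \<open>k\<close>. It is therefore itself of order \<open>k\<close>, hence zero,
  and only the remainder is left.\<close>

lemma vanishing_hadamard:
  fixes F :: "(real ^ 'n, 'b::{real_normed_field, banach}) germ"
  assumes "F \<in> vanishing k"
  shows "\<exists>y. (\<forall>l. y l \<in> smooth_germs) \<and> F = (\<Sum>l\<in>words k. wmono l * y l)"
proof -
  obtain c y where y: "\<And>l. y l \<in> smooth_germs"
    "F = (\<Sum>l\<in>short_words k. const (c l) * wmono l) + (\<Sum>l\<in>words k. wmono l * y l)"
    using smooth_germ_taylor[OF vanishing_smooth[OF assms]] by blast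
  have "wmono l * y l \<in> vanishing k" if "l \<in> words k" for l
    using vanishing_mult_smooth[OF wmono_vanishing y(1)] that by force
  then have "F - (\<Sum>l\<in>words k. wmono l * y l) \<in> vanishing k"
    by (intro vanishing_diff assms vanishing_sum) auto
  then have "(\<Sum>l\<in>short_words k. const (c l) * wmono l) = (0 :: (real ^ 'n, 'b) germ)"
    by (intro small_poly_germ_zero) (simp add: y(2))
  then show ?thesis using y by auto
qed

text \<open>Replacing each cofactor of a word by its value at the origin costs one order. This
  homogeneous leading part is the handle for inductions that raise the order of vanishing.\<close>

lemma vanishing_leading:
  fixes F :: "(real ^ 'n, 'b::{real_normed_field, banach}) germ"
  assumes "F \<in> vanishing k"
  shows "\<exists>c. F - (\<Sum>l\<in>words k. const (c l) * wmono l) \<in> vanishing (Suc k)"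
proof -
  obtain y where y: "\<And>l. y l \<in> smooth_germs" "F = (\<Sum>l\<in>words k. wmono l * y l)"
    using vanishing_hadamard[OF assms] by blast
  have "\<exists>c. y l - const c \<in> vanishing 1" for l
  proof -
    obtain c z where z: "\<And>i. z i \<in> smooth_germs" "y l = const c + (\<Sum>i\<in>UNIV. coord i * z i)"
      using smooth_germ_hadamard[OF y(1)] by metis
    have "(\<Sum>i\<in>UNIV. coord i * z i) \<in> vanishing 1"
      by (intro vanishing_sum vanishing_mult_smooth coord_vanishing z(1))
    then show ?thesis using z(2) by (intro exI[of _ c]) simp
  qed
  then obtain c where c: "\<And>l. y l - const (c l) \<in> vanishing 1" by metis
  have "(\<Sum>l\<in>words k. wmono l * (y l - const (c l))) \<in> vanishing (Suc k)"
    using vanishing_mult[OF wmono_vanishing c] by (intro vanishing_sum) force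
  then show ?thesis
    by (intro exI[of _ c]) (simp add: y(2) sum_subtractf algebra_simps)
qed

section \<open>Noetherian rings of functions\<close>

definition subring_set :: "'r::comm_ring_1 set \<Rightarrow> bool" where
  "subring_set A \<longleftrightarrow> 0 \<in> A \<and> 1 \<in> A \<and> (\<forall>x\<in>A. - x \<in> A) \<and> (\<forall>x\<in>A. \<forall>y\<in>A. x + y \<in> A \<and> x * y \<in> A)"

text \<open>Built up one multiple at a time, so that rule induction takes the place of computations
  with finite linear combinations.\<close>

inductive_set ideal_gen :: "'r::comm_ring_1 set \<Rightarrow> 'r set \<Rightarrow> 'r set" for A S where
  ideal_gen_0: "0 \<in> ideal_gen A S"
| ideal_gen_step: "x \<in> ideal_gen A S \<Longrightarrow> a \<in> A \<Longrightarrow> s \<in> S \<Longrightarrow> x + a * s \<in> ideal_gen A S"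

text \<open>The generators have to come from \<open>S\<close> itself: the bound on the multiplicity
  rests on finitely many of the given determinants, each of which carries its own bound.\<close>

definition noetherian_set :: "'r::comm_ring_1 set \<Rightarrow> bool" where
  "noetherian_set A \<longleftrightarrow> subring_set A \<and> (\<forall>S\<subseteq>A. \<exists>F. finite F \<and> F \<subseteq> S \<and> S \<subseteq> ideal_gen A F)"

lemma subring_setD:
  assumes "subring_set A"
  shows "0 \<in> A" "1 \<in> A" "x \<in> A \<Longrightarrow> - x \<in> A" "x \<in> A \<Longrightarrow> y \<in> A \<Longrightarrow> x + y \<in> A"
    "x \<in> A \<Longrightarrow> y \<in> A \<Longrightarrow> x * y \<in> A" "x \<in> A \<Longrightarrow> y \<in> A \<Longrightarrow> x - y \<in> A"
  using assms unfolding subring_set_def by (simp_all, metis add_uminus_conv_diff)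

lemma subring_set_sum:
  assumes "subring_set A" "\<And>i. i \<in> I \<Longrightarrow> f i \<in> A"
  shows "(\<Sum>i\<in>I. f i) \<in> A"
  using assms(2) by (induction I rule: infinite_finite_induct) (auto intro: subring_setD[OF assms(1)])

lemma ideal_gen_add: "y \<in> ideal_gen A S \<Longrightarrow> x \<in> ideal_gen A S \<Longrightarrow> x + y \<in> ideal_gen A S"
  by (induction rule: ideal_gen.induct) (auto simp: add.assoc[symmetric] intro: ideal_gen.intros)

lemma ideal_gen_mult:
  assumes "subring_set A" "a \<in> A"
  shows "x \<in> ideal_gen A S \<Longrightarrow> a * x \<in> ideal_gen A S"
proof (induction rule: ideal_gen.induct)
  case (ideal_gen_step x b s)
  then have "a * x + (a * b) * s \<in> ideal_gen A S"
    by (intro ideal_gen.ideal_gen_step subring_setD(5)[OF assms(1)] assms(2))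
  then show ?case by (simp add: algebra_simps)
qed (simp add: ideal_gen.intros)

lemma ideal_gen_incl: "subring_set A \<Longrightarrow> s \<in> S \<Longrightarrow> s \<in> ideal_gen A S"
  using ideal_gen.ideal_gen_step[OF ideal_gen_0, of 1 A s S] subring_setD(2) by auto

lemma ideal_gen_uminus: "subring_set A \<Longrightarrow> x \<in> ideal_gen A S \<Longrightarrow> - x \<in> ideal_gen A S"
  using ideal_gen_mult[of A "-1" x S] subring_setD(2,3) by auto

lemma ideal_gen_diff: "subring_set A \<Longrightarrow> x \<in> ideal_gen A S \<Longrightarrow> y \<in> ideal_gen A S \<Longrightarrow> x - y \<in> ideal_gen A S"
  using ideal_gen_add[OF ideal_gen_uminus[of A y S], of x] by simp

lemma ideal_gen_subset:
  assumes "subring_set A" "S \<subseteq> ideal_gen A T"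
  shows "ideal_gen A S \<subseteq> ideal_gen A T"
proof
  fix x assume "x \<in> ideal_gen A S"
  then show "x \<in> ideal_gen A T"
    by (induction rule: ideal_gen.induct)
      (use assms in \<open>auto intro: ideal_gen_0 ideal_gen_add ideal_gen_mult\<close>)
qed

lemma ideal_gen_mono: "subring_set A \<Longrightarrow> S \<subseteq> T \<Longrightarrow> ideal_gen A S \<subseteq> ideal_gen A T"
  by (rule ideal_gen_subset) (auto intro: ideal_gen_incl)

lemma ideal_gen_in_ring: "x \<in> ideal_gen A S \<Longrightarrow> subring_set A \<Longrightarrow> S \<subseteq> A \<Longrightarrow> x \<in> A"
  by (induction rule: ideal_gen.induct) (auto intro: subring_setD)

lemma ideal_gen_finite:
  assumes "subring_set A"
  shows "x \<in> ideal_gen A S \<Longrightarrow> \<exists>F. finite F \<and> F \<subseteq> S \<and> x \<in> ideal_gen A F"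
proof (induction rule: ideal_gen.induct)
  case ideal_gen_0
  then show ?case using ideal_gen.ideal_gen_0 by blast
next
  case (ideal_gen_step x a s)
  then obtain F where F: "finite F" "F \<subseteq> S" "x \<in> ideal_gen A F" by blast
  then have "x \<in> ideal_gen A (insert s F)"
    using ideal_gen_mono[OF assms, of F "insert s F"] by blast
  then show ?case
    using F ideal_gen_step by (intro exI[of _ "insert s F"]) (auto intro: ideal_gen.ideal_gen_step)
qed

lemma ideal_gen_finite_subset:
  assumes "subring_set A" "finite P" "P \<subseteq> ideal_gen A S"
  shows "\<exists>F. finite F \<and> F \<subseteq> S \<and> P \<subseteq> ideal_gen A F"
proof -
  have "\<forall>p\<in>P. \<exists>F. finite F \<and> F \<subseteq> S \<and> p \<in> ideal_gen A F"
    using ideal_gen_finite[OF assms(1)] assms(3) by blast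
  then obtain F where F: "\<And>p. p \<in> P \<Longrightarrow> finite (F p) \<and> F p \<subseteq> S \<and> p \<in> ideal_gen A (F p)"
    by metis
  have "P \<subseteq> ideal_gen A (\<Union>p\<in>P. F p)"
    using F ideal_gen_mono[OF assms(1), of "F _" "\<Union>p\<in>P. F p"] by blast
  then show ?thesis using F assms(2) by (intro exI[of _ "\<Union>p\<in>P. F p"]) auto
qed

definition polys :: "'r::comm_ring_1 set \<Rightarrow> 'r poly set" where
  "polys A = {p. \<forall>i. Polynomial.coeff p i \<in> A}"

lemma subring_set_polys: "subring_set A \<Longrightarrow> subring_set (polys A)"
  unfolding subring_set_def[of "polys A"] unfolding polys_def
  by (auto simp: coeff_mult coeff_1 intro: subring_setD subring_set_sum)

text \<open>Hilbert's basis theorem. In an ideal that is not finitely generated, pick successively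
  polynomials of minimal degree outside the ideal generated by the previous ones; the leading
  coefficients then contradict the Noetherian property of the coefficient ring.\<close>

theorem noetherian_set_polys:
  fixes A :: "'r::comm_ring_1 set"
  assumes "noetherian_set A"
  shows "noetherian_set (polys A)"
proof -
  have A: "subring_set A" using assms by (simp add: noetherian_set_def)
  note PA = subring_set_polys[OF A]
  let ?gen = "ideal_gen (polys A)"
  have "\<exists>F. finite F \<and> F \<subseteq> S \<and> S \<subseteq> ?gen F" if S: "S \<subseteq> polys A" for S
  proof -
    \<comment> \<open>Finite generation is first shown with generators from the ideal
      \<open>J\<close>. Each of these is a combination of finitely many elements of
      \<open>S\<close>, which then replace it.\<close>
    define J where "J = ?gen S"
    have "\<exists>P. finite P \<and> P \<subseteq> J \<and> J \<subseteq> ?gen P"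
    proof (rule ccontr)
      assume neg: "\<not> (\<exists>P. finite P \<and> P \<subseteq> J \<and> J \<subseteq> ?gen P)"
      define pick where "pick P = arg_min degree (\<lambda>p. p \<in> J \<and> p \<notin> ?gen P)" for P
      have pick: "pick P \<in> J" "pick P \<notin> ?gen P" "\<And>q. q \<in> J \<Longrightarrow> q \<notin> ?gen P \<Longrightarrow> degree (pick P) \<le> degree q"
        if "finite P" "P \<subseteq> J" for P
      proof -
        obtain q where "q \<in> J \<and> q \<notin> ?gen P" using neg \<open>finite P\<close> \<open>P \<subseteq> J\<close> by blast
        from arg_min_nat_lemma[of "\<lambda>p. p \<in> J \<and> p \<notin> ?gen P", OF this, of degree]
        show "pick P \<in> J" "pick P \<notin> ?gen P" "\<And>q. q \<in> J \<Longrightarrow> q \<notin> ?gen P \<Longrightarrow> degree (pick P) \<le> degree q"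
          unfolding pick_def by blast+
      qed
      define P where "P = rec_nat {} (\<lambda>_ P. insert (pick P) P)"
      define p where "p n = pick (P n)" for n
      have P0: "P 0 = {}" and PSuc: "P (Suc n) = insert (p n) (P n)" for n
        by (simp_all add: P_def p_def)
      have P_eq: "P n = p ` {..<n}" for n
        by (induction n) (auto simp: P0 PSuc lessThan_Suc)
      have fin: "finite (P n)" for n by (simp add: P_eq)
      have PJ: "P n \<subseteq> J" for n
        by (induction n) (use pick(1)[OF fin] in \<open>auto simp: P0 PSuc p_def\<close>)
      have pJ: "p n \<in> J" and p_new: "p n \<notin> ?gen (P n)"
        and p_min: "\<And>q. q \<in> J \<Longrightarrow> q \<notin> ?gen (P n) \<Longrightarrow> degree (p n) \<le> degree q" for n
        unfolding p_def using pick[OF fin PJ] by blast+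
      have pA: "p n \<in> polys A" for n
        using ideal_gen_in_ring[OF pJ[unfolded J_def] PA S] .
      have deg_le: "degree (p i) \<le> degree (p n)" if "i < n" for i n
      proof (rule p_min[OF pJ])
        have "P i \<subseteq> P n" using that by (auto simp: P_eq)
        then show "p n \<notin> ?gen (P i)" using p_new[of n] ideal_gen_mono[OF PA] by blast
      qed
      define a where "a n = lead_coeff (p n)" for n
      have "range a \<subseteq> A" using pA by (auto simp: a_def polys_def)
      then obtain F where F: "finite F" "F \<subseteq> range a" "range a \<subseteq> ideal_gen A F"
        using assms unfolding noetherian_set_def by meson
      obtain I where I: "finite I" "F = a ` I" using finite_subset_image[OF F(1,2)] by auto
      obtain N where "I \<subseteq> {..<N}" using I(1) finite_nat_iff_bounded by blast
      then have "F \<subseteq> a ` {..<N}" using I(2) by blast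
      then have "a N \<in> ideal_gen A (a ` {..<N})"
        using F(3) ideal_gen_mono[OF A, of F "a ` {..<N}"] by blast
      then have "\<exists>q\<in>?gen (P N). degree q \<le> degree (p N) \<and> Polynomial.coeff q (degree (p N)) = a N"
      proof (induction rule: ideal_gen.induct)
        case ideal_gen_0
        show ?case by (rule bexI[of _ 0]) (simp_all add: ideal_gen.ideal_gen_0)
      next
        case (ideal_gen_step x c s)
        then obtain q i where q: "q \<in> ?gen (P N)" "degree q \<le> degree (p N)" "Polynomial.coeff q (degree (p N)) = x"
          and i: "i < N" "s = a i" by auto
        \<comment> \<open>The monomial lifts \<open>p i\<close> to the degree of \<open>p N\<close>,
          which is possible because the degrees of the successive picks do not decrease.\<close>
        let ?m = "Polynomial.monom c (degree (p N) - degree (p i))"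
        have m: "?m \<in> polys A" using ideal_gen_step.hyps(2) subring_setD(1)[OF A] by (auto simp: polys_def)
        have "degree (?m * p i) \<le> degree (p N)"
          using degree_mult_le[of ?m "p i"] degree_monom_le[of c "degree (p N) - degree (p i)"] deg_le[OF i(1)]
          by linarith
        moreover have "Polynomial.coeff (?m * p i) (degree (p N)) = c * s"
          using deg_le[OF i(1)] by (simp add: coeff_monom_mult i(2) a_def)
        moreover have "q + ?m * p i \<in> ?gen (P N)"
          using i(1) by (intro ideal_gen.ideal_gen_step q(1) m) (auto simp: P_eq)
        ultimately show ?case
          using q(2,3) by (intro bexI[of _ "q + ?m * p i"]) (auto intro: degree_add_le)
      qed
      then obtain q where q: "q \<in> ?gen (P N)" "degree q \<le> degree (p N)" "Polynomial.coeff q (degree (p N)) = a N"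
        by blast
      \<comment> \<open>\<open>q\<close> has the leading term of \<open>p N\<close>. The difference
        lies in \<open>J\<close> and outside the ideal of the earlier picks, so minimality forces
        its degree up to that of \<open>p N\<close>, where its coefficient is zero; so it is the
        zero polynomial, which lies in every ideal.\<close>
      let ?r = "p N - q"
      have "?r \<notin> ?gen (P N)"
        using p_new[of N] ideal_gen_add[OF q(1), of ?r] by auto
      moreover have "?r \<in> J"
        using pJ q(1) ideal_gen_subset[OF PA PJ[unfolded J_def]] unfolding J_def
        by (intro ideal_gen_diff[OF PA]) auto
      ultimately have "degree (p N) \<le> degree ?r" by (intro p_min)
      moreover have "degree ?r \<le> degree (p N)" by (rule degree_diff_le) (use q(2) in auto)
      moreover have "Polynomial.coeff ?r (degree (p N)) = 0" by (simp add: q(3) a_def)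
      ultimately have "?r = 0" by (metis leading_coeff_0_iff order_antisym)
      then show False using \<open>?r \<notin> ?gen (P N)\<close> by (simp add: ideal_gen_0)
    qed
    then obtain P where P: "finite P" "P \<subseteq> J" "J \<subseteq> ?gen P" by blast
    obtain F where F: "finite F" "F \<subseteq> S" "P \<subseteq> ?gen F"
      using ideal_gen_finite_subset[OF PA P(1) P(2)[unfolded J_def]] by metis
    have "S \<subseteq> ?gen F"
      using ideal_gen_incl[OF PA, of _ S] P(3) ideal_gen_subset[OF PA F(3)] unfolding J_def by (meson subset_iff)
    then show ?thesis using F by blast
  qed
  then show ?thesis using PA by (simp add: noetherian_set_def)
qed

text \<open>A homomorphic image of a Noetherian ring is Noetherian: generators for the preimage of
  \<open>S\<close> under evaluation at \<open>x\<close> are mapped to generators for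
  \<open>S\<close>.\<close>

lemma noetherian_set_adjoin:
  fixes A :: "'r::comm_ring_1 set"
  assumes "noetherian_set A"
  shows "noetherian_set ((\<lambda>p. poly p x) ` polys A)"
proof -
  let ?e = "\<lambda>p. poly p x"
  note P = noetherian_set_polys[OF assms]
  have PA: "subring_set (polys A)" using P by (simp add: noetherian_set_def)
  have "\<forall>p\<in>polys A. - ?e p \<in> ?e ` polys A" 
    using subring_setD(3)[OF PA] by (metis image_eqI poly_minus)
  moreover have "?e p + ?e q \<in> ?e ` polys A" "?e p * ?e q \<in> ?e ` polys A" if "p \<in> polys A" "q \<in> polys A" for p q
    using subring_setD(4,5)[OF PA that] by (metis image_eqI poly_add, metis image_eqI poly_mult)
  moreover have "0 \<in> ?e ` polys A" "1 \<in> ?e ` polys A"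
    using subring_setD(1,2)[OF PA] by (metis image_eqI poly_0, metis image_eqI poly_1)
  ultimately have sub: "subring_set (?e ` polys A)" unfolding subring_set_def by auto
  have gen: "?e p \<in> ideal_gen (?e ` polys A) (?e ` F)" if "p \<in> ideal_gen (polys A) F" for p F
    using that by (induction rule: ideal_gen.induct) (auto intro: ideal_gen.intros)
  have "\<exists>F. finite F \<and> F \<subseteq> S \<and> S \<subseteq> ideal_gen (?e ` polys A) F" if S: "S \<subseteq> ?e ` polys A" for S
  proof -
    let ?S = "{p \<in> polys A. ?e p \<in> S}"
    obtain F where F: "finite F" "F \<subseteq> ?S" "?S \<subseteq> ideal_gen (polys A) F"
      using P unfolding noetherian_set_def by (metis (no_types, lifting) mem_Collect_eq subsetI)
    have "S \<subseteq> ideal_gen (?e ` polys A) (?e ` F)"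
      using S F(3) gen by blast
    then show ?thesis using F(1,2) by (intro exI[of _ "?e ` F"]) auto
  qed
  then show ?thesis using sub by (simp add: noetherian_set_def)
qed

section \<open>Finitely generated algebras of functions\<close>

inductive_set fun_alg :: "('w \<Rightarrow> complex) set \<Rightarrow> ('w \<Rightarrow> complex) set" for \<Gamma> where
  fun_alg_gen: "u \<in> \<Gamma> \<Longrightarrow> u \<in> fun_alg \<Gamma>"
| fun_alg_const: "(\<lambda>_. c) \<in> fun_alg \<Gamma>"
| fun_alg_add: "u \<in> fun_alg \<Gamma> \<Longrightarrow> v \<in> fun_alg \<Gamma> \<Longrightarrow> (\<lambda>w. u w + v w) \<in> fun_alg \<Gamma>"
| fun_alg_mult: "u \<in> fun_alg \<Gamma> \<Longrightarrow> v \<in> fun_alg \<Gamma> \<Longrightarrow> (\<lambda>w. u w * v w) \<in> fun_alg \<Gamma>"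

lemma noetherian_set_consts: "noetherian_set (range (\<lambda>c::complex. (\<lambda>_::'w. c)))"
proof -
  let ?A = "range (\<lambda>c::complex. (\<lambda>_::'w. c))"
  have sub: "subring_set ?A"
    by (auto simp: subring_set_def plus_fun_def times_fun_def zero_fun_def one_fun_def fun_Compl_def)
  have "\<exists>F. finite F \<and> F \<subseteq> S \<and> S \<subseteq> ideal_gen ?A F" if S: "S \<subseteq> ?A" for S
  proof (cases "S \<subseteq> {0}")
    case True
    then show ?thesis by (intro exI[of _ "{}"]) (auto intro: ideal_gen_0)
  next
    case False
    then obtain c where c: "(\<lambda>_. c) \<in> S" "c \<noteq> 0" using S by (auto simp: zero_fun_def)
    have "s \<in> ideal_gen ?A {\<lambda>_. c}" if "s \<in> S" for s
    proof -
      obtain d where d: "s = (\<lambda>_. d)" using S \<open>s \<in> S\<close> by auto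
      have "(0::'w \<Rightarrow> complex) + (\<lambda>_. d / c) * (\<lambda>_. c) \<in> ideal_gen ?A {\<lambda>_. c}"
        by (intro ideal_gen.intros) auto
      then show ?thesis using c(2) by (simp add: d times_fun_def zero_fun_def plus_fun_def)
    qed
    then show ?thesis using c(1) by (intro exI[of _ "{\<lambda>_. c}"]) auto
  qed
  then show ?thesis using sub by (simp add: noetherian_set_def)
qed

text \<open>The generators are adjoined to the constants one after the other. Inclusion in a
  Noetherian ring is enough, since the ideals may be formed in that larger ring.\<close>

lemma fun_alg_subset_noetherian:
  assumes "finite \<Gamma>"
  shows "\<exists>A. noetherian_set A \<and> fun_alg \<Gamma> \<subseteq> A"
proof -
  have "\<exists>A. noetherian_set A \<and> \<Gamma> \<subseteq> A \<and> range (\<lambda>c::complex. (\<lambda>_::'a. c)) \<subseteq> A"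
    using assms
  proof induction
    case empty
    then show ?case using noetherian_set_consts by blast
  next
    case (insert x \<Gamma>)
    then obtain A where A: "noetherian_set A" "\<Gamma> \<subseteq> A" "range (\<lambda>c::complex. (\<lambda>_::'a. c)) \<subseteq> A" by blast
    let ?A = "(\<lambda>p. poly p x) ` polys A"
    have sub: "subring_set A" using A(1) by (simp add: noetherian_set_def)
    have "[:a:] \<in> polys A" if "a \<in> A" for a
      using that subring_setD(1)[OF sub] by (auto simp: polys_def coeff_pCons split: nat.split)
    then have "A \<subseteq> ?A" by (force simp: image_iff)
    moreover have "[:0, 1:] \<in> polys A"
      using subring_setD(1,2)[OF sub] by (auto simp: polys_def coeff_pCons split: nat.split)
    then have "x \<in> ?A" by (force simp: image_iff)
    ultimately show ?case using noetherian_set_adjoin[OF A(1), of x] A(2,3) by blast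
  qed
  then obtain A where A: "noetherian_set A" "\<Gamma> \<subseteq> A" "range (\<lambda>c::complex. (\<lambda>_::'a. c)) \<subseteq> A" by blast
  have sub: "subring_set A" using A(1) by (simp add: noetherian_set_def)
  have "u \<in> A" if "u \<in> fun_alg \<Gamma>" for u
    using that
  proof induction
    case (fun_alg_add u v)
    then show ?case using subring_setD(4)[OF sub, of u v] by (simp add: plus_fun_def)
  next
    case (fun_alg_mult u v)
    then show ?case using subring_setD(5)[OF sub, of u v] by (simp add: times_fun_def)
  qed (use A in auto)
  then show ?thesis using A(1) by blast
qed

text \<open>All elements of an ideal vanish wherever its generators do, and the Noetherian property
  selects finitely many generators from \<open>S\<close>.\<close>

theorem fun_alg_finite_common_zeros:
  assumes "finite \<Gamma>" "S \<subseteq> fun_alg \<Gamma>"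
  shows "\<exists>F. finite F \<and> F \<subseteq> S \<and> (\<forall>w. (\<forall>D\<in>F. D w = 0) \<longrightarrow> (\<forall>D\<in>S. D w = 0))"
proof -
  obtain A where A: "noetherian_set A" "S \<subseteq> A"
    using fun_alg_subset_noetherian[OF assms(1)] assms(2) by blast
  then obtain F where F: "finite F" "F \<subseteq> S" "S \<subseteq> ideal_gen A F"
    unfolding noetherian_set_def by meson
  have zero: "D w = 0" if "\<forall>D\<in>F. D w = 0" "D \<in> ideal_gen A F" for D w
    using that(2)
  proof induction
    case (ideal_gen_step x a s)
    then show ?case using that(1) by (simp add: plus_fun_def times_fun_def)
  qed (simp add: zero_fun_def)
  show ?thesis
  proof (intro exI conjI allI impI ballI)
    fix w D assume "\<forall>D\<in>F. D w = 0" "D \<in> S"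
    then show "D w = 0" using zero F(3) by (meson subsetD)
  qed (use F in auto)
qed

section \<open>Annihilating polynomials and exponential sums\<close>

text \<open>\<open>L\<close> is the graph of the derivation \<open>d/dt\<close> or of the shift \<open>n \<mapsto> n + 1\<close>, and \<open>b i \<beta>\<close> is
  \<open>t\<^sup>i/i! exp (\<beta> t)\<close> or \<open>(n choose i) \<beta>\<^sup>n\<^sup>-\<^sup>i\<close>, respectively.\<close>

locale jordan_chains =
  fixes L :: "('w \<Rightarrow> complex) \<Rightarrow> ('w \<Rightarrow> complex) \<Rightarrow> bool"
    and b :: "nat \<Rightarrow> complex \<Rightarrow> 'w \<Rightarrow> complex" and adm :: "complex set"
  assumes L_add: "L U u \<Longrightarrow> L V v \<Longrightarrow> L (\<lambda>t. U t + V t) (\<lambda>t. u t + v t)"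
    and L_scale: "L U u \<Longrightarrow> L (\<lambda>t. c * U t) (\<lambda>t. c * u t)"
    and L_b_0: "\<beta> \<in> adm \<Longrightarrow> L (b 0 \<beta>) (\<lambda>t. \<beta> * b 0 \<beta> t)"
    and L_b_Suc: "\<beta> \<in> adm \<Longrightarrow> L (b (Suc i) \<beta>) (\<lambda>t. \<beta> * b (Suc i) \<beta> t + b i \<beta> t)"
begin

inductive_set chain_span :: "('w \<Rightarrow> complex) set" where
  chain_span_0: "(\<lambda>_. 0) \<in> chain_span"
| chain_span_step: "u \<in> chain_span \<Longrightarrow> \<beta> \<in> adm \<Longrightarrow> (\<lambda>t. u t + c * b i \<beta> t) \<in> chain_span"

lemma chain_span_add: "v \<in> chain_span \<Longrightarrow> u \<in> chain_span \<Longrightarrow> (\<lambda>t. u t + v t) \<in> chain_span"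
  by (induction rule: chain_span.induct) (auto simp: add.assoc[symmetric] intro: chain_span.intros)

lemma chain_span_scale: "u \<in> chain_span \<Longrightarrow> (\<lambda>t. d * u t) \<in> chain_span"
proof (induction rule: chain_span.induct)
  case (chain_span_step u \<beta> c i)
  then show ?case using chain_span.chain_span_step[of "\<lambda>t. d * u t" \<beta> "d * c" i] by (simp add: algebra_simps)
qed (use chain_span_0 in simp)

lemma chain_span_b: "\<beta> \<in> adm \<Longrightarrow> b i \<beta> \<in> chain_span"
  using chain_span_step[OF chain_span_0, of \<beta> 1 i] by simp

text \<open>In the resonant case \<open>\<alpha> = \<beta>\<close> the next function of the chain is
  a solution. Otherwise \<open>L - \<alpha>\<close> maps \<open>b (Suc i) \<beta>\<close> to
  \<open>(\<beta> - \<alpha>) * b (Suc i) \<beta> + b i \<beta>\<close>, so the solution for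
  \<open>b i \<beta>\<close> is subtracted and the result divided by
  \<open>\<beta> - \<alpha>\<close>.\<close>

lemma b_solution:
  assumes "\<alpha> \<in> adm" "\<beta> \<in> adm"
  shows "\<exists>U\<in>chain_span. L U (\<lambda>t. \<alpha> * U t + b i \<beta> t)"
proof (cases "\<alpha> = \<beta>")
  case True
  then show ?thesis using L_b_Suc[OF assms(2), of i] chain_span_b[OF assms(2), of "Suc i"] by blast
next
  case False
  then have nz: "\<beta> - \<alpha> \<noteq> 0" by simp
  show ?thesis
  proof (induction i)
    case 0
    have "L (\<lambda>t. inverse (\<beta> - \<alpha>) * b 0 \<beta> t) (\<lambda>t. inverse (\<beta> - \<alpha>) * (\<beta> * b 0 \<beta> t))"
      by (intro L_scale L_b_0 assms)
    moreover have "(\<lambda>t. inverse (\<beta> - \<alpha>) * (\<beta> * b 0 \<beta> t)) = (\<lambda>t. \<alpha> * (inverse (\<beta> - \<alpha>) * b 0 \<beta> t) + b 0 \<beta> t)"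
      using nz by (simp add: field_simps)
    ultimately show ?case
      by (intro bexI[of _ "\<lambda>t. inverse (\<beta> - \<alpha>) * b 0 \<beta> t"]) (auto intro: chain_span_scale chain_span_b assms)
  next
    case (Suc i)
    then obtain U where U: "U \<in> chain_span" "L U (\<lambda>t. \<alpha> * U t + b i \<beta> t)" by blast
    let ?V = "\<lambda>t. inverse (\<beta> - \<alpha>) * (b (Suc i) \<beta> t + (-1) * U t)"
    have "L ?V (\<lambda>t. inverse (\<beta> - \<alpha>) * ((\<beta> * b (Suc i) \<beta> t + b i \<beta> t) + (-1) * (\<alpha> * U t + b i \<beta> t)))"
      by (intro L_scale L_add L_b_Suc U assms)
    moreover have "(\<lambda>t. inverse (\<beta> - \<alpha>) * ((\<beta> * b (Suc i) \<beta> t + b i \<beta> t) + (-1) * (\<alpha> * U t + b i \<beta> t))) =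
        (\<lambda>t. \<alpha> * ?V t + b (Suc i) \<beta> t)"
      using nz by (simp add: field_simps)
    moreover have "?V \<in> chain_span"
      by (intro chain_span_scale chain_span_add U chain_span_b assms)
    ultimately show ?case by (intro bexI[of _ ?V]) simp_all
  qed
qed

lemma chain_span_solution:
  assumes "u \<in> chain_span" "\<alpha> \<in> adm" and L_0: "L (\<lambda>_. 0) (\<lambda>_. 0)"
  shows "\<exists>U\<in>chain_span. L U (\<lambda>t. \<alpha> * U t + u t)"
  using assms(1)
proof (induction rule: chain_span.induct)
  case chain_span_0
  then show ?case using L_0 chain_span.chain_span_0 by (intro bexI[of _ "\<lambda>_. 0"]) auto
next
  case (chain_span_step u \<beta> c i)
  then obtain U where U: "U \<in> chain_span" "L U (\<lambda>t. \<alpha> * U t + u t)" by blast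
  obtain V where V: "V \<in> chain_span" "L V (\<lambda>t. \<alpha> * V t + b i \<beta> t)"
    using b_solution[OF assms(2) chain_span_step(2)] by blast
  have "L (\<lambda>t. U t + c * V t) (\<lambda>t. (\<alpha> * U t + u t) + c * (\<alpha> * V t + b i \<beta> t))"
    by (intro L_add L_scale U V)
  then show ?case
    by (intro bexI[of _ "\<lambda>t. U t + c * V t"] chain_span_add chain_span_scale U V) (simp add: algebra_simps)
qed

end

text \<open>The product of the factors \<open>T - \<alpha>\<close> applied to \<open>F\<close>. A
  polynomial in \<open>T\<close> is kept as the list of its roots because the inductions below peel
  off one linear factor at a time.\<close>

primrec annihilate ::
  "((real ^ 'n, complex) germ \<Rightarrow> (real ^ 'n, complex) germ) \<Rightarrow> complex list \<Rightarrow>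
    (real ^ 'n, complex) germ \<Rightarrow> (real ^ 'n, complex) germ" where
  "annihilate T [] F = F"
| "annihilate T (\<alpha> # \<alpha>s) F = annihilate T \<alpha>s (T F - const \<alpha> * F)"

text \<open>The common frame for pullback by a germ fixing the origin and for derivation along a
  vector field vanishing there.\<close>

locale filtered_operator =
  fixes T :: "(real ^ 'n, complex) germ \<Rightarrow> (real ^ 'n, complex) germ"
  assumes T_van: "F \<in> vanishing k \<Longrightarrow> T F \<in> vanishing k"
    and T_add: "F \<in> smooth_germs \<Longrightarrow> G \<in> smooth_germs \<Longrightarrow> T (F + G) = T F + T G"
    and T_const: "F \<in> smooth_germs \<Longrightarrow> T (const c * F) = const c * T F"
begin

lemma T_smooth: "F \<in> smooth_germs \<Longrightarrow> T F \<in> smooth_germs"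
  using T_van[of F 0] by (simp add: vanishing_zero_eq)

lemma T_diff: "F \<in> smooth_germs \<Longrightarrow> G \<in> smooth_germs \<Longrightarrow> T (F - G) = T F - T G"
  using T_add[of F "const (-1) * G"] T_const[of G "-1"]
  by (simp add: smooth_germs_intros const_uminus const_1)

lemma annihilate_vanishing: "F \<in> vanishing k \<Longrightarrow> annihilate T \<alpha>s F \<in> vanishing k"
  by (induction \<alpha>s arbitrary: F)
    (auto intro!: vanishing_diff T_van vanishing_smooth_mult smooth_germs_const)

lemma annihilate_add:
  "F \<in> smooth_germs \<Longrightarrow> G \<in> smooth_germs \<Longrightarrow> annihilate T \<alpha>s (F + G) = annihilate T \<alpha>s F + annihilate T \<alpha>s G"
proof (induction \<alpha>s arbitrary: F G)
  case (Cons \<alpha> \<alpha>s)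
  have "T (F + G) - const \<alpha> * (F + G) = (T F - const \<alpha> * F) + (T G - const \<alpha> * G)"
    using Cons.prems by (simp add: T_add algebra_simps)
  then show ?case using Cons by (simp add: smooth_germs_intros T_smooth)
qed simp

lemma annihilate_const:
  "F \<in> smooth_germs \<Longrightarrow> annihilate T \<alpha>s (const c * F) = const c * annihilate T \<alpha>s F"
proof (induction \<alpha>s arbitrary: F)
  case (Cons \<alpha> \<alpha>s)
  have "T (const c * F) - const \<alpha> * (const c * F) = const c * (T F - const \<alpha> * F)"
    using Cons.prems by (simp only: T_const) (simp add: algebra_simps)
  then show ?case using Cons by (simp add: smooth_germs_intros T_smooth)
qed simp

lemma annihilate_append: "annihilate T (\<alpha>s @ \<beta>s) F = annihilate T \<beta>s (annihilate T \<alpha>s F)"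
  by (induction \<alpha>s arbitrary: F) auto

lemma annihilate_step_commute:
  "F \<in> smooth_germs \<Longrightarrow>
    T (annihilate T \<alpha>s F) - const \<beta> * annihilate T \<alpha>s F = annihilate T \<alpha>s (T F - const \<beta> * F)"
proof (induction \<alpha>s arbitrary: F)
  case (Cons \<alpha> \<alpha>s)
  let ?G = "T F - const \<alpha> * F"
  have "T ?G - const \<beta> * ?G = T (T F - const \<beta> * F) - const \<alpha> * (T F - const \<beta> * F)"
    using Cons.prems
    by (simp only: T_diff T_const T_smooth smooth_germs_mult smooth_germs_const) (simp add: algebra_simps)
  then show ?case using Cons by (simp add: smooth_germs_intros T_smooth)
qed simp

lemma annihilate_commute:
  "F \<in> smooth_germs \<Longrightarrow> annihilate T (\<alpha>s @ \<beta>s) F = annihilate T (\<beta>s @ \<alpha>s) F"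
proof (induction \<alpha>s arbitrary: F)
  case (Cons \<alpha> \<alpha>s)
  have "annihilate T (\<beta>s @ \<alpha> # \<alpha>s) F =
      annihilate T \<alpha>s (T (annihilate T \<beta>s F) - const \<alpha> * annihilate T \<beta>s F)"
    by (simp add: annihilate_append)
  also have "\<dots> = annihilate T (\<beta>s @ \<alpha>s) (T F - const \<alpha> * F)"
    by (simp add: annihilate_append annihilate_step_commute Cons.prems)
  also have "\<dots> = annihilate T (\<alpha>s @ \<beta>s) (T F - const \<alpha> * F)"
    using Cons by (simp add: smooth_germs_intros T_smooth)
  finally show ?case by simp
qed simp

text \<open>Germs whose class modulo \<open>vanishing k\<close> is a sum of generalized eigenvectors
  of \<open>T\<close> with eigenvalues in \<open>adm\<close>.\<close>

definition nilpotent_mod :: "complex set \<Rightarrow> nat \<Rightarrow> (real ^ 'n, complex) germ set" where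
  "nilpotent_mod adm k = {F \<in> smooth_germs. \<exists>\<alpha>s. set \<alpha>s \<subseteq> adm \<and> annihilate T \<alpha>s F \<in> vanishing k}"

lemma nilpotent_mod_add:
  assumes "F \<in> nilpotent_mod adm k" "G \<in> nilpotent_mod adm k"
  shows "F + G \<in> nilpotent_mod adm k"
proof -
  obtain \<alpha>s \<beta>s where *: "set \<alpha>s \<subseteq> adm" "annihilate T \<alpha>s F \<in> vanishing k"
    "set \<beta>s \<subseteq> adm" "annihilate T \<beta>s G \<in> vanishing k" "F \<in> smooth_germs" "G \<in> smooth_germs"
    using assms unfolding nilpotent_mod_def by blast
  have "annihilate T (\<alpha>s @ \<beta>s) F \<in> vanishing k"
    unfolding annihilate_append by (rule annihilate_vanishing) (rule *)
  moreover have "annihilate T (\<alpha>s @ \<beta>s) G \<in> vanishing k"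
    unfolding annihilate_commute[OF *(6), of \<alpha>s] annihilate_append[of \<beta>s]
    by (rule annihilate_vanishing) (rule *)
  ultimately have "annihilate T (\<alpha>s @ \<beta>s) (F + G) \<in> vanishing k"
    using * by (simp add: annihilate_add vanishing_add)
  then show ?thesis using * unfolding nilpotent_mod_def
    by (intro CollectI conjI exI[of _ "\<alpha>s @ \<beta>s"]) (auto intro: smooth_germs_add)
qed

lemma nilpotent_mod_vanishing: "F \<in> vanishing k \<Longrightarrow> F \<in> nilpotent_mod adm k"
  unfolding nilpotent_mod_def by (intro CollectI conjI exI[of _ "[]"]) (auto intro: vanishing_smooth)

lemma nilpotent_mod_const: "F \<in> nilpotent_mod adm k \<Longrightarrow> const c * F \<in> nilpotent_mod adm k"
  unfolding nilpotent_mod_def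
  by (auto simp: annihilate_const intro: vanishing_smooth_mult smooth_germs_intros)

lemma nilpotent_mod_sum:
  "(\<And>i. i \<in> I \<Longrightarrow> F i \<in> nilpotent_mod adm k) \<Longrightarrow> (\<Sum>i\<in>I. F i) \<in> nilpotent_mod adm k"
  by (induction I rule: infinite_finite_induct)
    (auto intro: nilpotent_mod_add nilpotent_mod_vanishing vanishing_0)

lemma nilpotent_mod_step:
  "F \<in> smooth_germs \<Longrightarrow> \<alpha> \<in> adm \<Longrightarrow> T F - const \<alpha> * F \<in> nilpotent_mod adm k \<Longrightarrow> F \<in> nilpotent_mod adm k"
  unfolding nilpotent_mod_def by clarsimp (metis annihilate.simps(2) insert_subset list.set(2))

lemma nilpotent_mod_annihilate:
  "F \<in> smooth_germs \<Longrightarrow> set \<alpha>s \<subseteq> adm \<Longrightarrow> annihilate T \<alpha>s F \<in> nilpotent_mod adm k \<Longrightarrow> F \<in> nilpotent_mod adm k"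
proof (induction \<alpha>s arbitrary: F)
  case (Cons \<alpha> \<alpha>s)
  have "T F - const \<alpha> * F \<in> nilpotent_mod adm k"
    by (rule Cons.IH) (use Cons.prems in \<open>simp_all add: smooth_germs_diff smooth_germs_mult smooth_germs_const T_smooth\<close>)
  then show ?case by (rule nilpotent_mod_step[rotated 2]) (use Cons.prems in auto)
qed simp

end

text \<open>Pullback by a germ of a diffeomorphism satisfies the product rule with
  \<open>\<sigma> = T\<close>, multiplication as \<open>conv\<close> and \<open>w \<alpha> = \<alpha>\<close>; a derivation satisfies it with
  \<open>\<sigma> = id\<close>, addition as \<open>conv\<close> and \<open>w \<alpha> = 1\<close>.\<close>

locale multiplicative_operator = filtered_operator T + \<sigma>: filtered_operator \<sigma>
  for T \<sigma> :: "(real ^ 'n, complex) germ \<Rightarrow> (real ^ 'n, complex) germ" +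
  fixes conv :: "complex \<Rightarrow> complex \<Rightarrow> complex" and w :: "complex \<Rightarrow> complex"
    and adm :: "complex set" and \<epsilon> :: complex
  assumes commute: "F \<in> smooth_germs \<Longrightarrow> \<sigma> (T F) = T (\<sigma> F)"
    and product_rule: "F \<in> smooth_germs \<Longrightarrow> G \<in> smooth_germs \<Longrightarrow>
      T (F * G) - const (conv \<alpha> \<beta>) * (F * G) =
      (T F - const \<alpha> * F) * \<sigma> G + const (w \<alpha>) * (F * (T G - const \<beta> * G))"
    and conv_adm: "\<alpha> \<in> adm \<Longrightarrow> \<beta> \<in> adm \<Longrightarrow> conv \<alpha> \<beta> \<in> adm"
    and unit_adm: "\<epsilon> \<in> adm" and T_unit: "T 1 = const \<epsilon>"
begin

lemma annihilate_\<sigma>: "F \<in> smooth_germs \<Longrightarrow> annihilate T \<alpha>s (\<sigma> F) = \<sigma> (annihilate T \<alpha>s F)"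
proof (induction \<alpha>s arbitrary: F)
  case (Cons \<alpha> \<alpha>s)
  have "T (\<sigma> F) - const \<alpha> * \<sigma> F = \<sigma> (T F - const \<alpha> * F)"
    using Cons.prems by (simp add: \<sigma>.T_diff \<sigma>.T_const T_smooth smooth_germs_intros commute)
  then show ?case using Cons by (simp add: smooth_germs_intros T_smooth)
qed simp

text \<open>The product rule lets each new factor act on \<open>F\<close> or on \<open>G\<close>.
  Once all factors of one of the two have been used up, that germ has gained an order, and so has
  the product. Hence the total number of remaining factors is the induction measure.\<close>

lemma nilpotent_mod_mult:
  assumes "set \<alpha>s \<subseteq> adm" "set \<beta>s \<subseteq> adm" "F \<in> vanishing j" "G \<in> vanishing k"
    and "annihilate T \<alpha>s F \<in> vanishing (Suc j)" "annihilate T \<beta>s G \<in> vanishing (Suc k)"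
  shows "F * G \<in> nilpotent_mod adm (Suc (j + k))"
  using assms
proof (induction "length \<alpha>s + length \<beta>s" arbitrary: \<alpha>s \<beta>s F G rule: less_induct)
  case less
  show ?case
  proof (cases \<alpha>s)
    case Nil
    then have "F * G \<in> vanishing (Suc j + k)" using less.prems by (intro vanishing_mult) auto
    then show ?thesis by (simp add: nilpotent_mod_vanishing)
  next
    case \<alpha>: (Cons \<alpha> \<alpha>s')
    show ?thesis
    proof (cases \<beta>s)
      case Nil
      then have "F * G \<in> vanishing (j + Suc k)" using less.prems by (intro vanishing_mult) auto
      then show ?thesis by (simp add: nilpotent_mod_vanishing)
    next
      case \<beta>: (Cons \<beta> \<beta>s')
      have F: "F \<in> smooth_germs" and G: "G \<in> smooth_germs" using less.prems vanishing_smooth by blast+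
      have step: "T H - const c * H \<in> vanishing i" if "H \<in> vanishing i" for H c i
        using that by (intro vanishing_diff T_van vanishing_smooth_mult smooth_germs_const)
      have "(T F - const \<alpha> * F) * \<sigma> G \<in> nilpotent_mod adm (Suc (j + k))"
      proof (rule less.hyps[of \<alpha>s' \<beta>s])
        show "annihilate T \<beta>s (\<sigma> G) \<in> vanishing (Suc k)"
          unfolding annihilate_\<sigma>[OF G] by (intro \<sigma>.T_van less.prems)
        show "annihilate T \<alpha>s' (T F - const \<alpha> * F) \<in> vanishing (Suc j)"
          using less.prems(5) by (simp add: \<alpha>)
      qed (use less.prems(1-4) \<alpha> in \<open>auto intro: step \<sigma>.T_van\<close>)
      moreover have "F * (T G - const \<beta> * G) \<in> nilpotent_mod adm (Suc (j + k))"
      proof (rule less.hyps[of \<alpha>s \<beta>s'])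
        show "annihilate T \<beta>s' (T G - const \<beta> * G) \<in> vanishing (Suc k)"
          using less.prems(6) by (simp add: \<beta>)
      qed (use less.prems(1-5) \<beta> in \<open>auto intro: step\<close>)
      ultimately have "T (F * G) - const (conv \<alpha> \<beta>) * (F * G) \<in> nilpotent_mod adm (Suc (j + k))"
        unfolding product_rule[OF F G] by (intro nilpotent_mod_add nilpotent_mod_const)
      then show ?thesis
        by (rule nilpotent_mod_step[rotated 2])
          (use less.prems(1,2) \<alpha> \<beta> in \<open>auto intro: smooth_germs_mult F G conv_adm\<close>)
    qed
  qed
qed

text \<open>Induction on \<open>k\<close>: what remains after annihilation modulo
  \<open>vanishing k\<close> is, up to the next order, a combination of words of length
  \<open>k\<close>. Appending the roots that annihilate these words gains one more order.\<close>

lemma nilpotent_mod_all: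
  assumes "\<And>i. coord i \<in> nilpotent_mod adm 2" "F \<in> smooth_germs"
  shows "F \<in> nilpotent_mod adm k"
proof -
  have wmono: "wmono l \<in> nilpotent_mod adm (Suc (length l))" for l :: "'n list"
  proof (induction l)
    case Nil
    have "T 1 - const \<epsilon> * 1 = 0" by (simp add: T_unit)
    then show ?case
      unfolding nilpotent_mod_def using unit_adm
      by (intro CollectI conjI exI[of _ "[\<epsilon>]"]) (simp_all add: wmono_def smooth_germs_1 vanishing_0)
  next
    case (Cons i l)
    obtain \<alpha>s \<beta>s where "set \<alpha>s \<subseteq> adm" "annihilate T \<alpha>s (coord i) \<in> vanishing (Suc 1)"
      "set \<beta>s \<subseteq> adm" "annihilate T \<beta>s (wmono l) \<in> vanishing (Suc (length l))"
      using assms(1)[of i] Cons unfolding nilpotent_mod_def numeral_2_eq_2 One_nat_def by blast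
    then have "coord i * wmono l \<in> nilpotent_mod adm (Suc (1 + length l))"
      using coord_vanishing wmono_vanishing by (intro nilpotent_mod_mult)
    then show ?case by (simp add: wmono_def)
  qed
  have "F \<in> nilpotent_mod adm k" if "F \<in> smooth_germs" for F
  proof (induction k)
    case 0
    then show ?case using that by (intro nilpotent_mod_vanishing) (simp add: vanishing_zero_eq)
  next
    case (Suc k)
    then obtain \<alpha>s where \<alpha>s: "set \<alpha>s \<subseteq> adm" "annihilate T \<alpha>s F \<in> vanishing k"
      unfolding nilpotent_mod_def by blast
    then obtain c where c: "annihilate T \<alpha>s F - (\<Sum>l\<in>words k. const (c l) * wmono l) \<in> vanishing (Suc k)"
      using vanishing_leading by blast
    have "(\<Sum>l\<in>words k. const (c l) * wmono l) \<in> nilpotent_mod adm (Suc k)"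
      using wmono by (intro nilpotent_mod_sum nilpotent_mod_const) force
    from nilpotent_mod_add[OF nilpotent_mod_vanishing[OF c] this]
    have "annihilate T \<alpha>s F \<in> nilpotent_mod adm (Suc k)" by simp
    then show ?case using that \<alpha>s(1) by (rule nilpotent_mod_annihilate[rotated 2])
  qed
  then show ?thesis using assms(2) .
qed

end

text \<open>Gaussian elimination with the pivot \<open>c p k\<close>.\<close>

lemma nontrivial_relation:
  fixes c :: "nat \<Rightarrow> nat \<Rightarrow> 'a::field"
  shows "\<exists>d. (\<exists>i\<le>k. d i \<noteq> 0) \<and> (\<forall>j<k. (\<Sum>i\<le>k. d i * c i j) = 0)"
proof (induction k arbitrary: c)
  case 0
  show ?case by (intro exI[of _ "\<lambda>_. 1"]) auto
next
  case (Suc k)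
  show ?case
  proof (cases "\<exists>p\<le>Suc k. c p k \<noteq> 0")
    case False
    obtain d where d: "\<exists>i\<le>k. d i \<noteq> 0" "\<And>j. j < k \<Longrightarrow> (\<Sum>i\<le>k. d i * c i j) = 0"
      using Suc.IH[of c] by blast
    let ?d = "\<lambda>i. if i \<le> k then d i else 0"
    have "(\<Sum>i\<le>Suc k. ?d i * c i j) = 0" if "j < Suc k" for j
    proof (cases "j = k")
      case True
      then show ?thesis using False by (intro sum.neutral) auto
    next
      case False
      then show ?thesis using d(2)[of j] that by simp
    qed
    then show ?thesis using d(1) by (intro exI[of _ ?d]) (auto intro: le_SucI)
  next
    case True
    then obtain p where p: "p \<le> Suc k" "c p k \<noteq> 0" by blast
    define f where "f i = (if i < p then i else Suc i)" for i
    have f_bij: "bij_betw f {..k} ({..Suc k} - {p})"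
      by (rule bij_betwI[where g = "\<lambda>i. if i < p then i else i - 1"])
        (use p(1) in \<open>auto simp: f_def split: if_splits\<close>)
    obtain d where d: "\<exists>i\<le>k. d i \<noteq> 0"
      "\<And>j. j < k \<Longrightarrow> (\<Sum>i\<le>k. d i * (c (f i) j - c (f i) k / c p k * c p j)) = 0"
      using Suc.IH[of "\<lambda>i j. c (f i) j - c (f i) k / c p k * c p j"] by blast
    define g where "g = inv_into {..k} f"
    \<comment> \<open>The coefficient of the pivot row is chosen to undo the subtraction of its
      multiples from the other rows.\<close>
    define e where "e i = (if i = p then - (\<Sum>i\<le>k. d i * (c (f i) k / c p k)) else d (g i))" for i
    have ef: "e (f i) = d i" if "i \<le> k" for i
    proof -
      have "f i \<noteq> p" by (auto simp: f_def)
      moreover have "g (f i) = i"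
        unfolding g_def using f_bij that by (intro inv_into_f_f) (auto simp: bij_betw_def)
      ultimately show ?thesis by (simp add: e_def)
    qed
    have total: "(\<Sum>i\<le>Suc k. e i * c i j) = (\<Sum>i\<le>k. d i * (c (f i) j - c (f i) k / c p k * c p j))" for j
    proof -
      have "(\<Sum>i\<le>Suc k. e i * c i j) = e p * c p j + (\<Sum>i\<in>{..Suc k} - {p}. e i * c i j)"
        using p(1) by (intro sum.remove) auto
      also have "(\<Sum>i\<in>{..Suc k} - {p}. e i * c i j) = (\<Sum>i\<le>k. e (f i) * c (f i) j)"
        by (rule sum.reindex_bij_betw[OF f_bij, symmetric])
      also have "\<dots> = (\<Sum>i\<le>k. d i * c (f i) j)" by (intro sum.cong) (auto simp: ef)
      finally show ?thesis
        by (simp add: e_def sum_subtractf algebra_simps sum_distrib_left sum_distrib_right)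
    qed
    \<comment> \<open>In column \<open>k\<close> every reduced entry is zero by the choice of the
      pivot; the other columns are covered by the induction hypothesis.\<close>
    have "(\<Sum>i\<le>Suc k. e i * c i j) = 0" if "j < Suc k" for j
      using that d(2)[of j] p(2) unfolding total by (cases "j = k") auto
    moreover obtain i where "i \<le> k" "d i \<noteq> 0" using d(1) by blast
    then have "f i \<le> Suc k" "e (f i) \<noteq> 0" by (auto simp: ef) (auto simp: f_def)
    ultimately show ?thesis by blast
  qed
qed

section \<open>Polynomials in an operator and the eigenvalues of its linear part\<close>

context filtered_operator
begin

primrec list_eval :: "complex list \<Rightarrow> (real ^ 'n, complex) germ \<Rightarrow> (real ^ 'n, complex) germ" where
  "list_eval [] F = 0"
| "list_eval (a # as) F = const a * F + list_eval as (T F)"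

definition poly_eval :: "complex poly \<Rightarrow> (real ^ 'n, complex) germ \<Rightarrow> (real ^ 'n, complex) germ" where
  "poly_eval p = list_eval (coeffs p)"

lemma poly_eval_0: "poly_eval 0 F = 0"
  by (simp add: poly_eval_def)

lemma poly_eval_pCons: "poly_eval (pCons a p) F = const a * F + poly_eval p (T F)"
  by (cases "a = 0 \<and> p = 0") (auto simp: poly_eval_def cCons_def const_0)

lemma poly_eval_diff: "poly_eval (p - q) F = poly_eval p F - poly_eval q F"
proof (induction p arbitrary: q F)
  case 0
  have "poly_eval (- q) F = - poly_eval q F"
    by (induction q arbitrary: F) (simp_all add: poly_eval_0 poly_eval_pCons const_uminus)
  then show ?case by (simp add: poly_eval_0)
next
  case (pCons a p)
  show ?case
  proof (cases q)
    case (pCons b q')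
    then show ?thesis using pCons.IH by (simp add: poly_eval_pCons const_minus algebra_simps)
  qed
qed

lemma poly_eval_smult: "poly_eval (Polynomial.smult c p) F = const c * poly_eval p F"
  by (induction p arbitrary: F) (simp_all add: poly_eval_0 poly_eval_pCons const_mult algebra_simps)

lemma poly_eval_arg:
  "F \<in> smooth_germs \<Longrightarrow> poly_eval p (T F - const z * F) = poly_eval p (T F) - const z * poly_eval p F"
proof (induction p arbitrary: F)
  case (pCons a p)
  have "T (T F - const z * F) = T (T F) - const z * T F"
    using pCons.prems by (simp add: T_diff T_const T_smooth smooth_germs_intros)
  then show ?case using pCons by (simp only: poly_eval_pCons T_smooth) (simp add: algebra_simps)
qed (simp add: poly_eval_0)

lemma poly_eval_linear_factor:
  "F \<in> smooth_germs \<Longrightarrow> poly_eval ([:- z, 1:] * q) F = poly_eval q (T F - const z * F)"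
proof -
  assume F: "F \<in> smooth_germs"
  have "[:- z, 1:] * q = pCons 0 q - Polynomial.smult z q" by simp
  then show ?thesis
    using F by (simp add: poly_eval_diff poly_eval_smult poly_eval_pCons poly_eval_arg const_0)
qed

lemma poly_eval_sum:
  assumes "degree p \<le> n" "F \<in> smooth_germs"
  shows "poly_eval p F = (\<Sum>i\<le>n. const (Polynomial.coeff p i) * (T ^^ i) F)"
  using assms
proof (induction p arbitrary: F n)
  case 0
  then show ?case by (simp add: poly_eval_0 const_0)
next
  case (pCons a p)
  show ?case
  proof (cases n)
    case 0
    then have "p = 0" using pCons.prems by (simp split: if_splits)
    then show ?thesis by (simp add: 0 poly_eval_pCons poly_eval_0)
  next
    case (Suc m)
    then have "poly_eval p (T F) = (\<Sum>i\<le>m. const (Polynomial.coeff p i) * (T ^^ i) (T F))"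
      using pCons.prems by (intro pCons.IH T_smooth) (auto split: if_splits)
    then show ?thesis
      unfolding Suc sum.atMost_Suc_shift by (simp add: poly_eval_pCons funpow_swap1)
  qed
qed

text \<open>Complex scalars enter here: the fundamental theorem of algebra splits off one root after
  another, and the roots form the list.\<close>

lemma annihilate_of_poly_eval:
  assumes "p \<noteq> 0" "F \<in> smooth_germs" "poly_eval p F \<in> vanishing k"
  shows "\<exists>\<alpha>s. annihilate T \<alpha>s F \<in> vanishing k"
  using assms
proof (induction "degree p" arbitrary: p F)
  case 0
  then obtain c where c: "p = [:c:]" "c \<noteq> 0"
    by (metis degree_eq_zeroE pCons_0_0)
  then have "const (inverse c) * (const c * F) \<in> vanishing k"
    using 0 by (intro vanishing_smooth_mult[OF smooth_germs_const[of "inverse c"]]) (simp add: poly_eval_pCons poly_eval_0)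
  moreover have "const (inverse c) * (const c * F) = F"
    unfolding mult.assoc[symmetric] const_mult[symmetric] using c(2) by (simp add: const_1)
  ultimately show ?case by (intro exI[of _ "[]"]) simp
next
  case (Suc n)
  then have "\<not> Fundamental_Theorem_Algebra.constant (poly p)" by (simp add: constant_degree)
  then obtain z where "poly p z = 0" using fundamental_theorem_of_algebra by blast
  then obtain q where q: "p = [:- z, 1:] * q" by (auto simp: poly_eq_0_iff_dvd elim: dvdE)
  then have "q \<noteq> 0" using Suc.prems by auto
  then have "degree p = Suc (degree q)" unfolding q by (subst degree_mult_eq) auto
  then have "n = degree q" using Suc.hyps(2) by simp
  moreover have "T F - const z * F \<in> smooth_germs"
    by (intro smooth_germs_diff smooth_germs_mult smooth_germs_const T_smooth Suc.prems(2))
  moreover have "poly_eval q (T F - const z * F) \<in> vanishing k"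
    using Suc.prems(3) unfolding q poly_eval_linear_factor[OF Suc.prems(2)] .
  ultimately obtain \<alpha>s where "annihilate T \<alpha>s (T F - const z * F) \<in> vanishing k"
    using Suc.hyps(1) \<open>q \<noteq> 0\<close> by blast
  then show ?case by (intro exI[of _ "z # \<alpha>s"]) simp
qed

text \<open>A substitute for the characteristic polynomial. With \<open>k\<close> words of length
  one, the linear parts of the \<open>k + 1\<close> iterates of \<open>F\<close> have
  \<open>k\<close> coefficients each, so they satisfy a nontrivial relation, whose coefficients are
  those of \<open>p\<close>.\<close>

lemma annihilate_linear_part:
  assumes "F \<in> vanishing 1"
  shows "\<exists>\<alpha>s. annihilate T \<alpha>s F \<in> vanishing 2"
proof -
  have iter: "(T ^^ m) F \<in> vanishing 1" for m
    using assms by (induction m) (auto intro: T_van)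
  have "\<forall>m. \<exists>c. (T ^^ m) F - (\<Sum>l\<in>words 1. const (c l) * wmono l) \<in> vanishing 2"
    using vanishing_leading[OF iter] by (simp add: numeral_2_eq_2)
  from choice[OF this]
  obtain c where c: "\<And>m. (T ^^ m) F - (\<Sum>l\<in>words 1. const (c m l) * wmono l) \<in> vanishing 2"
    by blast
  define k where "k = card (words 1 :: 'n list set)"
  obtain e where e: "bij_betw e {..<k} (words 1 :: 'n list set)"
    using ex_bij_betw_nat_finite[OF finite_words] unfolding k_def atLeast0LessThan by blast
  obtain d where d: "\<exists>i\<le>k. d i \<noteq> 0" "\<And>j. j < k \<Longrightarrow> (\<Sum>i\<le>k. d i * c i (e j)) = 0"
    using nontrivial_relation[of k "\<lambda>i j. c i (e j)"] by blast
  have d0: "(\<Sum>i\<le>k. d i * c i l) = 0" if "l \<in> words 1" for l :: "'n list"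
  proof -
    have "l \<in> e ` {..<k}" unfolding bij_betw_imp_surj_on[OF e] by (rule that)
    then show ?thesis using d(2) by blast
  qed
  define p where "p = (\<Sum>i\<le>k. Polynomial.monom (d i) i)"
  have cp: "Polynomial.coeff p i = (if i \<le> k then d i else 0)" for i
    by (simp add: p_def coeff_sum)
  have "p \<noteq> 0" using d(1) cp by (metis coeff_0)
  moreover have "poly_eval p F \<in> vanishing 2"
  proof -
    have "degree p \<le> k" by (rule degree_le) (simp add: cp)
    then have "poly_eval p F = (\<Sum>i\<le>k. const (d i) * (T ^^ i) F)"
      using poly_eval_sum[of p k F] vanishing_smooth[OF assms] by (simp add: cp)
    also have "\<dots> = (\<Sum>i\<le>k. const (d i) * ((T ^^ i) F - (\<Sum>l\<in>words 1. const (c i l) * wmono l))) +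
        (\<Sum>i\<le>k. \<Sum>l\<in>words 1. const (d i * c i l) * wmono l)"
      by (simp add: sum.distrib[symmetric] sum_distrib_left const_mult algebra_simps)
    also have "(\<Sum>i\<le>k. \<Sum>l\<in>words 1. const (d i * c i l) * wmono l) =
        (\<Sum>l\<in>words 1. const (\<Sum>i\<le>k. d i * c i l) * wmono l)"
      unfolding const_sum sum_distrib_right by (rule sum.swap)
    also have "\<dots> = 0"
    proof (rule sum.neutral, rule ballI)
      fix l :: "'n list" assume "l \<in> words 1"
      then have "(\<Sum>i\<le>k. d i * c i l) = 0" by (rule d0)
      then show "const (\<Sum>i\<le>k. d i * c i l) * wmono l = 0" by (simp only: const_0 mult_zero_left)
    qed
    finally have eq: "poly_eval p F =
        (\<Sum>i\<le>k. const (d i) * ((T ^^ i) F - (\<Sum>l\<in>words 1. const (c i l) * wmono l)))" by simp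
    show ?thesis
      unfolding eq by (intro vanishing_sum vanishing_smooth_mult[OF smooth_germs_const] c)
  qed
  ultimately show ?thesis by (rule annihilate_of_poly_eval[OF _ vanishing_smooth[OF assms]])
qed

end

section \<open>Finitely parametrized sets of germs\<close>

lemma smooth_germs_fix_0E:
  assumes "H \<in> smooth_germs_fix_0"
  obtains h where "H = germ_of h" "smooth_near_0 h" "h 0 = 0" "filterlim h (nhds 0) (nhds 0)"
  using assms smooth_near_0_filterlim by (auto simp: smooth_germs_fix_0_def)

lemma germ_comp_germ_of:
  "filterlim g (nhds 0) (nhds 0) \<Longrightarrow> germ_comp (germ_of f) (germ_of g) = germ_of (\<lambda>x. f (g x))"
  by (simp add: germ_comp.abs_eq o_def)

lemma germ_cases: obtains f where "F = germ_of f"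
  by (metis Quotient_germ Quotient_abs_rep)

lemma germ_comp_add:
  assumes "H \<in> smooth_germs_fix_0"
  shows "germ_comp (F + G) H = germ_comp F H + germ_comp G H"
  by (rule smooth_germs_fix_0E[OF assms], rule germ_cases[of F], rule germ_cases[of G])
    (simp add: germ_of_add germ_comp_germ_of)

lemma germ_comp_mult:
  assumes "H \<in> smooth_germs_fix_0"
  shows "germ_comp (F * G) H = germ_comp F H * germ_comp G H"
  by (rule smooth_germs_fix_0E[OF assms], rule germ_cases[of F], rule germ_cases[of G])
    (simp add: germ_of_mult germ_comp_germ_of)

lemma germ_comp_diff:
  assumes "H \<in> smooth_germs_fix_0"
  shows "germ_comp (F - G) H = germ_comp F H - germ_comp G H"
  by (rule smooth_germs_fix_0E[OF assms], rule germ_cases[of F], rule germ_cases[of G])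
    (simp add: germ_of_minus germ_comp_germ_of)

lemma germ_comp_const:
  assumes "H \<in> smooth_germs_fix_0"
  shows "germ_comp (const c) H = const c"
  by (rule smooth_germs_fix_0E[OF assms]) (simp add: const_def germ_comp_germ_of)

lemma germ_comp_0: "H \<in> smooth_germs_fix_0 \<Longrightarrow> germ_comp 0 H = 0"
  unfolding const_0[symmetric] by (rule germ_comp_const)

lemma germ_comp_smooth:
  assumes "H \<in> smooth_germs_fix_0" "F \<in> smooth_germs"
  shows "germ_comp F H \<in> smooth_germs"
  by (rule smooth_germs_fix_0E[OF assms(1)], rule smooth_germsE[OF assms(2)])
    (simp add: germ_comp_germ_of germ_of_in_smooth_germs_iff smooth_near_0_compose)

lemma germ_comp_fix_0:
  assumes "H \<in> smooth_germs_fix_0" "K \<in> smooth_germs_fix_0"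
  shows "germ_comp H K \<in> smooth_germs_fix_0"
proof (rule smooth_germs_fix_0E[OF assms(1)], rule smooth_germs_fix_0E[OF assms(2)])
  fix h k
  assume *: "H = germ_of h" "smooth_near_0 h" "h 0 = 0" "K = germ_of k" "smooth_near_0 k" "k 0 = 0"
    "filterlim k (nhds 0) (nhds 0)"
  then have "germ_comp H K = germ_of (\<lambda>x. h (k x))" by (simp add: germ_comp_germ_of)
  then show ?thesis
    using * smooth_near_0_compose[of h k] unfolding smooth_germs_fix_0_def by (intro image_eqI) auto
qed

lemma germ_comp_assoc:
  assumes "H \<in> smooth_germs_fix_0" "K \<in> smooth_germs_fix_0"
  shows "germ_comp (germ_comp F H) K = germ_comp F (germ_comp H K)"
proof (rule smooth_germs_fix_0E[OF assms(1)], rule smooth_germs_fix_0E[OF assms(2)], rule germ_cases[of F])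
  fix f h k
  assume "H = germ_of h" "filterlim h (nhds 0) (nhds 0)" "K = germ_of k" "filterlim k (nhds 0) (nhds 0)"
    "F = germ_of f"
  then show ?thesis by (simp add: germ_comp_germ_of filterlim_compose[of h _ _ k])
qed

abbreviation id_germ :: "('a::{topological_space,zero}, 'a) germ" where "id_germ \<equiv> germ_of (\<lambda>x. x)"

lemma germ_comp_id: "germ_comp F id_germ = F"
  by (rule germ_cases[of F]) (simp add: germ_comp_germ_of filterlim_ident)

lemma germ_id_comp: "H \<in> smooth_germs_fix_0 \<Longrightarrow> germ_comp id_germ H = H"
  by (erule smooth_germs_fix_0E) (simp add: germ_comp_germ_of)

lemma id_germ_fix_0: "id_germ \<in> smooth_germs_fix_0"
  unfolding smooth_germs_fix_0_def
  using smooth_near_0_bounded_linear[OF bounded_linear_ident] by (intro image_eqI) auto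

lemma smooth_near_0_linear_bound:
  assumes "smooth_near_0 h" "h 0 = 0"
  shows "\<exists>C>0. \<forall>\<^sub>F x in nhds 0. norm (h x) \<le> C * norm x"
proof -
  let ?D = "frechet_derivative h (at 0)"
  have "(h has_derivative ?D) (at 0)"
    using smooth_near_0_has_derivative[OF assms(1)] by (rule eventually_nhds_x_imp_x)
  then have D: "bounded_linear ?D" and "\<forall>e>0. \<exists>d>0. \<forall>y. norm (y - 0) < d \<longrightarrow> norm (h y - h 0 - ?D (y - 0)) \<le> e * norm (y - 0)"
    unfolding has_derivative_at_alt by blast+
  then obtain d where d: "d > 0" "\<And>y. norm y < d \<Longrightarrow> norm (h y - ?D y) \<le> norm y"
    using assms(2) by (metis diff_zero mult_1 zero_less_one)
  obtain K where K: "K > 0" "\<And>x. norm (?D x) \<le> norm x * K"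
    using bounded_linear.pos_bounded[OF D] by blast
  have "norm (h y) \<le> (1 + K) * norm y" if "y \<in> ball 0 d" for y
    using norm_triangle_ineq2[of "h y" "?D y"] d(2)[of y] K(2)[of y] that by (simp add: algebra_simps)
  then have "\<forall>\<^sub>F x in nhds 0. norm (h x) \<le> (1 + K) * norm x"
    using eventually_nhds_in_open[OF open_ball centre_in_ball[THEN iffD2, OF d(1)]] by (rule eventually_mono[rotated])
  then show ?thesis using K(1) by (intro exI[of _ "1 + K"]) auto
qed

lemma germ_comp_vanishing:
  assumes "H \<in> smooth_germs_fix_0" "F \<in> vanishing k"
  shows "germ_comp F H \<in> vanishing k"
proof (rule smooth_germs_fix_0E[OF assms(1)], rule vanishingE[OF assms(2)])
  fix h f C
  assume h: "H = germ_of h" "smooth_near_0 h" "h 0 = 0" "filterlim h (nhds 0) (nhds 0)"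
    and f: "F = germ_of f" "smooth_near_0 f" "\<forall>\<^sub>F x in nhds 0. norm (f x) \<le> C * norm x ^ k"
  obtain K where K: "K > 0" "\<forall>\<^sub>F x in nhds 0. norm (h x) \<le> K * norm x"
    using smooth_near_0_linear_bound[OF h(2,3)] by blast
  have "\<forall>\<^sub>F x in nhds 0. norm (f (h x)) \<le> C * norm (h x) ^ k"
    using f(3) h(4) unfolding filterlim_iff by blast
  with K(2) have "\<forall>\<^sub>F x in nhds 0. norm (f (h x)) \<le> (\<bar>C\<bar> * K ^ k) * norm x ^ k"
  proof eventually_elim
    case (elim x)
    have "C * norm (h x) ^ k \<le> \<bar>C\<bar> * (K * norm x) ^ k"
      using elim(1) by (intro mult_mono power_mono) auto
    then show ?case using elim(2) by (simp add: power_mult_distrib mult_ac)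
  qed
  then show ?thesis
    using f h by (auto simp: germ_comp_germ_of intro!: vanishingI smooth_near_0_compose)
qed

text \<open>Germs depending on a parameter with the two kinds of variables separated, as in a tensor
  product of \<open>A\<close> with the smooth germs: only the scalar factors depend on the
  parameter.\<close>

inductive_set families :: "('w \<Rightarrow> complex) set \<Rightarrow> ('w \<Rightarrow> (real ^ 'n, complex) germ) set" for A where
  families_0: "(\<lambda>_. 0) \<in> families A"
| families_step: "\<phi> \<in> families A \<Longrightarrow> u \<in> A \<Longrightarrow> p \<in> smooth_germs \<Longrightarrow> (\<lambda>w. \<phi> w + const (u w) * p) \<in> families A"

lemma families_add: "\<psi> \<in> families A \<Longrightarrow> \<phi> \<in> families A \<Longrightarrow> (\<lambda>w. \<phi> w + \<psi> w) \<in> families A"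
  by (induction rule: families.induct) (auto simp: add.assoc[symmetric] intro: families.intros)

lemma families_mono: "\<phi> \<in> families A \<Longrightarrow> A \<subseteq> B \<Longrightarrow> \<phi> \<in> families B"
  by (induction rule: families.induct) (auto intro: families.intros)

lemma families_smooth: "\<phi> \<in> families A \<Longrightarrow> \<phi> w \<in> smooth_germs"
  by (induction rule: families.induct) (simp_all add: smooth_germs_intros)

lemma families_comp:
  "\<phi> \<in> families A \<Longrightarrow> (\<And>u. u \<in> A \<Longrightarrow> (\<lambda>v. u (s v)) \<in> B) \<Longrightarrow> (\<lambda>v. \<phi> (s v)) \<in> families B"
  by (induction rule: families.induct) (auto intro: families.intros)

lemma fun_alg_mono: "u \<in> fun_alg \<Gamma> \<Longrightarrow> \<Gamma> \<subseteq> \<Delta> \<Longrightarrow> u \<in> fun_alg \<Delta>"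
  by (induction rule: fun_alg.induct) (auto intro: fun_alg.intros)

lemma fun_alg_comp: "u \<in> fun_alg \<Gamma> \<Longrightarrow> (\<lambda>v. u (s v)) \<in> fun_alg ((\<lambda>u v. u (s v)) ` \<Gamma>)"
  by (induction rule: fun_alg.induct) (auto intro: fun_alg.intros)

lemma families_scale:
  "\<phi> \<in> families (fun_alg \<Gamma>) \<Longrightarrow> u \<in> fun_alg \<Gamma> \<Longrightarrow> (\<lambda>w. const (u w) * \<phi> w) \<in> families (fun_alg \<Gamma>)"
proof (induction rule: families.induct)
  case (families_step \<phi> v p)
  then show ?case
    using families.families_step[of "\<lambda>w. const (u w) * \<phi> w" "fun_alg \<Gamma>" "\<lambda>w. u w * v w" p]
    by (simp add: fun_alg_mult const_mult algebra_simps)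
qed (simp add: families_0)

text \<open>The order of quantifiers is the point: \<open>\<Gamma>\<close> is chosen before
  \<open>F\<close> and \<open>k\<close>, so one finitely generated algebra contains the coefficients
  of the jets of every order.\<close>

definition finitely_parametrized :: "(real ^ 'n, real ^ 'n) germ set \<Rightarrow> bool" where
  "finitely_parametrized H \<longleftrightarrow> (\<exists>\<Gamma>. finite \<Gamma> \<and>
    (\<forall>F\<in>smooth_germs. \<forall>k. \<exists>\<phi>\<in>families (fun_alg \<Gamma>). \<forall>h\<in>H. germ_comp F h - \<phi> h \<in> vanishing k))"

text \<open>An exponent or a time need not be determined by the germ, for instance when the germ has
  finite order. So \<open>s\<close> selects one parameter for each germ, and the generators are
  transported along it.\<close>

lemma finitely_parametrizedI:
  fixes s :: "(real ^ 'n, real ^ 'n) germ \<Rightarrow> 'w"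
  assumes "finite \<Gamma>" "\<And>F k. F \<in> smooth_germs \<Longrightarrow>
    \<exists>\<phi>\<in>families (fun_alg \<Gamma>). \<forall>h\<in>H. germ_comp F h - \<phi> (s h) \<in> vanishing k"
  shows "finitely_parametrized H"
  unfolding finitely_parametrized_def
proof (intro exI[of _ "(\<lambda>u h. u (s h)) ` \<Gamma>"] conjI ballI allI)
  fix F :: "(real ^ 'n, complex) germ" and k assume "F \<in> smooth_germs"
  then obtain \<phi> where \<phi>: "\<phi> \<in> families (fun_alg \<Gamma>)" "\<forall>h\<in>H. germ_comp F h - \<phi> (s h) \<in> vanishing k"
    using assms(2) by blast
  show "\<exists>\<phi>\<in>families (fun_alg ((\<lambda>u h. u (s h)) ` \<Gamma>)). \<forall>h\<in>H. germ_comp F h - \<phi> h \<in> vanishing k"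
    using families_comp[of \<phi> "fun_alg \<Gamma>" s, OF \<phi>(1) fun_alg_comp[of _ \<Gamma> s]] \<phi>(2) by (intro bexI)
qed (use assms(1) in simp)

text \<open>\<open>F\<close> is first expanded along \<open>H\<close>; the finitely many fixed germs
  of this expansion are then expanded along \<open>K\<close>. The coefficients become sums of
  products of a function of the first factor and a function of the second.\<close>

lemma finitely_parametrized_comp:
  fixes H K :: "(real ^ 'n, real ^ 'n) germ set"
  assumes "finitely_parametrized H" "finitely_parametrized K"
    and fix_0: "H \<subseteq> smooth_germs_fix_0" "K \<subseteq> smooth_germs_fix_0"
  shows "finitely_parametrized {germ_comp h k | h k. h \<in> H \<and> k \<in> K}"
proof -
  obtain \<Gamma> where \<Gamma>: "finite \<Gamma>"
    "\<And>F k. F \<in> smooth_germs \<Longrightarrow> \<exists>\<phi>\<in>families (fun_alg \<Gamma>). \<forall>h\<in>H. germ_comp F h - \<phi> h \<in> vanishing k"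
    using assms(1) unfolding finitely_parametrized_def by blast
  obtain \<Delta> where \<Delta>: "finite \<Delta>"
    "\<And>F k. F \<in> smooth_germs \<Longrightarrow> \<exists>\<phi>\<in>families (fun_alg \<Delta>). \<forall>h\<in>K. germ_comp F h - \<phi> h \<in> vanishing k"
    using assms(2) unfolding finitely_parametrized_def by blast
  let ?P = "H \<times> K"
  let ?A = "(\<lambda>u p. u (fst p)) ` \<Gamma> \<union> (\<lambda>u p. u (snd p)) ` \<Delta> :: ((real ^ 'n, real ^ 'n) germ \<times> (real ^ 'n, real ^ 'n) germ \<Rightarrow> complex) set"
  have fst_alg: "(\<lambda>p. u (fst p)) \<in> fun_alg ?A" if "u \<in> fun_alg \<Gamma>" for u
    by (rule fun_alg_mono[OF fun_alg_comp[OF that]]) auto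
  have snd_alg: "(\<lambda>p. u (snd p)) \<in> fun_alg ?A" if "u \<in> fun_alg \<Delta>" for u
    by (rule fun_alg_mono[OF fun_alg_comp[OF that]]) auto
  \<comment> \<open>Factorizations need not be unique, so one is selected for each composed
    germ.\<close>
  define s where "s g = (SOME p. p \<in> ?P \<and> g = germ_comp (fst p) (snd p))" for g
  have s: "s g \<in> ?P \<and> g = germ_comp (fst (s g)) (snd (s g))" if "g \<in> {germ_comp h k | h k. h \<in> H \<and> k \<in> K}" for g
    unfolding s_def by (rule someI_ex) (use that in auto)
  show ?thesis
  proof (rule finitely_parametrizedI[of ?A _ s])
    fix F :: "(real ^ 'n, complex) germ" and k assume F: "F \<in> smooth_germs"
    obtain \<phi> where \<phi>: "\<phi> \<in> families (fun_alg \<Gamma>)" "\<forall>h\<in>H. germ_comp F h - \<phi> h \<in> vanishing k"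
      using \<Gamma>(2)[OF F] by blast
    have "\<exists>\<psi>\<in>families (fun_alg ?A). \<forall>p\<in>?P. germ_comp (\<phi> (fst p)) (snd p) - \<psi> p \<in> vanishing k"
      using \<phi>(1)
    proof (induction rule: families.induct)
      case families_0
      show ?case
        using fix_0(2) by (intro bexI[of _ "\<lambda>_. 0"] families.families_0) (auto simp: germ_comp_0 vanishing_0)
    next
      case (families_step \<phi> u q)
      then obtain \<psi> where \<psi>: "\<psi> \<in> families (fun_alg ?A)"
        "\<And>p. p \<in> ?P \<Longrightarrow> germ_comp (\<phi> (fst p)) (snd p) - \<psi> p \<in> vanishing k" by blast
      obtain \<eta> where \<eta>: "\<eta> \<in> families (fun_alg \<Delta>)" "\<And>h. h \<in> K \<Longrightarrow> germ_comp q h - \<eta> h \<in> vanishing k"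
        using \<Delta>(2)[OF families_step(3)] by blast
      let ?\<psi> = "\<lambda>p. \<psi> p + const (u (fst p)) * \<eta> (snd p)"
      have "?\<psi> \<in> families (fun_alg ?A)"
        by (intro families_add families_scale fst_alg families_step(2) \<psi>(1) families_comp[of \<eta> "fun_alg \<Delta>" snd, OF \<eta>(1) snd_alg])
      moreover have "germ_comp (\<phi> (fst p) + const (u (fst p)) * q) (snd p) - ?\<psi> p \<in> vanishing k" if "p \<in> ?P" for p
      proof -
        have "snd p \<in> smooth_germs_fix_0" "snd p \<in> K" using that fix_0(2) by auto
        then have "germ_comp (\<phi> (fst p) + const (u (fst p)) * q) (snd p) - ?\<psi> p =
            (germ_comp (\<phi> (fst p)) (snd p) - \<psi> p) + const (u (fst p)) * (germ_comp q (snd p) - \<eta> (snd p))"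
          by (simp add: germ_comp_add germ_comp_mult germ_comp_const algebra_simps)
        also have "\<dots> \<in> vanishing k"
          using \<open>snd p \<in> K\<close> by (intro vanishing_add \<psi>(2) that vanishing_smooth_mult[OF smooth_germs_const] \<eta>(2))
        finally show ?thesis .
      qed
      ultimately show ?case by (intro bexI[of _ ?\<psi>]) auto
    qed
    then obtain \<psi> where \<psi>: "\<psi> \<in> families (fun_alg ?A)"
      "\<And>p. p \<in> ?P \<Longrightarrow> germ_comp (\<phi> (fst p)) (snd p) - \<psi> p \<in> vanishing k" by blast
    have "germ_comp F g - \<psi> (s g) \<in> vanishing k" if g: "g \<in> {germ_comp h k | h k. h \<in> H \<and> k \<in> K}" for g
    proof -
      obtain h l where hl: "s g = (h, l)" "h \<in> H" "l \<in> K" "g = germ_comp h l"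
        using s[OF g] by (cases "s g") auto
      have fix': "h \<in> smooth_germs_fix_0" "l \<in> smooth_germs_fix_0" using hl fix_0 by auto
      have "germ_comp F g - \<psi> (s g) = germ_comp (germ_comp F h - \<phi> h) l + (germ_comp (\<phi> h) l - \<psi> (s g))"
        using fix' by (simp add: hl(4) germ_comp_assoc germ_comp_diff)
      also have "\<dots> \<in> vanishing k"
        using \<phi>(2) hl \<psi>(2)[of "s g"] fix' by (intro vanishing_add germ_comp_vanishing) auto
      finally show ?thesis .
    qed
    then show "\<exists>\<phi>\<in>families (fun_alg ?A). \<forall>h\<in>{germ_comp h k | h k. h \<in> H \<and> k \<in> K}. germ_comp F h - \<phi> (s h) \<in> vanishing k"
      by (intro bexI[OF _ \<psi>(1)] ballI)
  qed (use \<Gamma>(1) \<Delta>(1) in simp)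
qed

text \<open>Discrete variation of constants: the iterates of \<open>F\<close> satisfy
  \<open>x (n + 1) = \<alpha> * x n + y n\<close>, where \<open>y\<close> consists of the iterates
  of \<open>T F - const \<alpha> * F\<close> and is expanded by the induction hypothesis. The
  recurrence is then solved inside the span of the chains.\<close>

lemma power_expansion:
  fixes T :: "(real ^ 'n, complex) germ \<Rightarrow> (real ^ 'n, complex) germ"
  assumes "filtered_operator T"
    and "jordan_chains (\<lambda>U u. \<forall>n. U (Suc n) = u n) b adm" and b0: "\<And>\<beta>. \<beta> \<in> adm \<Longrightarrow> b 0 \<beta> = (\<lambda>n. \<beta> ^ n)"
    and "F \<in> smooth_germs" "set \<alpha>s \<subseteq> adm" "annihilate T \<alpha>s F \<in> vanishing k"
  shows "\<exists>\<phi>\<in>families (jordan_chains.chain_span b adm). \<forall>n. (T ^^ n) F - \<phi> n \<in> vanishing k"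
proof -
  interpret filtered_operator T by fact
  interpret jordan_chains "\<lambda>U u. \<forall>n. U (Suc n) = u n" b adm by fact
  show ?thesis
    using assms(4-6)
  proof (induction \<alpha>s arbitrary: F)
    case Nil
    have "(T ^^ n) F \<in> vanishing k" for n using Nil.prems by (induction n) (auto intro: T_van)
    then show ?case by (intro bexI[of _ "\<lambda>_. 0"] families_0) simp
  next
    case (Cons \<alpha> \<alpha>s)
    let ?F = "T F - const \<alpha> * F"
    have \<alpha>: "\<alpha> \<in> adm" using Cons.prems by simp
    have sm: "(T ^^ n) F \<in> smooth_germs" for n using Cons.prems(1) by (induction n) (auto intro: T_smooth)
    have "?F \<in> smooth_germs"
      by (intro smooth_germs_diff smooth_germs_mult smooth_germs_const T_smooth Cons.prems(1))
    then obtain \<phi> where \<phi>: "\<phi> \<in> families chain_span" "\<And>n. (T ^^ n) ?F - \<phi> n \<in> vanishing k"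
      using Cons.IH[of ?F] Cons.prems(2,3) by (metis annihilate.simps(2) insert_subset list.set(2))
    have "\<exists>\<Phi>\<in>families chain_span. \<forall>n. \<Phi> (Suc n) = const \<alpha> * \<Phi> n + \<phi> n"
      using \<phi>(1)
    proof (induction rule: families.induct)
      case families_0
      show ?case by (intro bexI[of _ "\<lambda>_. 0"] families.families_0) simp
    next
      case (families_step \<phi> u p)
      then obtain \<Phi> where \<Phi>: "\<Phi> \<in> families chain_span" "\<And>n. \<Phi> (Suc n) = const \<alpha> * \<Phi> n + \<phi> n" by blast
      obtain U where U: "U \<in> chain_span" "\<And>n. U (Suc n) = \<alpha> * U n + u n"
        using chain_span_solution[OF families_step(2) \<alpha>] by auto
      show ?case
        by (intro bexI[of _ "\<lambda>n. \<Phi> n + const (U n) * p"] families.families_step \<Phi>(1) U(1) families_step(3))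
          (simp add: \<Phi>(2) U(2) const_add const_mult algebra_simps)
    qed
    then obtain \<Phi> where \<Phi>: "\<Phi> \<in> families chain_span" "\<And>n. \<Phi> (Suc n) = const \<alpha> * \<Phi> n + \<phi> n" by blast
    \<comment> \<open>Modulo \<open>vanishing k\<close> this error solves the homogeneous
      recurrence, so it equals \<open>\<alpha> ^ n\<close> times its initial value. Adding that term
      corrects the particular solution \<open>\<Phi>\<close>.\<close>
    define d where "d n = (T ^^ n) F - \<Phi> n" for n
    have step: "d (Suc n) - const \<alpha> * d n \<in> vanishing k" for n
    proof -
      have "(T ^^ n) ?F = (T ^^ Suc n) F - const \<alpha> * (T ^^ n) F"
        using sm[of 0] sm[of 1]
      proof (induction n)
        case (Suc n)
        then show ?case
          using sm by (simp add: T_diff T_const T_smooth smooth_germs_mult smooth_germs_const)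
      qed simp
      then have "d (Suc n) - const \<alpha> * d n = (T ^^ n) ?F - \<phi> n"
        by (simp add: d_def \<Phi>(2) algebra_simps)
      then show ?thesis using \<phi>(2) by simp
    qed
    have "d n - const (\<alpha> ^ n) * d 0 \<in> vanishing k" for n
    proof (induction n)
      case 0
      then show ?case by (simp add: const_1 vanishing_0)
    next
      case (Suc n)
      have eq: "d (Suc n) - const (\<alpha> ^ Suc n) * d 0 =
          (d (Suc n) - const \<alpha> * d n) + const \<alpha> * (d n - const (\<alpha> ^ n) * d 0)"
        by (simp add: const_mult algebra_simps)
      show ?case
        unfolding eq by (rule vanishing_add[OF step vanishing_smooth_mult[OF smooth_germs_const Suc]])
    qed
    moreover have "(\<lambda>n. \<Phi> n + const (b 0 \<alpha> n) * d 0) \<in> families chain_span"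
      using sm[of 0] families_smooth[OF \<Phi>(1)]
      by (intro families.families_step \<Phi>(1) chain_span_b \<alpha>) (simp add: d_def smooth_germs_diff)
    ultimately show ?case
      by (intro bexI[of _ "\<lambda>n. \<Phi> n + const (b 0 \<alpha> n) * d 0"])
        (simp_all add: d_def b0[OF \<alpha>] algebra_simps)
  qed
qed

section \<open>Powers of a diffeomorphism germ\<close>

lemma germ_comp_filtered_operator:
  assumes "a \<in> smooth_germs_fix_0"
  shows "filtered_operator (\<lambda>F. germ_comp F a)"
  by unfold_locales
    (simp_all add: assms germ_comp_vanishing germ_comp_add germ_comp_mult germ_comp_const)

definition germ_power :: "(real ^ 'n, real ^ 'n) germ \<Rightarrow> nat \<Rightarrow> (real ^ 'n, real ^ 'n) germ" where
  "germ_power a n = ((\<lambda>h. germ_comp h a) ^^ n) id_germ"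

lemma germ_power_fix_0: "a \<in> smooth_germs_fix_0 \<Longrightarrow> germ_power a n \<in> smooth_germs_fix_0"
  by (induction n) (auto simp: germ_power_def id_germ_fix_0 germ_comp_fix_0)

lemma germ_comp_germ_power:
  assumes "a \<in> smooth_germs_fix_0"
  shows "germ_comp F (germ_power a n) = ((\<lambda>F. germ_comp F a) ^^ n) F"
proof (induction n)
  case (Suc n)
  have "germ_comp F (germ_power a (Suc n)) = germ_comp F (germ_comp (germ_power a n) a)"
    by (simp add: germ_power_def)
  also have "\<dots> = germ_comp (germ_comp F (germ_power a n)) a"
    by (rule germ_comp_assoc[symmetric]) (rule germ_power_fix_0[OF assms], rule assms)
  finally show ?case using Suc by simp
qed (simp add: germ_power_def germ_comp_id)

text \<open>For fixed \<open>i\<close> the binomial coefficient is a polynomial in \<open>n\<close>,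
  by recursion on \<open>i\<close>. The complex difference of \<open>n\<close> and \<open>i\<close>
  is correct also for \<open>n < i\<close>, since it is then multiplied by zero.\<close>

lemma of_nat_choose_fun_alg: "(\<lambda>n. of_nat (n choose i)) \<in> fun_alg (insert of_nat \<Gamma>)"
proof (induction i)
  case (Suc i)
  have *: "of_nat (n choose Suc i) = inverse (of_nat (Suc i)) * (of_nat (n choose i) * (of_nat n + - of_nat i) :: complex)" for n
  proof (cases "i \<le> n")
    case True
    have "Suc i * (n choose Suc i) = (n choose i) * (n - i)"
      using binomial_absorption[of i n] binomial_absorb_comp[of n i] by (simp only: mult.commute)
    then have "of_nat (Suc i * (n choose Suc i)) = (of_nat ((n choose i) * (n - i)) :: complex)" by (rule arg_cong)
    then have "of_nat (Suc i) * of_nat (n choose Suc i) = (of_nat (n choose i) * (of_nat n - of_nat i) :: complex)"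
      by (simp only: of_nat_mult of_nat_diff[OF True])
    then show ?thesis by (simp add: field_simps del: of_nat_Suc)
  qed (simp add: binomial_eq_0)
  show ?case
    unfolding * by (intro fun_alg_mult fun_alg_add fun_alg_const Suc fun_alg_gen insertI1)
qed (use fun_alg_const[of 1] in simp)

lemma finitely_parametrized_powers:
  fixes a a' :: "(real ^ 'n, real ^ 'n) germ"
  assumes a: "a \<in> smooth_germs_fix_0" "a' \<in> smooth_germs_fix_0" "germ_comp a a' = id_germ"
  shows "finitely_parametrized (range (germ_power a))"
proof -
  define T where "T = (\<lambda>F :: (real ^ 'n, complex) germ. germ_comp F a)"
  interpret filtered_operator T unfolding T_def by (rule germ_comp_filtered_operator[OF a(1)])
  \<comment> \<open>Invertibility of \<open>a\<close> makes \<open>T\<close> injective modulo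
    \<open>vanishing k\<close>, so that roots equal to \<open>0\<close> can be cancelled from the
    lists. The functions \<open>b\<close> below divide by powers of the roots.\<close>
  have cancel: "F \<in> vanishing k" if "T F \<in> vanishing k" for F k
    using germ_comp_vanishing[OF a(2) that]
    by (simp add: T_def germ_comp_assoc[OF a(1,2)] a(3) germ_comp_id)
  have drop_zeros: "annihilate T (filter (\<lambda>\<alpha>. \<alpha> \<noteq> 0) \<alpha>s) F \<in> vanishing k"
    if "F \<in> smooth_germs" "annihilate T \<alpha>s F \<in> vanishing k" for \<alpha>s F k
    using that
  proof (induction \<alpha>s arbitrary: F)
    case (Cons \<alpha> \<alpha>s)
    show ?case
    proof (cases "\<alpha> = 0")
      case True
      then have "T (annihilate T \<alpha>s F) \<in> vanishing k"
        using Cons.prems annihilate_step_commute[OF Cons.prems(1), of \<alpha>s 0] by (simp add: const_0)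
      then have "annihilate T \<alpha>s F \<in> vanishing k" by (rule cancel)
      then show ?thesis using Cons True by simp
    next
      case False
      then show ?thesis
        using Cons by (simp add: smooth_germs_diff smooth_germs_mult smooth_germs_const T_smooth)
    qed
  qed simp
  have "\<forall>i. \<exists>\<alpha>s. 0 \<notin> set \<alpha>s \<and> annihilate T \<alpha>s (coord i) \<in> vanishing 2"
  proof
    fix i
    obtain \<alpha>s where "annihilate T \<alpha>s (coord i) \<in> vanishing 2"
      using annihilate_linear_part[OF coord_vanishing] by blast
    from drop_zeros[OF smooth_germs_coord this]
    show "\<exists>\<alpha>s. 0 \<notin> set \<alpha>s \<and> annihilate T \<alpha>s (coord i) \<in> vanishing 2"
      by (intro exI[of _ "filter (\<lambda>\<alpha>. \<alpha> \<noteq> 0) \<alpha>s"] conjI) simp_all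
  qed
  from choice[OF this] obtain \<alpha>s where
    \<alpha>s: "\<And>i. 0 \<notin> set (\<alpha>s i)" "\<And>i. annihilate T (\<alpha>s i) (coord i) \<in> vanishing 2" by blast
  define \<Lambda> where "\<Lambda> = (\<Union>i. set (\<alpha>s i))"
  define \<Gamma> :: "(nat \<Rightarrow> complex) set" where "\<Gamma> = insert of_nat ((\<lambda>\<beta> n. \<beta> ^ n) ` \<Lambda>)"
  define adm where "adm = {\<beta>. \<beta> \<noteq> 0 \<and> (\<lambda>n. \<beta> ^ n) \<in> fun_alg \<Gamma>}"
  \<comment> \<open>The quotient \<open>\<beta> ^ n / \<beta> ^ i\<close> avoids truncated
    subtraction in the exponent and exhibits \<open>\<beta> ^ n\<close>, which lies in the algebra;
    for \<open>n < i\<close> the binomial coefficient is zero.\<close>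
  define b :: "nat \<Rightarrow> complex \<Rightarrow> nat \<Rightarrow> complex" where "b i \<beta> n = of_nat (n choose i) * \<beta> ^ n / \<beta> ^ i" for i \<beta> n
  have \<Lambda>: "\<Lambda> \<subseteq> adm"
    unfolding adm_def
  proof (intro subsetI CollectI conjI)
    fix \<beta> assume "\<beta> \<in> \<Lambda>"
    then show "(\<lambda>n. \<beta> ^ n) \<in> fun_alg \<Gamma>" by (intro fun_alg_gen) (auto simp: \<Gamma>_def)
    show "\<beta> \<noteq> 0" using \<open>\<beta> \<in> \<Lambda>\<close> \<alpha>s(1) by (auto simp: \<Lambda>_def)
  qed
  interpret multiplicative_operator T T "(*)" "\<lambda>\<alpha>. \<alpha>" adm 1
  proof unfold_locales
    show "\<alpha> * \<beta> \<in> adm" if "\<alpha> \<in> adm" "\<beta> \<in> adm" for \<alpha> \<beta>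
      using that fun_alg_mult[of "\<lambda>n. \<alpha> ^ n" \<Gamma> "\<lambda>n. \<beta> ^ n"]
      by (simp add: adm_def power_mult_distrib[symmetric])
    have "(\<lambda>n. (1::complex) ^ n) \<in> fun_alg \<Gamma>" by (simp only: power_one fun_alg_const)
    then show "1 \<in> adm" unfolding adm_def by (intro CollectI conjI) (rule one_neq_zero, assumption)
    show "T 1 = const 1" unfolding T_def const_1[symmetric] by (rule germ_comp_const[OF a(1)])
  qed (simp_all add: T_def germ_comp_mult[OF a(1)] const_mult algebra_simps)
  interpret chains: jordan_chains "\<lambda>U u. \<forall>n. U (Suc n) = u n" b adm
  proof unfold_locales
    fix \<beta> i assume "\<beta> \<in> adm"
    then have "\<beta> \<noteq> 0" by (simp add: adm_def)
    then show "\<forall>n. b (Suc i) \<beta> (Suc n) = \<beta> * b (Suc i) \<beta> n + b i \<beta> n"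
      by (auto simp: b_def field_simps)
  qed (auto simp: b_def)
  have span: "chains.chain_span \<subseteq> fun_alg \<Gamma>"
  proof
    fix u assume "u \<in> chains.chain_span"
    then show "u \<in> fun_alg \<Gamma>"
    proof (induction rule: chains.chain_span.induct)
      case (chain_span_step u \<beta> c i)
      have "(\<lambda>n. u n + (c * inverse (\<beta> ^ i)) * (of_nat (n choose i) * \<beta> ^ n)) \<in> fun_alg \<Gamma>"
        using chain_span_step of_nat_choose_fun_alg[of i] unfolding \<Gamma>_def adm_def
        by (intro fun_alg_add fun_alg_mult fun_alg_const) auto
      then show ?case by (simp add: b_def divide_inverse mult_ac)
    qed (rule fun_alg_const)
  qed
  define s where "s h = (SOME n. h = germ_power a n)" for h
  have s: "h = germ_power a (s h)" if "h \<in> range (germ_power a)" for h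
    unfolding s_def by (rule someI_ex) (use that in auto)
  show ?thesis
  proof (rule finitely_parametrizedI[of \<Gamma> _ s])
    show "finite \<Gamma>" by (simp add: \<Gamma>_def \<Lambda>_def)
    fix F :: "(real ^ 'n, complex) germ" and k assume F: "F \<in> smooth_germs"
    have "coord i \<in> nilpotent_mod adm 2" for i
      using \<alpha>s(2)[of i] \<Lambda> unfolding nilpotent_mod_def \<Lambda>_def by (auto simp: smooth_germs_coord)
    then have "F \<in> nilpotent_mod adm k" using F by (rule nilpotent_mod_all)
    then obtain \<beta>s where "set \<beta>s \<subseteq> adm" "annihilate T \<beta>s F \<in> vanishing k"
      unfolding nilpotent_mod_def by blast
    moreover have "b 0 \<beta> = (\<lambda>n. \<beta> ^ n)" for \<beta> by (simp add: b_def fun_eq_iff)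
    ultimately obtain \<phi> where \<phi>: "\<phi> \<in> families chains.chain_span" "\<And>n. (T ^^ n) F - \<phi> n \<in> vanishing k"
      using power_expansion[OF filtered_operator_axioms chains.jordan_chains_axioms _ F] by blast
    have "germ_comp F h - \<phi> (s h) \<in> vanishing k" if "h \<in> range (germ_power a)" for h
      using \<phi>(2)[of "s h"] s[OF that] germ_comp_germ_power[OF a(1), of F "s h"] by (simp add: T_def)
    then show "\<exists>\<phi>\<in>families (fun_alg \<Gamma>). \<forall>h\<in>range (germ_power a). germ_comp F h - \<phi> (s h) \<in> vanishing k"
      using families_mono[OF \<phi>(1) span] by (intro bexI) auto
  qed
qed

section \<open>Flows\<close>

definition deriv_along ::
  "(real ^ 'n \<Rightarrow> real ^ 'n) \<Rightarrow> (real ^ 'n, 'b::real_normed_field) germ \<Rightarrow> (real ^ 'n, 'b) germ" where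
  "deriv_along v F = germ_of (\<lambda>x. frechet_derivative (rep_germ F) (at x) (v x))"

lemma frechet_derivative_cong_near:
  assumes "\<forall>\<^sub>F y in nhds x. f y = g y"
  shows "frechet_derivative f (at x) = frechet_derivative g (at x)"
proof -
  obtain S where S: "open S" "x \<in> S" "\<And>y. y \<in> S \<Longrightarrow> f y = g y"
    using assms unfolding eventually_nhds by blast
  have "(f has_derivative D) (at x) \<longleftrightarrow> (g has_derivative D) (at x)" for D
    using has_derivative_transform_within_open[OF _ S(1,2), of f D UNIV g]
      has_derivative_transform_within_open[OF _ S(1,2), of g D UNIV f] S(3) by auto
  then show ?thesis by (simp add: frechet_derivative_def)
qed

text \<open>Independence of the representative: functions that agree near the origin agree near
  every point close to it, so their derivatives agree at all these points.\<close>

lemma deriv_along_germ_of: "deriv_along v (germ_of f) = germ_of (\<lambda>x. frechet_derivative f (at x) (v x))"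
proof -
  have "\<forall>\<^sub>F x in nhds 0. rep_germ (germ_of f) x = f x"
    using Quotient_abs_rep[OF Quotient_germ, of "germ_of f"] by (simp only: germ_of_eq_iff)
  then have "\<forall>\<^sub>F x in nhds 0. \<forall>\<^sub>F y in nhds x. rep_germ (germ_of f) y = f y"
    by (simp add: eventually_eventually)
  then show ?thesis
    unfolding deriv_along_def germ_of_eq_iff
    by (rule eventually_mono) (simp add: frechet_derivative_cong_near)
qed

context
  fixes v :: "real ^ 'n \<Rightarrow> real ^ 'n"
  assumes v: "smooth_near_0 v" "v 0 = 0"
begin

lemma smooth_near_0_deriv_along:
  assumes "smooth_near_0 f"
  shows "smooth_near_0 (\<lambda>x. frechet_derivative f (at x) (v x))"
proof -
  have "\<forall>\<^sub>F x in nhds 0. (\<Sum>b\<in>Basis. (v x \<bullet> b) *\<^sub>R frechet_derivative f (at x) b) = frechet_derivative f (at x) (v x)"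
    using smooth_near_0_has_derivative[OF assms]
  proof eventually_elim
    case (elim x)
    then have lin: "linear (frechet_derivative f (at x))" by (rule has_derivative_linear)
    show ?case
      using linear_sum[OF lin, of "\<lambda>b. (v x \<bullet> b) *\<^sub>R b" Basis]
      by (simp add: euclidean_representation linear_scale[OF lin])
  qed
  moreover have "smooth_near_0 (\<lambda>x. \<Sum>b\<in>Basis. (v x \<bullet> b) *\<^sub>R frechet_derivative f (at x) b)"
    by (intro smooth_near_0_sum smooth_near_0_bilinear[OF bounded_bilinear_scaleR]
        smooth_near_0_frechet[OF assms] smooth_near_0_bounded_linear_comp[OF bounded_linear_inner_left v(1)])
  ultimately show ?thesis using smooth_near_0_cong by (auto simp: eq_near_0_def)
qed

lemma deriv_along_smooth:
  "F \<in> smooth_germs \<Longrightarrow> deriv_along v F \<in> smooth_germs"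
  by (erule smooth_germsE) (simp add: deriv_along_germ_of germ_of_in_smooth_germs_iff smooth_near_0_deriv_along)

lemma deriv_along_add:
  assumes "F \<in> smooth_germs" "G \<in> smooth_germs"
  shows "deriv_along v (F + G) = deriv_along v F + deriv_along v G"
proof -
  obtain f g where f: "F = germ_of f" "smooth_near_0 f" and g: "G = germ_of g" "smooth_near_0 g"
    using assms by (auto simp: smooth_germs_def)
  have "\<forall>\<^sub>F x in nhds 0. frechet_derivative (\<lambda>x. f x + g x) (at x) (v x) =
      frechet_derivative f (at x) (v x) + frechet_derivative g (at x) (v x)"
    using smooth_near_0_has_derivative[OF f(2)] smooth_near_0_has_derivative[OF g(2)]
  proof eventually_elim
    case (elim x)
    show ?case by (simp add: frechet_derivative_at[OF has_derivative_add[OF elim], symmetric])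
  qed
  then show ?thesis by (simp add: f(1) g(1) germ_of_add deriv_along_germ_of germ_of_eq_iff)
qed

lemma deriv_along_mult:
  assumes "F \<in> smooth_germs" "G \<in> smooth_germs"
  shows "deriv_along v (F * G) = deriv_along v F * G + F * deriv_along v G"
proof -
  obtain f g where f: "F = germ_of f" "smooth_near_0 f" and g: "G = germ_of g" "smooth_near_0 g"
    using assms by (auto simp: smooth_germs_def)
  have "\<forall>\<^sub>F x in nhds 0. frechet_derivative (\<lambda>x. f x * g x) (at x) (v x) =
      frechet_derivative f (at x) (v x) * g x + f x * frechet_derivative g (at x) (v x)"
    using smooth_near_0_has_derivative[OF f(2)] smooth_near_0_has_derivative[OF g(2)]
  proof eventually_elim
    case (elim x)
    show ?case by (simp add: frechet_derivative_at[OF has_derivative_mult[OF elim], symmetric])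
  qed
  then show ?thesis
    by (simp add: f(1) g(1) germ_of_mult germ_of_add deriv_along_germ_of germ_of_eq_iff)
qed

lemma deriv_along_const: "deriv_along v (const c) = 0"
  by (simp add: const_def deriv_along_germ_of germ_of_0)

lemma deriv_along_sum:
  "(\<And>i. i \<in> I \<Longrightarrow> F i \<in> smooth_germs) \<Longrightarrow> deriv_along v (\<Sum>i\<in>I. F i) = (\<Sum>i\<in>I. deriv_along v (F i))"
  by (induction I rule: infinite_finite_induct)
    (auto simp: deriv_along_add smooth_germs_sum deriv_along_const simp flip: const_0)

lemma deriv_along_coord: "deriv_along v (coord i :: (real ^ 'n, 'b::real_normed_field) germ) \<in> vanishing 1"
proof -
  have bl: "bounded_linear (\<lambda>x::real ^ 'n. of_real (x $ i) :: 'b)"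
    by (intro bounded_linear_compose[OF bounded_linear_of_real bounded_linear_vec_nth])
  have "frechet_derivative (\<lambda>x::real ^ 'n. of_real (x $ i) :: 'b) (at x) = (\<lambda>x. of_real (x $ i))" for x
    using frechet_derivative_at[OF bounded_linear_imp_has_derivative[OF bl]] by simp
  then have "deriv_along v (coord i :: (real ^ 'n, 'b) germ) = germ_of (\<lambda>x. of_real (v x $ i))"
    by (simp add: coord_def deriv_along_germ_of)
  moreover obtain C where "\<forall>\<^sub>F x in nhds 0. norm (v x) \<le> C * norm x"
    using smooth_near_0_linear_bound[OF v] by blast
  then have "\<forall>\<^sub>F x in nhds 0. norm (of_real (v x $ i) :: 'b) \<le> C * norm x ^ 1"
    by eventually_elim (use component_le_norm_cart order_trans in \<open>fastforce simp: norm_of_real\<close>)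
  ultimately show ?thesis
    by (simp only:) (rule vanishingI, rule smooth_near_0_bounded_linear_comp[OF bl v(1)])
qed

text \<open>A growth bound on a function says nothing about its derivative, so the germ is written
  with monomials by Hadamard's lemma. The product rule removes one coordinate from a monomial and
  puts a component of \<open>v\<close>, again of order one, in its place.\<close>

lemma deriv_along_vanishing:
  fixes F :: "(real ^ 'n, 'b::{real_normed_field, banach}) germ"
  assumes "F \<in> vanishing k"
  shows "deriv_along v F \<in> vanishing k"
proof -
  have wmono: "deriv_along v (wmono l :: (real ^ 'n, 'b) germ) \<in> vanishing (length l)" for l
  proof (induction l)
    case Nil
    show ?case by (simp add: wmono_def vanishing_zero_eq smooth_germs_1 deriv_along_smooth)
  next
    case (Cons i l)
    have eq: "deriv_along v (wmono (i # l) :: (real ^ 'n, 'b) germ) =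
        deriv_along v (coord i) * wmono l + coord i * deriv_along v (wmono l)"
      by (simp add: wmono_def deriv_along_mult smooth_germs_coord smooth_germs_wmono[unfolded wmono_def])
    show ?case
      unfolding eq
      using vanishing_mult[OF deriv_along_coord wmono_vanishing, of i l] vanishing_mult[OF coord_vanishing Cons, of i]
      by (intro vanishing_add) simp_all
  qed
  obtain y where y: "\<And>l. y l \<in> smooth_germs" "F = (\<Sum>l\<in>words k. wmono l * y l)"
    using vanishing_hadamard[OF assms] by blast
  have "deriv_along v (wmono l * y l) \<in> vanishing k" if "l \<in> words k" for l
  proof -
    have "length l = k" using that by simp
    then have "deriv_along v (wmono l) * y l + wmono l * deriv_along v (y l) \<in> vanishing k"
      using vanishing_mult_smooth[OF wmono y(1), of l l]
        vanishing_mult_smooth[OF wmono_vanishing deriv_along_smooth[OF y(1)], of l l] by (simp add: vanishing_add)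
    then show ?thesis by (simp add: deriv_along_mult smooth_germs_wmono y(1))
  qed
  then show ?thesis
    unfolding y(2)
    by (subst deriv_along_sum) (auto intro: smooth_germs_mult smooth_germs_wmono y(1) vanishing_sum)
qed

end

lemma deriv_along_filtered_operator:
  assumes "smooth_near_0 v" "v 0 = 0"
  shows "filtered_operator (deriv_along v)"
  by unfold_locales
    (simp_all add: deriv_along_vanishing[OF assms] deriv_along_add[OF assms] deriv_along_mult[OF assms]
      deriv_along_const[OF assms] smooth_germs_const)

text \<open>Only forward times occur: for a fixed direction of time, flow maps compose by concatenating
  trajectories, with no appeal to uniqueness. Flows backward in time are flows of \<open>-v\<close>.\<close>

definition flow_family ::
  "(real ^ 'n \<Rightarrow> real ^ 'n) \<Rightarrow> real \<Rightarrow> (real ^ 'n) set \<Rightarrow> (real \<Rightarrow> real ^ 'n \<Rightarrow> real ^ 'n) \<Rightarrow> bool" where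
  "flow_family v \<tau> U \<psi> \<longleftrightarrow> 0 \<le> \<tau> \<and> open U \<and> 0 \<in> U \<and>
    (\<forall>x\<in>U. \<psi> 0 x = x \<and> (\<forall>s\<in>{0..\<tau>}.
      ((\<lambda>s. \<psi> s x) has_vector_derivative v (\<psi> s x)) (at s within {0..\<tau>})))"

text \<open>A Gronwall estimate with a continuation argument, since the linear bound on
  \<open>v\<close> is available only up to radius \<open>\<rho>\<close>: as long as the trajectory
  stays there, its norm grows at most exponentially, and \<open>init\<close> then keeps it from ever
  reaching that radius.\<close>

lemma trajectory_bound:
  fixes \<psi> :: "real \<Rightarrow> 'a::euclidean_space"
  assumes deriv: "\<And>s. s \<in> {0..\<tau>} \<Longrightarrow> (\<psi> has_vector_derivative v (\<psi> s)) (at s within {0..\<tau>})"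
    and v: "\<And>y. norm y \<le> \<rho> \<Longrightarrow> norm (v y) \<le> C * norm y"
    and C: "C \<ge> 0" and init: "norm (\<psi> 0) * exp (C * \<tau>) < \<rho>" and s: "s \<in> {0..\<tau>}"
  shows "norm (\<psi> s) \<le> norm (\<psi> 0) * exp (C * \<tau>)"
proof -
  have cont: "continuous_on {0..\<tau>} \<psi>"
    unfolding continuous_on_eq_continuous_within using has_vector_derivative_continuous[OF deriv] by blast
  have bound: "norm (\<psi> r) \<le> norm (\<psi> 0) * exp (C * \<tau>)"
    if r: "r \<in> {0..\<tau>}" and small: "\<And>q. q \<in> {0..<r} \<Longrightarrow> norm (\<psi> q) \<le> \<rho>" for r
  proof -
    \<comment> \<open>The squared norm grows at a rate of at most \<open>2 * C\<close>, which the
      exponential factor compensates, so \<open>?h\<close> is nonincreasing.\<close>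
    let ?h = "\<lambda>q. exp (- (2 * C * q)) * (\<psi> q \<bullet> \<psi> q)"
    have contr: "continuous_on {0..r} ?h"
    proof -
      have "continuous_on {0..r} \<psi>" using cont r by (auto intro: continuous_on_subset)
      then show ?thesis by (intro continuous_intros)
    qed
    have deriv_h: "\<exists>y\<le>0. (?h has_real_derivative y) (at q)" if q: "0 < q" "q < r" for q
    proof -
      have "(\<psi> has_vector_derivative v (\<psi> q)) (at q within {0..\<tau>})" using q r by (intro deriv) auto
      then have "(\<psi> has_vector_derivative v (\<psi> q)) (at q)"
        using q r by (simp add: at_within_Icc_at)
      then have D: "(?h has_real_derivative
          exp (- (2 * C * q)) * (2 * (\<psi> q \<bullet> v (\<psi> q)) - 2 * C * (\<psi> q \<bullet> \<psi> q))) (at q)"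
        unfolding has_vector_derivative_def has_field_derivative_def
        by (auto intro!: derivative_eq_intros simp: inner_commute algebra_simps)
      have "norm (v (\<psi> q)) \<le> C * norm (\<psi> q)" using q by (intro v small) auto
      then have "\<psi> q \<bullet> v (\<psi> q) \<le> norm (\<psi> q) * (C * norm (\<psi> q))"
        using norm_cauchy_schwarz[of "\<psi> q" "v (\<psi> q)"] by (meson mult_left_mono norm_ge_zero order_trans)
      then have "\<psi> q \<bullet> v (\<psi> q) \<le> C * (\<psi> q \<bullet> \<psi> q)"
        by (simp add: dot_square_norm power2_eq_square mult_ac)
      then have "exp (- (2 * C * q)) * (2 * (\<psi> q \<bullet> v (\<psi> q)) - 2 * C * (\<psi> q \<bullet> \<psi> q)) \<le> 0"
        by (intro mult_nonneg_nonpos) auto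
      then show ?thesis using D by blast
    qed
    have "?h r \<le> ?h 0"
    proof (cases "r = 0")
      case False
      then have "0 < r" using r by simp
      then obtain l z where z: "0 < z" "z < r" "(?h has_real_derivative l) (at z)" "?h r - ?h 0 = (r - 0) * l"
      proof -
        have "?h differentiable (at q)" if "0 < q" "q < r" for q
          using deriv_h[OF that] unfolding real_differentiable_def by blast
        from MVT[OF \<open>0 < r\<close> contr this] show ?thesis using that by blast
      qed
      obtain y where "y \<le> 0" "(?h has_real_derivative y) (at z)" using deriv_h[OF z(1,2)] by blast
      then have "l \<le> 0" using DERIV_unique[OF z(3)] by simp
      then have "r * l \<le> 0" using \<open>0 < r\<close> by (simp add: mult_nonneg_nonpos)
      then have "?h r - ?h 0 \<le> 0" using z(4) by (simp only: diff_zero)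
      then show ?thesis by (simp only: diff_le_0_iff_le)
    qed simp
    then have "norm (\<psi> r) ^ 2 \<le> exp (2 * C * r) * norm (\<psi> 0) ^ 2"
      by (simp add: dot_square_norm exp_minus field_simps)
    also have "\<dots> \<le> exp (2 * C * \<tau>) * norm (\<psi> 0) ^ 2"
      using r C by (intro mult_right_mono) (auto intro!: mult_left_mono)
    also have "\<dots> = (norm (\<psi> 0) * exp (C * \<tau>)) ^ 2"
      by (simp add: power_mult_distrib power2_eq_square flip: exp_add)
    finally show ?thesis by (rule power2_le_imp_le) simp
  qed
  have "norm (\<psi> q) \<le> \<rho>" if "q \<in> {0..\<tau>}" for q
  proof (rule ccontr)
    assume neg: "\<not> norm (\<psi> q) \<le> \<rho>"
    \<comment> \<open>The least element \<open>p\<close> of this compact set is the first time at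
      which radius \<open>\<rho>\<close> is reached. The estimate holds up to and including
      \<open>p\<close>, where it contradicts \<open>init\<close>.\<close>
    let ?Z = "{0..\<tau>} \<inter> (\<lambda>q. norm (\<psi> q)) -` {\<rho>..}"
    have "closed ?Z"
      by (intro continuous_closed_preimage continuous_on_norm cont) auto
    from compact_Int_closed[OF compact_Icc[of 0 \<tau>] this]
    have "compact ?Z" by (simp only: Int_assoc[symmetric] Int_absorb)
    moreover have "q \<in> ?Z" using neg that by simp
    then have "?Z \<noteq> {}" by blast
    ultimately obtain p where p: "p \<in> ?Z" "\<And>r. r \<in> ?Z \<Longrightarrow> p \<le> r"
      using compact_attains_inf[of ?Z] by blast
    have "norm (\<psi> r) \<le> \<rho>" if "r \<in> {0..<p}" for r
    proof (rule ccontr)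
      assume "\<not> norm (\<psi> r) \<le> \<rho>"
      then have "r \<in> ?Z" using that p(1) by simp
      then show False using p(2)[of r] that by simp
    qed
    then have "norm (\<psi> p) \<le> norm (\<psi> 0) * exp (C * \<tau>)" using p(1) by (intro bound) auto
    then show False using p(1) init by auto
  qed
  then show ?thesis using s by (intro bound) auto
qed

lemma flow_family_bound:
  assumes "flow_family v \<tau> U \<psi>" "\<forall>\<^sub>F x in nhds 0. v x = u x" "smooth_near_0 u" "u 0 = 0"
  shows "\<exists>K>0. \<forall>\<^sub>F x in nhds 0. x \<in> U \<and> (\<forall>s\<in>{0..\<tau>}. norm (\<psi> s x) \<le> K * norm x)"
proof -
  obtain C where C: "C > 0" "\<forall>\<^sub>F x in nhds 0. norm (u x) \<le> C * norm x"
    using smooth_near_0_linear_bound[OF assms(3,4)] by blast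
  have "\<forall>\<^sub>F x in nhds 0. norm (v x) \<le> C * norm x" using assms(2) C(2) by eventually_elim simp
  then obtain d where d: "d > 0" "\<And>y. dist y 0 < d \<Longrightarrow> norm (v y) \<le> C * norm y"
    unfolding eventually_nhds_metric by blast
  then have v: "norm (v y) \<le> C * norm y" if "norm y \<le> d / 2" for y
    using that by (intro d(2)) (simp add: dist_norm)
  note fl = assms(1)[unfolded flow_family_def]
  have "\<forall>\<^sub>F x in nhds 0. x \<in> U" using fl by (intro eventually_nhds_in_open) auto
  \<comment> \<open>From starting points in this ball, growth by the factor
    \<open>exp (C * \<tau>)\<close> does not lead beyond \<open>d / 2\<close>, where the linear
    bound on \<open>v\<close> is known.\<close>
  moreover have "\<forall>\<^sub>F x in nhds 0. x \<in> ball 0 (d / 2 * exp (- (C * \<tau>)))"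
    using d(1) by (intro eventually_nhds_in_open) auto
  ultimately have "\<forall>\<^sub>F x in nhds 0. x \<in> U \<and> (\<forall>s\<in>{0..\<tau>}. norm (\<psi> s x) \<le> exp (C * \<tau>) * norm x)"
  proof eventually_elim
    case (elim x)
    then have x: "\<psi> 0 x = x" "\<And>s. s \<in> {0..\<tau>} \<Longrightarrow> ((\<lambda>s. \<psi> s x) has_vector_derivative v (\<psi> s x)) (at s within {0..\<tau>})"
      using fl by auto
    have "norm (\<psi> 0 x) * exp (C * \<tau>) < d / 2" using elim(2) by (simp add: x(1) exp_minus field_simps)
    then have "norm (\<psi> s x) \<le> norm (\<psi> 0 x) * exp (C * \<tau>)" if "s \<in> {0..\<tau>}" for s
      using that C(1) by (intro trajectory_bound[where \<psi> = "\<lambda>s. \<psi> s x" and v = v and \<rho> = "d / 2", OF x(2) v]) auto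
    then show ?case using elim(1) by (simp add: x(1) mult.commute)
  qed
  then show ?thesis by (intro exI[of _ "exp (C * \<tau>)"]) auto
qed

text \<open>The counterpart of \<open>families\<close> for functions instead of germs: estimates
  along a trajectory differentiate in time at a fixed starting point and need one neighbourhood for
  all times.\<close>

inductive_set fun_families :: "(real \<Rightarrow> complex) set \<Rightarrow> (real \<Rightarrow> real ^ 'n \<Rightarrow> complex) set" for A where
  fun_families_0: "(\<lambda>_ _. 0) \<in> fun_families A"
| fun_families_step: "\<phi> \<in> fun_families A \<Longrightarrow> u \<in> A \<Longrightarrow> smooth_near_0 p \<Longrightarrow>
    (\<lambda>t x. \<phi> t x + u t * p x) \<in> fun_families A"

lemma fun_families_smooth: "\<phi> \<in> fun_families A \<Longrightarrow> smooth_near_0 (\<phi> t)"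
proof (induction rule: fun_families.induct)
  case (fun_families_step \<phi> u p)
  then show ?case by (intro smooth_near_0_add smooth_near_0_mult smooth_near_0_const)
qed (rule smooth_near_0_const)

lemma fun_families_germ: "\<phi> \<in> fun_families A \<Longrightarrow> (\<lambda>t. germ_of (\<phi> t)) \<in> families A"
proof (induction rule: fun_families.induct)
  case fun_families_0
  then show ?case using families_0 by (simp add: germ_of_0)
next
  case (fun_families_step \<phi> u p)
  then have "(\<lambda>t. germ_of (\<phi> t) + const (u t) * germ_of p) \<in> families A"
    by (intro families_step) (simp_all add: germ_of_in_smooth_germs_iff)
  then show ?case by (simp add: const_def germ_of_mult germ_of_add)
qed

lemma flow_family_eventually:
  assumes "flow_family v \<tau> U \<psi>" "smooth_near_0 v" "v 0 = 0" "\<forall>\<^sub>F y in nhds 0. P y"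
  shows "\<forall>\<^sub>F x in nhds 0. \<forall>s\<in>{0..\<tau>}. P (\<psi> s x)"
proof -
  obtain K where K: "K > 0" "\<forall>\<^sub>F x in nhds 0. x \<in> U \<and> (\<forall>s\<in>{0..\<tau>}. norm (\<psi> s x) \<le> K * norm x)"
    using flow_family_bound[OF assms(1) _ assms(2,3)] by auto
  obtain d where d: "d > 0" "\<And>y. dist y 0 < d \<Longrightarrow> P y"
    using assms(4) unfolding eventually_nhds_metric by blast
  have "\<forall>\<^sub>F x in nhds (0::real ^ 'a). x \<in> ball 0 (d / K)"
    using d(1) K(1) by (intro eventually_nhds_in_open) auto
  with K(2) show ?thesis
  proof eventually_elim
    case (elim x)
    then have "K * norm x < d" using K(1) by (simp add: field_simps)
    then show ?case using elim(1) by (intro ballI d(2)) (auto intro: le_less_trans)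
  qed
qed

lemma norm_integral_bound:
  fixes g :: "real \<Rightarrow> 'b::real_normed_vector"
  assumes "\<And>s. s \<in> {0..\<tau>} \<Longrightarrow> (g has_vector_derivative g' s) (at s within {0..\<tau>})"
    and "\<And>s. s \<in> {0..\<tau>} \<Longrightarrow> norm (g' s) \<le> B" and "s \<in> {0..\<tau>}"
  shows "norm (g s - g 0) \<le> B * s"
proof -
  have "norm (g s - g 0) \<le> B * norm (s - 0)"
  proof (rule differentiable_bound[of "{0..\<tau>}" g "\<lambda>r h. h *\<^sub>R g' r"])
    fix r assume "r \<in> {0..\<tau>}"
    then show "(g has_derivative (\<lambda>h. h *\<^sub>R g' r)) (at r within {0..\<tau>})"
      using assms(1) by (simp add: has_vector_derivative_def)
    show "onorm (\<lambda>h. h *\<^sub>R g' r) \<le> B"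
      using assms(2)[OF \<open>r \<in> {0..\<tau>}\<close>] by (intro onorm_le) (simp add: mult.commute[of B] mult_left_mono)
  qed (use assms(3) in auto)
  then show ?thesis using assms(3) by simp
qed

text \<open>Variation of constants: \<open>f\<close> along a trajectory solves \<open>y' = \<alpha> y + f'\<close>, where \<open>f'\<close> is annihilated by
  the shorter list.\<close>

lemma flow_expansion:
  fixes v :: "real ^ 'n \<Rightarrow> real ^ 'n"
  assumes v: "smooth_near_0 v" "v 0 = 0"
    and "jordan_chains (\<lambda>U u. \<forall>t. (U has_vector_derivative u t) (at t)) b adm"
    and b0: "\<And>\<beta>. \<beta> \<in> adm \<Longrightarrow> b 0 \<beta> = (\<lambda>t. exp (\<beta> * of_real t))"
    and "smooth_near_0 f" "set \<alpha>s \<subseteq> adm" "annihilate (deriv_along v) \<alpha>s (germ_of f) \<in> vanishing k"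
  shows "\<exists>\<phi>\<in>fun_families (jordan_chains.chain_span b adm). \<forall>\<tau> U \<psi>. flow_family v \<tau> U \<psi> \<longrightarrow>
    (\<exists>C. \<forall>\<^sub>F x in nhds 0. \<forall>s\<in>{0..\<tau>}. norm (f (\<psi> s x) - \<phi> s x) \<le> C * norm x ^ k)"
proof -
  interpret filtered_operator "deriv_along v" by (rule deriv_along_filtered_operator[OF v])
  interpret jordan_chains "\<lambda>U u. \<forall>t. (U has_vector_derivative u t) (at t)" b adm by fact
  show ?thesis
    using assms(5-7)
  proof (induction \<alpha>s arbitrary: f)
    case Nil
    then obtain C where C: "\<forall>\<^sub>F x in nhds 0. norm (f x) \<le> C * norm x ^ k"
      using germ_of_vanishingD by auto
    show ?case
    proof (intro bexI[of _ "\<lambda>_ _. 0"] fun_families_0 allI impI)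
      fix \<tau> U \<psi> assume fl: "flow_family v \<tau> U \<psi>"
      obtain K where K: "K > 0" "\<forall>\<^sub>F x in nhds 0. x \<in> U \<and> (\<forall>s\<in>{0..\<tau>}. norm (\<psi> s x) \<le> K * norm x)"
        using flow_family_bound[OF fl _ v] by auto
      from K(2) flow_family_eventually[OF fl v C]
      have "\<forall>\<^sub>F x in nhds 0. \<forall>s\<in>{0..\<tau>}. norm (f (\<psi> s x) - 0) \<le> (\<bar>C\<bar> * K ^ k) * norm x ^ k"
      proof eventually_elim
        case (elim x)
        show ?case
        proof
          fix s assume s: "s \<in> {0..\<tau>}"
          have "C * norm (\<psi> s x) ^ k \<le> \<bar>C\<bar> * (K * norm x) ^ k"
            using elim(1) s by (intro mult_mono power_mono) auto
          then show "norm (f (\<psi> s x) - 0) \<le> (\<bar>C\<bar> * K ^ k) * norm x ^ k"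
            using elim(2) s by (force simp: power_mult_distrib mult.assoc)
        qed
      qed
      then show "\<exists>C. \<forall>\<^sub>F x in nhds 0. \<forall>s\<in>{0..\<tau>}. norm (f (\<psi> s x) - 0) \<le> C * norm x ^ k" by blast
    qed
  next
    case (Cons \<alpha> \<alpha>s)
    have \<alpha>: "\<alpha> \<in> adm" using Cons.prems by simp
    define f' where "f' x = frechet_derivative f (at x) (v x) - \<alpha> * f x" for x
    have germ_f': "germ_of f' = deriv_along v (germ_of f) - const \<alpha> * germ_of f"
      by (simp add: f'_def[abs_def] deriv_along_germ_of const_def germ_of_mult germ_of_minus)
    have "germ_of f' \<in> smooth_germs"
      unfolding germ_f' using Cons.prems(1)
      by (intro smooth_germs_diff smooth_germs_mult smooth_germs_const T_smooth)
        (simp_all add: germ_of_in_smooth_germs_iff)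
    then have "smooth_near_0 f'" by (simp add: germ_of_in_smooth_germs_iff)
    moreover have "annihilate (deriv_along v) \<alpha>s (germ_of f') \<in> vanishing k"
      using Cons.prems(3) by (simp add: germ_f')
    moreover have "set \<alpha>s \<subseteq> adm" using Cons.prems(2) by simp
    ultimately obtain \<phi> where \<phi>: "\<phi> \<in> fun_families chain_span"
      "\<And>\<tau> U \<psi>. flow_family v \<tau> U \<psi> \<Longrightarrow>
        \<exists>C. \<forall>\<^sub>F x in nhds 0. \<forall>s\<in>{0..\<tau>}. norm (f' (\<psi> s x) - \<phi> s x) \<le> C * norm x ^ k"
      using Cons.IH[of f'] by blast
    have "\<exists>\<Phi>\<in>fun_families chain_span. \<forall>x t. ((\<lambda>t. \<Phi> t x) has_vector_derivative \<alpha> * \<Phi> t x + \<phi> t x) (at t)"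
      using \<phi>(1)
    proof (induction rule: fun_families.induct)
      case fun_families_0
      show ?case by (intro bexI[of _ "\<lambda>_ _. 0"] fun_families.fun_families_0) simp
    next
      case (fun_families_step \<phi> u p)
      then obtain \<Phi> where \<Phi>: "\<Phi> \<in> fun_families chain_span"
        "\<And>x t. ((\<lambda>t. \<Phi> t x) has_vector_derivative \<alpha> * \<Phi> t x + \<phi> t x) (at t)" by blast
      obtain U where U: "U \<in> chain_span" "\<And>t. (U has_vector_derivative \<alpha> * U t + u t) (at t)"
        using chain_span_solution[OF fun_families_step(2) \<alpha>] by auto
      have "((\<lambda>t. \<Phi> t x + U t * p x) has_vector_derivative
          \<alpha> * (\<Phi> t x + U t * p x) + (\<phi> t x + u t * p x)) (at t)" for x t
        using has_vector_derivative_add[OF \<Phi>(2)[where x = x] bounded_linear.has_vector_derivative[OF bounded_linear_mult_left U(2), of "p x"], of t]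
        by (simp add: algebra_simps)
      then show ?case
        by (intro bexI[of _ "\<lambda>t x. \<Phi> t x + U t * p x"] fun_families.fun_families_step \<Phi>(1) U(1)
            fun_families_step(3)) blast
    qed
    then obtain \<Phi> where \<Phi>: "\<Phi> \<in> fun_families chain_span"
      "\<And>x t. ((\<lambda>t. \<Phi> t x) has_vector_derivative \<alpha> * \<Phi> t x + \<phi> t x) (at t)" by blast
    \<comment> \<open>The discrepancy at time \<open>0\<close>. Multiplied by the homogeneous
      solution \<open>b 0 \<alpha>\<close>, it adjusts the particular solution \<open>\<Phi>\<close>
      to the initial value \<open>f x\<close>.\<close>
    define d where "d x = f x - \<Phi> 0 x" for x
    have "germ_of d = germ_of f - germ_of (\<Phi> 0)" by (simp add: d_def[abs_def] germ_of_minus)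
    moreover have "germ_of f - germ_of (\<Phi> 0) \<in> smooth_germs"
      using Cons.prems(1) fun_families_smooth[OF \<Phi>(1)]
      by (intro smooth_germs_diff) (simp_all add: germ_of_in_smooth_germs_iff)
    ultimately have d: "smooth_near_0 d" by (metis germ_of_in_smooth_germs_iff)
    show ?case
    proof (intro bexI[of _ "\<lambda>t x. \<Phi> t x + b 0 \<alpha> t * d x"] allI impI)
      show "(\<lambda>t x. \<Phi> t x + b 0 \<alpha> t * d x) \<in> fun_families chain_span"
        by (intro fun_families.fun_families_step \<Phi>(1) chain_span_b \<alpha> d)
      fix \<tau> U \<psi> assume fl: "flow_family v \<tau> U \<psi>"
      note fl' = fl[unfolded flow_family_def]
      obtain C where C: "\<forall>\<^sub>F x in nhds 0. \<forall>s\<in>{0..\<tau>}. norm (f' (\<psi> s x) - \<phi> s x) \<le> C * norm x ^ k"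
        using \<phi>(2)[OF fl] by blast
      have U: "\<forall>\<^sub>F x in nhds 0. x \<in> U" using fl' by (intro eventually_nhds_in_open) auto
      let ?M = "exp (norm \<alpha> * \<tau>)"
      have exp_bound: "norm (exp (\<beta> * of_real s)) \<le> ?M" if "s \<in> {0..\<tau>}" "norm \<beta> = norm \<alpha>" for s and \<beta> :: complex
      proof -
        have "norm (exp (\<beta> * of_real s)) \<le> exp (norm (\<beta> * of_real s))" by (rule norm_exp)
        also have "\<dots> \<le> ?M" using that by (auto simp: norm_mult intro!: mult_left_mono)
        finally show ?thesis .
      qed
      have "\<forall>\<^sub>F x in nhds 0. \<forall>s\<in>{0..\<tau>}.
          norm (f (\<psi> s x) - (\<Phi> s x + b 0 \<alpha> s * d x)) \<le> (?M * (?M * C) * \<tau>) * norm x ^ k"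
        using C U flow_family_eventually[OF fl v smooth_near_0_has_derivative[OF Cons.prems(1)]]
      proof eventually_elim
        case (elim x)
        \<comment> \<open>With the integrating factor, the terms containing \<open>\<alpha>\<close>
          cancel in the derivative of \<open>g\<close>, and what remains is the error bounded by the
          induction hypothesis.\<close>
        define g where "g s = exp (- \<alpha> * of_real s) * (f (\<psi> s x) - \<Phi> s x)" for s
        have \<psi>0: "\<psi> 0 x = x" using fl' elim(2) by blast
        have g': "(g has_vector_derivative exp (- \<alpha> * of_real s) * (f' (\<psi> s x) - \<phi> s x)) (at s within {0..\<tau>})"
          if s: "s \<in> {0..\<tau>}" for s
        proof -
          let ?D = "frechet_derivative f (at (\<psi> s x))"
          have D: "(f has_derivative ?D) (at (\<psi> s x))" using elim(3) s by blast
          have "((\<lambda>s. \<psi> s x) has_derivative (\<lambda>h. h *\<^sub>R v (\<psi> s x))) (at s within {0..\<tau>})"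
            using fl' elim(2) s by (simp add: has_vector_derivative_def)
          from has_derivative_compose[of "\<lambda>s. \<psi> s x", OF this D]
          have "((\<lambda>s. f (\<psi> s x)) has_vector_derivative ?D (v (\<psi> s x))) (at s within {0..\<tau>})"
            by (simp add: has_vector_derivative_def linear_scale[OF has_derivative_linear[OF D]])
          from has_vector_derivative_diff[OF this has_vector_derivative_at_within[OF \<Phi>(2)]]
          have d1: "((\<lambda>s. f (\<psi> s x) - \<Phi> s x) has_vector_derivative ?D (v (\<psi> s x)) - (\<alpha> * \<Phi> s x + \<phi> s x)) (at s within {0..\<tau>})" .
          have d2: "((\<lambda>s. exp (- \<alpha> * of_real s)) has_vector_derivative - \<alpha> * exp (- \<alpha> * of_real s)) (at s within {0..\<tau>})"
            by (rule has_vector_derivative_at_within, rule has_vector_derivative_real_field)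
              (auto intro!: derivative_eq_intros)
          from has_vector_derivative_mult[OF d2 d1] show ?thesis
            unfolding g_def[abs_def] by (rule has_vector_derivative_eq_rhs) (simp add: f'_def algebra_simps)
        qed
        show ?case
        proof
          fix s assume s: "s \<in> {0..\<tau>}"
          have nonneg: "0 \<le> C * norm x ^ k" using elim(1) s norm_ge_zero order_trans by blast
          have "norm (g s - g 0) \<le> (?M * (C * norm x ^ k)) * s"
          proof (rule norm_integral_bound[OF g' _ s])
            fix r assume r: "r \<in> {0..\<tau>}"
            then show "norm (exp (- \<alpha> * of_real r) * (f' (\<psi> r x) - \<phi> r x)) \<le> ?M * (C * norm x ^ k)"
              unfolding norm_mult using elim(1) nonneg by (intro mult_mono exp_bound) auto
          qed
          also have "\<dots> \<le> (?M * (C * norm x ^ k)) * \<tau>"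
            using s nonneg by (intro mult_left_mono) auto
          finally have gs: "norm (g s - g 0) \<le> (?M * (C * norm x ^ k)) * \<tau>" .
          have "f (\<psi> s x) - (\<Phi> s x + b 0 \<alpha> s * d x) = exp (\<alpha> * of_real s) * (g s - g 0)"
            by (simp add: g_def d_def \<psi>0 b0[OF \<alpha>] exp_minus field_simps)
          then have "norm (f (\<psi> s x) - (\<Phi> s x + b 0 \<alpha> s * d x)) = norm (exp (\<alpha> * of_real s)) * norm (g s - g 0)"
            by (simp add: norm_mult)
          also have "\<dots> \<le> ?M * ((?M * (C * norm x ^ k)) * \<tau>)"
            using s by (intro mult_mono exp_bound gs) auto
          finally show "norm (f (\<psi> s x) - (\<Phi> s x + b 0 \<alpha> s * d x)) \<le> (?M * (?M * C) * \<tau>) * norm x ^ k"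
            by (simp add: mult_ac)
        qed
      qed
      then show "\<exists>C. \<forall>\<^sub>F x in nhds 0. \<forall>s\<in>{0..\<tau>}. norm (f (\<psi> s x) - (\<Phi> s x + b 0 \<alpha> s * d x)) \<le> C * norm x ^ k" by blast
    qed
  qed
qed

definition flow_germs :: "(real ^ 'n \<Rightarrow> real ^ 'n) \<Rightarrow> (real ^ 'n, real ^ 'n) germ set" where
  "flow_germs v = {germ_of (\<psi> \<tau>) | \<tau> U \<psi>. flow_family v \<tau> U \<psi>}"

text \<open>The intersection with \<open>smooth_germs_fix_0\<close> supplies smoothness of the flow
  map in the starting point. For the intended germs it comes from their membership in
  \<open>G\<close>, so it is not derived from the differential equation.\<close>

lemma finitely_parametrized_flow_germs:
  fixes v :: "real ^ 'n \<Rightarrow> real ^ 'n"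
  assumes v: "smooth_near_0 v" "v 0 = 0"
  shows "finitely_parametrized (flow_germs v \<inter> smooth_germs_fix_0)"
proof -
  define T where "T = (deriv_along v :: (real ^ 'n, complex) germ \<Rightarrow> _)"
  interpret filtered_operator T unfolding T_def by (rule deriv_along_filtered_operator[OF v])
  have "\<forall>i. \<exists>\<alpha>s. annihilate T \<alpha>s (coord i) \<in> vanishing 2"
    using annihilate_linear_part[OF coord_vanishing] by blast
  from choice[OF this] obtain \<alpha>s where \<alpha>s: "\<And>i. annihilate T (\<alpha>s i) (coord i) \<in> vanishing 2" by blast
  define \<Lambda> where "\<Lambda> = (\<Union>i. set (\<alpha>s i))"
  define \<Gamma> :: "(real \<Rightarrow> complex) set" where "\<Gamma> = insert of_real ((\<lambda>\<beta> t. exp (\<beta> * of_real t)) ` \<Lambda>)"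
  define adm where "adm = {\<beta>. (\<lambda>t. exp (\<beta> * of_real t)) \<in> fun_alg \<Gamma>}"
  define b :: "nat \<Rightarrow> complex \<Rightarrow> real \<Rightarrow> complex"
    where "b i \<beta> t = of_real t ^ i / fact i * exp (\<beta> * of_real t)" for i \<beta> t
  have \<Lambda>: "\<Lambda> \<subseteq> adm"
    by (auto simp: adm_def \<Gamma>_def intro: fun_alg_gen)
  interpret multiplicative_operator T "\<lambda>F. F" "(+)" "\<lambda>_. 1" adm 0
  proof unfold_locales
    show "\<alpha> + \<beta> \<in> adm" if "\<alpha> \<in> adm" "\<beta> \<in> adm" for \<alpha> \<beta>
      using that fun_alg_mult[of "\<lambda>t. exp (\<alpha> * of_real t)" \<Gamma> "\<lambda>t. exp (\<beta> * of_real t)"]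
      by (simp add: adm_def distrib_right exp_add)
    show "0 \<in> adm" by (simp add: adm_def fun_alg_const)
    show "T 1 = const 0" unfolding T_def const_1[symmetric] by (simp add: deriv_along_const[OF v] const_0)
    fix F G :: "(real ^ 'n, complex) germ" and \<alpha> \<beta> assume "F \<in> smooth_germs" "G \<in> smooth_germs"
    then show "T (F * G) - const (\<alpha> + \<beta>) * (F * G) =
        (T F - const \<alpha> * F) * G + const 1 * (F * (T G - const \<beta> * G))"
      unfolding T_def by (simp add: deriv_along_mult[OF v] const_add const_1 algebra_simps)
  qed auto
  interpret chains: jordan_chains "\<lambda>U u. \<forall>t. (U has_vector_derivative u t) (at t)" b adm
  proof unfold_locales
    have deriv: "((\<lambda>t. of_real t ^ i / fact i * exp (\<beta> * of_real t)) has_vector_derivative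
        \<beta> * b i \<beta> t + of_nat i * of_real t ^ (i - 1) / fact i * exp (\<beta> * of_real t)) (at t)" for i \<beta> t
      by (rule has_vector_derivative_real_field)
        (auto intro!: derivative_eq_intros simp: b_def field_simps)
    show "\<forall>t. (b 0 \<beta> has_vector_derivative \<beta> * b 0 \<beta> t) (at t)" for \<beta>
      using deriv[of 0 \<beta>] by (simp add: b_def[abs_def])
    show "\<forall>t. (b (Suc i) \<beta> has_vector_derivative \<beta> * b (Suc i) \<beta> t + b i \<beta> t) (at t)" for i \<beta>
    proof
      fix t
      have "of_nat (Suc i) * of_real t ^ (Suc i - 1) / fact (Suc i) * exp (\<beta> * of_real t) = b i \<beta> t"
        by (simp add: b_def del: of_nat_Suc)
      then show "(b (Suc i) \<beta> has_vector_derivative \<beta> * b (Suc i) \<beta> t + b i \<beta> t) (at t)"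
        using deriv[of "Suc i" \<beta> t] unfolding b_def[of "Suc i" \<beta>, abs_def] by (simp only:)
    qed
  qed (auto intro: has_vector_derivative_add bounded_linear.has_vector_derivative[OF bounded_linear_mult_right])
  have power_alg: "(\<lambda>t. of_real t ^ i) \<in> fun_alg \<Gamma>" for i
  proof (induction i)
    case (Suc i)
    have "of_real \<in> fun_alg \<Gamma>" by (simp add: \<Gamma>_def fun_alg_gen)
    from fun_alg_mult[OF this Suc] show ?case by simp
  qed (simp add: fun_alg_const)
  have span: "chains.chain_span \<subseteq> fun_alg \<Gamma>"
  proof
    fix u assume "u \<in> chains.chain_span"
    then show "u \<in> fun_alg \<Gamma>"
    proof (induction rule: chains.chain_span.induct)
      case (chain_span_step u \<beta> c i)
      have "(\<lambda>t. u t + (c * inverse (fact i)) * (of_real t ^ i * exp (\<beta> * of_real t))) \<in> fun_alg \<Gamma>"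
        using chain_span_step power_alg[of i] unfolding adm_def
        by (intro fun_alg_add fun_alg_mult fun_alg_const) auto
      then show ?case by (simp add: b_def divide_inverse mult_ac)
    qed (rule fun_alg_const)
  qed
  define s where "s h = (SOME \<tau>. \<exists>U \<psi>. flow_family v \<tau> U \<psi> \<and> h = germ_of (\<psi> \<tau>))" for h
  have s: "\<exists>U \<psi>. flow_family v (s h) U \<psi> \<and> h = germ_of (\<psi> (s h))" if "h \<in> flow_germs v" for h
    unfolding s_def by (rule someI_ex) (use that in \<open>auto simp: flow_germs_def\<close>)
  show ?thesis
  proof (rule finitely_parametrizedI[of \<Gamma> _ s])
    show "finite \<Gamma>" by (simp add: \<Gamma>_def \<Lambda>_def)
    fix F :: "(real ^ 'n, complex) germ" and k assume F: "F \<in> smooth_germs"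
    obtain f where f: "F = germ_of f" "smooth_near_0 f" using F by (rule smooth_germsE)
    have "coord i \<in> nilpotent_mod adm 2" for i
      using \<alpha>s[of i] \<Lambda> unfolding nilpotent_mod_def \<Lambda>_def by (auto simp: smooth_germs_coord)
    then have "F \<in> nilpotent_mod adm k" using F by (rule nilpotent_mod_all)
    then obtain \<beta>s where \<beta>s: "set \<beta>s \<subseteq> adm" "annihilate T \<beta>s (germ_of f) \<in> vanishing k"
      unfolding nilpotent_mod_def f(1) by blast
    have "b 0 \<beta> = (\<lambda>t. exp (\<beta> * of_real t))" for \<beta> by (simp add: b_def fun_eq_iff)
    from flow_expansion[OF v chains.jordan_chains_axioms this f(2) \<beta>s(1) \<beta>s(2)[unfolded T_def]]
    obtain \<phi> where \<phi>: "\<phi> \<in> fun_families chains.chain_span"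
      "\<And>\<tau> U \<psi>. flow_family v \<tau> U \<psi> \<Longrightarrow>
        \<exists>C. \<forall>\<^sub>F x in nhds 0. \<forall>s\<in>{0..\<tau>}. norm (f (\<psi> s x) - \<phi> s x) \<le> C * norm x ^ k" by blast
    have "germ_comp F h - germ_of (\<phi> (s h)) \<in> vanishing k" if h: "h \<in> flow_germs v \<inter> smooth_germs_fix_0" for h
    proof -
      obtain U \<psi> where fl: "flow_family v (s h) U \<psi>" "h = germ_of (\<psi> (s h))" using s h by blast
      have nonneg: "0 \<le> s h" using fl(1) by (simp add: flow_family_def)
      have lim: "filterlim (\<psi> (s h)) (nhds 0) (nhds 0)"
        unfolding filterlim_iff
      proof (intro allI impI)
        fix P :: "real ^ 'n \<Rightarrow> bool" assume "eventually P (nhds 0)"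
        from flow_family_eventually[OF fl(1) v this]
        show "\<forall>\<^sub>F x in nhds 0. P (\<psi> (s h) x)" by eventually_elim (use nonneg in auto)
      qed
      have eq: "germ_comp F h - germ_of (\<phi> (s h)) = germ_of (\<lambda>x. f (\<psi> (s h) x) - \<phi> (s h) x)"
        unfolding f(1) by (subst fl(2)) (simp add: germ_comp_germ_of lim germ_of_minus)
      have "germ_comp F h - germ_of (\<phi> (s h)) \<in> smooth_germs"
        using h F fun_families_smooth[OF \<phi>(1)]
        by (intro smooth_germs_diff germ_comp_smooth) (auto simp: germ_of_in_smooth_germs_iff)
      then have "smooth_near_0 (\<lambda>x. f (\<psi> (s h) x) - \<phi> (s h) x)"
        unfolding eq germ_of_in_smooth_germs_iff .
      moreover obtain C where "\<forall>\<^sub>F x in nhds 0. \<forall>r\<in>{0..s h}. norm (f (\<psi> r x) - \<phi> r x) \<le> C * norm x ^ k"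
        using \<phi>(2)[OF fl(1)] by blast
      then have "\<forall>\<^sub>F x in nhds 0. norm (f (\<psi> (s h) x) - \<phi> (s h) x) \<le> C * norm x ^ k"
        by eventually_elim (use nonneg in auto)
      ultimately show ?thesis unfolding eq by (rule vanishingI)
    qed
    then show "\<exists>\<phi>\<in>families (fun_alg \<Gamma>). \<forall>h\<in>flow_germs v \<inter> smooth_germs_fix_0. germ_comp F h - \<phi> (s h) \<in> vanishing k"
      using families_mono[OF fun_families_germ[OF \<phi>(1)] span] by (intro bexI[of _ "\<lambda>t. germ_of (\<phi> t)"]) auto
  qed
qed

text \<open>A flow germ may be given by any representative of its vector field. Trajectories
  starting close enough to the origin stay, up to time \<open>\<tau>\<close>, where the
  representatives agree, so that one representative can be fixed.\<close>

lemma flow_germs_transfer: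
  assumes "flow_family w \<tau> U \<psi>" "\<forall>\<^sub>F x in nhds 0. w x = v x" "smooth_near_0 v" "v 0 = 0"
  shows "germ_of (\<psi> \<tau>) \<in> flow_germs v"
proof -
  have "eq_near_0 v w" unfolding eq_near_0_def using assms(2) by eventually_elim simp
  with assms(3) have w: "smooth_near_0 w" by (rule smooth_near_0_cong)
  have w0: "w 0 = 0" using eventually_nhds_x_imp_x[OF assms(2)] assms(4) by simp
  note fl = assms(1)[unfolded flow_family_def]
  have "\<forall>\<^sub>F x in nhds 0. x \<in> U" using fl by (intro eventually_nhds_in_open) auto
  with flow_family_eventually[OF assms(1) w w0 assms(2)]
  have "\<forall>\<^sub>F x in nhds 0. x \<in> U \<and> (\<forall>s\<in>{0..\<tau>}. w (\<psi> s x) = v (\<psi> s x))" by eventually_elim auto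
  then obtain S where S: "open S" "0 \<in> S" "\<And>x. x \<in> S \<Longrightarrow> x \<in> U \<and> (\<forall>s\<in>{0..\<tau>}. w (\<psi> s x) = v (\<psi> s x))"
    unfolding eventually_nhds by blast
  have "flow_family v \<tau> S \<psi>"
    unfolding flow_family_def
  proof (intro conjI ballI)
    fix x s assume x: "x \<in> S" and s: "s \<in> {0..\<tau>}"
    have "((\<lambda>s. \<psi> s x) has_vector_derivative w (\<psi> s x)) (at s within {0..\<tau>})" using fl S(3)[OF x] s by blast
    then show "((\<lambda>s. \<psi> s x) has_vector_derivative v (\<psi> s x)) (at s within {0..\<tau>})" using S(3)[OF x] s by simp
  qed (use fl S in auto)
  then show ?thesis by (auto simp: flow_germs_def)
qed

lemma flow_germs_comp:
  fixes v :: "real ^ 'n \<Rightarrow> real ^ 'n"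
  assumes v: "smooth_near_0 v" "v 0 = 0" and "F \<in> flow_germs v" "H \<in> flow_germs v"
  shows "germ_comp F H \<in> flow_germs v"
proof -
  obtain \<tau> U \<psi> where F: "flow_family v \<tau> U \<psi>" "F = germ_of (\<psi> \<tau>)" using assms(3) by (auto simp: flow_germs_def)
  obtain \<sigma> V \<theta> where H: "flow_family v \<sigma> V \<theta>" "H = germ_of (\<theta> \<sigma>)" using assms(4) by (auto simp: flow_germs_def)
  note Ff = F(1)[unfolded flow_family_def] and Hf = H(1)[unfolded flow_family_def]
  have \<tau>: "0 \<le> \<tau>" and \<sigma>: "0 \<le> \<sigma>" using Ff Hf by auto
  have "\<forall>\<^sub>F x in nhds 0. x \<in> U" using Ff by (intro eventually_nhds_in_open) auto
  from flow_family_eventually[OF H(1) v this] have "\<forall>\<^sub>F x in nhds 0. \<theta> \<sigma> x \<in> U"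
    by eventually_elim (use \<sigma> in auto)
  moreover have "\<forall>\<^sub>F x in nhds 0. x \<in> V" using Hf by (intro eventually_nhds_in_open) auto
  ultimately have "\<forall>\<^sub>F x in nhds 0. x \<in> V \<and> \<theta> \<sigma> x \<in> U" by eventually_elim auto
  then obtain S where S: "open S" "0 \<in> S" "\<And>x. x \<in> S \<Longrightarrow> x \<in> V \<and> \<theta> \<sigma> x \<in> U"
    unfolding eventually_nhds by blast
  \<comment> \<open>The trajectory follows \<open>\<theta>\<close> up to time
    \<open>\<sigma>\<close> and continues with \<open>\<psi>\<close> from the point reached.\<close>
  define \<eta> where "\<eta> s x = (if s \<in> {0..\<sigma>} then \<theta> s x else \<psi> (s - \<sigma>) (\<theta> \<sigma> x))" for s x
  have "flow_family v (\<tau> + \<sigma>) S \<eta>"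
    unfolding flow_family_def
  proof (intro conjI ballI)
    fix x assume x: "x \<in> S"
    have x': "x \<in> V" "\<theta> \<sigma> x \<in> U" using S(3)[OF x] by auto
    show "\<eta> 0 x = x" using \<sigma> Hf x' by (simp add: \<eta>_def)
    fix s assume s: "s \<in> {0..\<tau> + \<sigma>}"
    have glue: "\<theta> \<sigma> x = \<psi> (\<sigma> - \<sigma>) (\<theta> \<sigma> x)" using Ff x' by simp
    have eq: "{0..\<tau> + \<sigma>} = {0..\<sigma>} \<union> {\<sigma>..\<tau> + \<sigma>}" using \<tau> \<sigma> by auto
    have cl: "{0..\<sigma>} \<union> (closure {0..\<sigma>} \<inter> closure {\<sigma>..\<tau> + \<sigma>}) = {0..\<sigma>}"
      "{\<sigma>..\<tau> + \<sigma>} \<union> (closure {0..\<sigma>} \<inter> closure {\<sigma>..\<tau> + \<sigma>}) = {\<sigma>..\<tau> + \<sigma>}" using \<tau> \<sigma> by auto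
    have "((\<lambda>s. if s \<in> {0..\<sigma>} then \<theta> s x else \<psi> (s - \<sigma>) (\<theta> \<sigma> x)) has_vector_derivative
        (if s \<in> {0..\<sigma>} then v (\<theta> s x) else v (\<psi> (s - \<sigma>) (\<theta> \<sigma> x)))) (at s within {0..\<tau> + \<sigma>})"
    \<comment> \<open>At the junction \<open>s = \<sigma>\<close> the two one-sided derivatives
      agree, since both are the value of \<open>v\<close> at the common point.\<close>
    proof (rule has_vector_derivative_If_within_closures[OF _ eq, unfolded cl])
      show "s \<in> {0..\<sigma>} \<union> {\<sigma>..\<tau> + \<sigma>}" using s unfolding eq .
      show "((\<lambda>s. \<theta> s x) has_vector_derivative v (\<theta> s x)) (at s within {0..\<sigma>})" if "s \<in> {0..\<sigma>}"
        using Hf x' that by blast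
      show "((\<lambda>s. \<psi> (s - \<sigma>) (\<theta> \<sigma> x)) has_vector_derivative v (\<psi> (s - \<sigma>) (\<theta> \<sigma> x))) (at s within {\<sigma>..\<tau> + \<sigma>})"
        if s: "s \<in> {\<sigma>..\<tau> + \<sigma>}"
      proof -
        have im: "(\<lambda>s. s - \<sigma>) ` {\<sigma>..\<tau> + \<sigma>} = {0..\<tau>}"
          by (auto simp: image_iff intro!: bexI[of _ "_ + \<sigma>"])
        have "s - \<sigma> \<in> {0..\<tau>}" using s by auto
        then have "((\<lambda>s. \<psi> s (\<theta> \<sigma> x)) has_vector_derivative v (\<psi> (s - \<sigma>) (\<theta> \<sigma> x))) (at (s - \<sigma>) within (\<lambda>s. s - \<sigma>) ` {\<sigma>..\<tau> + \<sigma>})"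
          unfolding im using Ff x' by blast
        moreover have "((\<lambda>s. s - \<sigma>) has_vector_derivative 1) (at s within {\<sigma>..\<tau> + \<sigma>})"
          by (auto intro!: derivative_eq_intros)
        ultimately show ?thesis
          using vector_diff_chain_within[of "\<lambda>s. s - \<sigma>" 1 s "{\<sigma>..\<tau> + \<sigma>}" "\<lambda>s. \<psi> s (\<theta> \<sigma> x)"] by (simp add: o_def)
      qed
      have agree: "\<theta> s x = \<psi> (s - \<sigma>) (\<theta> \<sigma> x)" if "s \<in> closure {0..\<sigma>}" "s \<in> closure {\<sigma>..\<tau> + \<sigma>}"
      proof -
        have "s = \<sigma>" using that by auto
        then show ?thesis using glue by simp
      qed
      then show "\<theta> s x = \<psi> (s - \<sigma>) (\<theta> \<sigma> x)" if "s \<in> closure {0..\<sigma>}" "s \<in> closure {\<sigma>..\<tau> + \<sigma>}"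
        using that by blast
      show "v (\<theta> s x) = v (\<psi> (s - \<sigma>) (\<theta> \<sigma> x))" if "s \<in> closure {0..\<sigma>}" "s \<in> closure {\<sigma>..\<tau> + \<sigma>}"
        using agree[OF that] by (rule arg_cong)
    qed
    then show "((\<lambda>s. \<eta> s x) has_vector_derivative v (\<eta> s x)) (at s within {0..\<tau> + \<sigma>})"
      unfolding \<eta>_def by (simp add: if_distrib)
  qed (use \<tau> \<sigma> S in auto)
  moreover have "germ_comp F H = germ_of (\<eta> (\<tau> + \<sigma>))"
  proof -
    have lim: "filterlim (\<theta> \<sigma>) (nhds 0) (nhds 0)"
      unfolding filterlim_iff
    proof (intro allI impI)
      fix P :: "real ^ 'n \<Rightarrow> bool" assume "eventually P (nhds 0)"
      from flow_family_eventually[OF H(1) v this]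
      show "\<forall>\<^sub>F x in nhds 0. P (\<theta> \<sigma> x)" by eventually_elim (use \<sigma> in auto)
    qed
    have "\<forall>\<^sub>F x in nhds 0. x \<in> S" using S by (intro eventually_nhds_in_open) auto
    then have "\<forall>\<^sub>F x in nhds 0. \<psi> \<tau> (\<theta> \<sigma> x) = \<eta> (\<tau> + \<sigma>) x"
    proof eventually_elim
      case (elim x)
      then have "\<psi> 0 (\<theta> \<sigma> x) = \<theta> \<sigma> x" using S(3) Ff by blast
      then show ?case using \<tau> \<sigma> by (auto simp: \<eta>_def)
    qed
    then show ?thesis by (simp add: F(2) H(2) germ_comp_germ_of[OF lim] germ_of_eq_iff)
  qed
  ultimately show ?thesis by (auto simp: flow_germs_def)
qed

section \<open>Commutative finitely generated groups\<close>

definition germ_monoid :: "(real ^ 'n, real ^ 'n) germ monoid" where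
  "germ_monoid = \<lparr>carrier = smooth_germs_fix_0, monoid.mult = germ_comp, one = id_germ\<rparr>"

lemma monoid_germ_monoid: "Group.monoid germ_monoid"
  by (rule monoidI)
    (simp_all add: germ_monoid_def germ_comp_fix_0 id_germ_fix_0 germ_comp_assoc germ_comp_id germ_id_comp)

lemma Diff_0_eq: "Diff_0 = units_of germ_monoid"
  by (simp add: Diff_0_def germ_monoid_def)

lemma group_Diff_0: "Group.group Diff_0"
  unfolding Diff_0_eq by (rule monoid.units_group[OF monoid_germ_monoid])

lemma mult_Diff_0: "x \<otimes>\<^bsub>Diff_0\<^esub> y = germ_comp x y" and one_Diff_0: "\<one>\<^bsub>Diff_0\<^esub> = id_germ"
  by (simp_all add: Diff_0_eq units_of_def germ_monoid_def)

lemma carrier_Diff_0: "carrier Diff_0 \<subseteq> smooth_germs_fix_0"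
  unfolding Diff_0_eq units_of_def by (auto simp: Units_def germ_monoid_def)

lemma Diff_0_inv:
  assumes "a \<in> carrier Diff_0"
  shows "inv\<^bsub>Diff_0\<^esub> a \<in> carrier Diff_0" "germ_comp a (inv\<^bsub>Diff_0\<^esub> a) = id_germ"
    "germ_comp (inv\<^bsub>Diff_0\<^esub> a) a = id_germ"
  using group.inv_closed[OF group_Diff_0 assms] group.r_inv[OF group_Diff_0 assms]
    group.l_inv[OF group_Diff_0 assms] by (simp_all add: mult_Diff_0 one_Diff_0)

lemma germ_power_add:
  assumes "a \<in> smooth_germs_fix_0"
  shows "germ_comp (germ_power a m) (germ_power a n) = germ_power a (m + n)"
proof (induction n)
  case (Suc n)
  have "germ_comp (germ_power a m) (germ_power a (Suc n)) = germ_comp (germ_power a m) (germ_comp (germ_power a n) a)"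
    by (simp add: germ_power_def)
  also have "\<dots> = germ_comp (germ_comp (germ_power a m) (germ_power a n)) a"
    by (rule germ_comp_assoc[symmetric]) (rule germ_power_fix_0[OF assms], rule assms)
  also have "\<dots> = germ_power a (m + Suc n)" unfolding Suc by (simp add: germ_power_def)
  finally show ?case .
qed (simp add: germ_power_def germ_comp_id)

lemma finitely_parametrized_subset: "finitely_parametrized H \<Longrightarrow> K \<subseteq> H \<Longrightarrow> finitely_parametrized K"
  unfolding finitely_parametrized_def by (meson subsetD)

lemma finitely_parametrized_id: "finitely_parametrized {id_germ :: (real ^ 'n, real ^ 'n) germ}"
proof (rule finitely_parametrizedI[of "{}" _ "\<lambda>_. ()"])
  fix F :: "(real ^ 'n, complex) germ" and k assume "F \<in> smooth_germs"
  then have "(\<lambda>_. 0 + const 1 * F) \<in> families (fun_alg ({} :: (unit \<Rightarrow> complex) set))"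
    by (intro families_step families_0 fun_alg_const)
  then show "\<exists>\<phi>\<in>families (fun_alg {}). \<forall>h\<in>{id_germ}. germ_comp F h - \<phi> () \<in> vanishing k"
    by (intro bexI) (auto simp: germ_comp_id const_1 vanishing_0)
qed simp

lemma flow_germsI: "flow_family v \<tau> U \<psi> \<Longrightarrow> germ_of (\<psi> \<tau>) \<in> flow_germs v"
  unfolding flow_germs_def by (intro CollectI exI conjI) (rule refl)

lemma flow_germs_id: "id_germ \<in> flow_germs v"
proof -
  have "flow_family v 0 UNIV (\<lambda>_ x. x)"
    by (auto simp: flow_family_def has_vector_derivative_def has_derivative_within_singleton_iff
        intro: bounded_linear_scaleR_left)
  from flow_germsI[OF this] show ?thesis .
qed

text \<open>The trajectory issuing from \<open>f x\<close> ends at \<open>x\<close>; run backwards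
  it leads from \<open>x\<close> to \<open>f x\<close> along \<open>- v\<close>. The inverse germ
  thus supplies the starting points, and no existence theorem for differential equations is
  invoked.\<close>

lemma flow_germs_inverse:
  assumes "F \<in> flow_germs v" "F' \<in> smooth_germs_fix_0" "germ_comp F F' = id_germ"
  shows "F' \<in> flow_germs (\<lambda>x. - v x)"
proof -
  obtain \<tau> U \<psi> where F: "flow_family v \<tau> U \<psi>" "F = germ_of (\<psi> \<tau>)" using assms(1) by (auto simp: flow_germs_def)
  note Ff = F(1)[unfolded flow_family_def]
  obtain f where f: "F' = germ_of f" "smooth_near_0 f" "f 0 = 0" "filterlim f (nhds 0) (nhds 0)"
    using assms(2) by (rule smooth_germs_fix_0E)
  have "\<forall>\<^sub>F x in nhds 0. \<psi> \<tau> (f x) = x"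
    using assms(3) by (simp add: F(2) f(1) germ_comp_germ_of f(4) germ_of_eq_iff)
  moreover have "\<forall>\<^sub>F x in nhds 0. x \<in> U" using Ff by (intro eventually_nhds_in_open) auto
  then have "\<forall>\<^sub>F x in nhds 0. f x \<in> U" using f(4) unfolding filterlim_iff by blast
  ultimately have "\<forall>\<^sub>F x in nhds 0. \<psi> \<tau> (f x) = x \<and> f x \<in> U" by eventually_elim auto
  then obtain S where S: "open S" "0 \<in> S" "\<And>x. x \<in> S \<Longrightarrow> \<psi> \<tau> (f x) = x \<and> f x \<in> U"
    unfolding eventually_nhds by blast
  have "flow_family (\<lambda>x. - v x) \<tau> S (\<lambda>s x. \<psi> (\<tau> - s) (f x))"
    unfolding flow_family_def
  proof (intro conjI ballI)
    fix x s assume x: "x \<in> S" and s: "s \<in> {0..\<tau>}"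
    have im: "(\<lambda>s. \<tau> - s) ` {0..\<tau>} = {0..\<tau>}" by (auto simp: image_iff intro!: bexI[of _ "\<tau> - _"])
    have "\<tau> - s \<in> {0..\<tau>}" using s by auto
    then have "((\<lambda>s. \<psi> s (f x)) has_vector_derivative v (\<psi> (\<tau> - s) (f x))) (at (\<tau> - s) within (\<lambda>s. \<tau> - s) ` {0..\<tau>})"
      unfolding im using Ff S(3)[OF x] by blast
    moreover have "((\<lambda>s. \<tau> - s) has_vector_derivative - 1) (at s within {0..\<tau>})"
      by (auto intro!: derivative_eq_intros)
    ultimately show "((\<lambda>s. \<psi> (\<tau> - s) (f x)) has_vector_derivative - v (\<psi> (\<tau> - s) (f x))) (at s within {0..\<tau>})"
      using vector_diff_chain_within[of "\<lambda>s. \<tau> - s" "- 1" s "{0..\<tau>}" "\<lambda>s. \<psi> s (f x)"] by (simp add: o_def)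
  qed (use Ff S in auto)
  from flow_germsI[OF this] have "germ_of (\<lambda>x. \<psi> (\<tau> - \<tau>) (f x)) \<in> flow_germs (\<lambda>x. - v x)" .
  moreover have "F' = germ_of (\<lambda>x. \<psi> (\<tau> - \<tau>) (f x))"
  proof -
    have "\<forall>\<^sub>F x in nhds 0. x \<in> S" using S by (intro eventually_nhds_in_open) auto
    then have "\<forall>\<^sub>F x in nhds 0. f x = \<psi> (\<tau> - \<tau>) (f x)"
      by eventually_elim (use S(3) Ff in auto)
    then show ?thesis unfolding f(1) germ_of_eq_iff .
  qed
  ultimately show ?thesis by simp
qed

lemma is_flow_germ_flow_germs:
  assumes "is_flow_germ (germ_of v) t F" "smooth_near_0 v" "v 0 = 0"
  shows "F \<in> flow_germs v \<union> flow_germs (\<lambda>x. - v x)"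
proof -
  obtain w W U \<phi> where *: "germ_of v = germ_of w \<and> open W \<and> smooth_on W w \<and> open U \<and> 0 \<in> U \<and>
        (\<forall>x\<in>U. \<phi> 0 x = x \<and>
          (\<forall>s\<in>closed_segment 0 t. \<phi> s x \<in> W \<and>
             ((\<lambda>s. \<phi> s x) has_vector_derivative w (\<phi> s x)) (at s within closed_segment 0 t))) \<and>
        F = germ_of (\<phi> t)"
    using assms(1) unfolding is_flow_germ_def by (elim exE) (rule that)
  then have fl: "germ_of v = germ_of w" "open U" "0 \<in> U"
    "\<And>x. x \<in> U \<Longrightarrow> \<phi> 0 x = x"
    "\<And>x s. x \<in> U \<Longrightarrow> s \<in> closed_segment 0 t \<Longrightarrow>
      ((\<lambda>s. \<phi> s x) has_vector_derivative w (\<phi> s x)) (at s within closed_segment 0 t)"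
    "F = germ_of (\<phi> t)" by simp_all
  have wv: "\<forall>\<^sub>F x in nhds 0. w x = v x" using fl(1) by (simp add: germ_of_eq_iff eq_commute)
  show ?thesis
  proof (cases "0 \<le> t")
    case True
    then have "flow_family w t U \<phi>"
      using fl by (simp add: flow_family_def closed_segment_eq_real_ivl)
    then show ?thesis using flow_germs_transfer[OF _ wv assms(2,3)] fl(6) by blast
  next
    case False
    \<comment> \<open>For negative \<open>t\<close> time is reversed by
      \<open>s \<mapsto> - s\<close>, which turns the flow into a forward flow of the opposite
      field.\<close>
    have "flow_family (\<lambda>x. - w x) (- t) U (\<lambda>s x. \<phi> (- s) x)"
      unfolding flow_family_def
    proof (intro conjI ballI)
      fix x s assume x: "x \<in> U" and s: "s \<in> {0..- t}"
      have im: "uminus ` {0..- t} = closed_segment 0 t" using False by (simp add: closed_segment_eq_real_ivl)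
      have "- s \<in> closed_segment 0 t" using s False by (simp add: closed_segment_eq_real_ivl)
      then have "((\<lambda>s. \<phi> s x) has_vector_derivative w (\<phi> (- s) x)) (at (- s) within uminus ` {0..- t})"
        unfolding im using fl(5)[OF x] by blast
      moreover have "(uminus has_vector_derivative - 1) (at s within {0..- t})"
        by (auto intro!: derivative_eq_intros)
      ultimately show "((\<lambda>s. \<phi> (- s) x) has_vector_derivative - w (\<phi> (- s) x)) (at s within {0..- t})"
        using vector_diff_chain_within[of uminus "- 1" s "{0..- t}" "\<lambda>s. \<phi> s x"] by (simp add: o_def)
    qed (use fl False in auto)
    moreover have "\<forall>\<^sub>F x in nhds 0. - w x = - v x" using wv by eventually_elim simp
    moreover have "smooth_near_0 (\<lambda>x. - v x)"
      by (rule smooth_near_0_bounded_linear_comp[OF bounded_linear_minus[OF bounded_linear_ident] assms(2)])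
    ultimately have "germ_of (\<phi> (- (- t))) \<in> flow_germs (\<lambda>x. - v x)"
      using flow_germs_transfer[of "\<lambda>x. - w x" "- t" U "\<lambda>s x. \<phi> (- s) x" "\<lambda>x. - v x"] assms(3) by simp
    then show ?thesis using fl(6) by simp
  qed
qed

text \<open>Inverses are left out because exponents are natural numbers and times are nonnegative;
  the opposite direction is a submonoid of its own.\<close>

definition parametrized_submonoid ::
  "(real ^ 'n, real ^ 'n) germ set \<Rightarrow> (real ^ 'n, real ^ 'n) germ set \<Rightarrow> bool" where
  "parametrized_submonoid G K \<longleftrightarrow> K \<subseteq> G \<and> id_germ \<in> K \<and> (\<forall>h\<in>K. \<forall>k\<in>K. germ_comp h k \<in> K) \<and>
    finitely_parametrized K"

text \<open>By commutativity \<open>(h k) (h' k') = (h h') (k k')\<close>, so the pointwise product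
  of two submonoids is again a submonoid, and \<open>finitely_parametrized_comp\<close> parametrizes
  it. Submonoids are joined one after the other.\<close>

lemma parametrized_submonoid_join:
  assumes G: "G \<subseteq> smooth_germs_fix_0" "\<And>x y. x \<in> G \<Longrightarrow> y \<in> G \<Longrightarrow> germ_comp x y \<in> G"
    "\<And>x y. x \<in> G \<Longrightarrow> y \<in> G \<Longrightarrow> germ_comp x y = germ_comp y x" "id_germ \<in> G"
    and "finite \<B>" "\<And>K. K \<in> \<B> \<Longrightarrow> parametrized_submonoid G K"
  shows "\<exists>P. parametrized_submonoid G P \<and> \<Union>\<B> \<subseteq> P"
  using assms(5,6)
proof (induction \<B>)
  case empty
  then show ?case
    using G(4) by (intro exI[of _ "{id_germ}"])
      (simp add: parametrized_submonoid_def finitely_parametrized_id germ_comp_id)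
next
  case (insert K \<B>)
  have "\<exists>P. parametrized_submonoid G P \<and> \<Union>\<B> \<subseteq> P" by (rule insert.IH) (rule insert.prems, rule insertI2)
  then obtain P where P: "parametrized_submonoid G P" "\<Union>\<B> \<subseteq> P" by (elim exE conjE) (rule that)
  note P' = P(1)[unfolded parametrized_submonoid_def]
  have K: "K \<subseteq> G \<and> id_germ \<in> K \<and> (\<forall>h\<in>K. \<forall>k\<in>K. germ_comp h k \<in> K) \<and> finitely_parametrized K"
    using insert.prems[of K] unfolding parametrized_submonoid_def by simp
  let ?Q = "{germ_comp h k | h k. h \<in> K \<and> k \<in> P}"
  have fpQ: "finitely_parametrized ?Q"
    by (rule finitely_parametrized_comp) (use K P' G(1) in auto)
  have QG: "?Q \<subseteq> G" using K P' G(2) by auto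
  have KQ: "K \<subseteq> ?Q" 
  proof
    fix h assume h: "h \<in> K"
    have "h = germ_comp h id_germ" by (rule germ_comp_id[symmetric])
    then show "h \<in> ?Q" using P' h by blast
  qed
  have PQ: "P \<subseteq> ?Q"
  proof
    fix k assume k: "k \<in> P"
    then have "k = germ_comp id_germ k" using P' G(1) by (intro germ_id_comp[symmetric]) auto
    then show "k \<in> ?Q" using K k by blast
  qed
  have comp_Q: "germ_comp g g' \<in> ?Q" if "g \<in> ?Q" "g' \<in> ?Q" for g g'
  proof -
    obtain h k h' k' where *: "g = germ_comp h k" "g' = germ_comp h' k'" "h \<in> K" "k \<in> P" "h' \<in> K" "k' \<in> P"
      using \<open>g \<in> ?Q\<close> \<open>g' \<in> ?Q\<close> by blast
    have inG: "h \<in> G" "k \<in> G" "h' \<in> G" "k' \<in> G" using * K P' by auto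
    then have fix_0: "h \<in> smooth_germs_fix_0" "k \<in> smooth_germs_fix_0" "h' \<in> smooth_germs_fix_0" "k' \<in> smooth_germs_fix_0"
      using G(1) by auto
    have "germ_comp g g' = germ_comp h (germ_comp (germ_comp k h') k')"
      unfolding *(1,2) by (simp only: germ_comp_assoc fix_0 germ_comp_fix_0)
    also have "germ_comp k h' = germ_comp h' k" using inG by (intro G(3))
    also have "germ_comp h (germ_comp (germ_comp h' k) k') = germ_comp (germ_comp h h') (germ_comp k k')"
      by (simp only: germ_comp_assoc fix_0 germ_comp_fix_0)
    finally show ?thesis using * K P' by blast
  qed
  have "id_germ \<in> ?Q" by (rule subsetD[OF KQ]) (use K in simp)
  then have "parametrized_submonoid G ?Q"
    unfolding parametrized_submonoid_def by (intro conjI QG fpQ ballI comp_Q)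
  moreover have "\<Union>(insert K \<B>) \<subseteq> ?Q"
    unfolding Union_insert by (intro Un_least KQ order_trans[OF P(2) PQ])
  ultimately show ?case by (intro exI[of _ ?Q] conjI)
qed

text \<open>The join of finitely many submonoids contains each generator as well as its inverse,
  which is what rule induction over \<open>generate\<close> requires; hence it contains all of
  \<open>G\<close>.\<close>

theorem finitely_generated_parametrized:
  fixes G :: "(real ^ 'n, real ^ 'n) germ set"
  assumes "subgroup G Diff_0" "comm_group (Diff_0\<lparr>carrier := G\<rparr>)" "finitely_generated G"
  shows "finitely_parametrized G"
proof -
  have GD: "G \<subseteq> carrier Diff_0" using subgroup.subset[OF assms(1)] .
  have G: "G \<subseteq> smooth_germs_fix_0" using GD carrier_Diff_0 by blast
  have closed: "germ_comp x y \<in> G" if "x \<in> G" "y \<in> G" for x y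
    using subgroup.m_closed[OF assms(1) that] by (simp add: mult_Diff_0)
  have one: "id_germ \<in> G" using subgroup.one_closed[OF assms(1)] by (simp add: one_Diff_0)
  have inv: "inv\<^bsub>Diff_0\<^esub> x \<in> G" if "x \<in> G" for x using subgroup.m_inv_closed[OF assms(1) that] .
  have comm: "germ_comp x y = germ_comp y x" if "x \<in> G" "y \<in> G" for x y
  proof -
    interpret comm_group "Diff_0\<lparr>carrier := G\<rparr>" by fact
    show ?thesis using m_comm[of x y] that by (simp add: mult_Diff_0)
  qed
  obtain A V where AV: "finite A" "A \<subseteq> carrier Diff_0" "finite V" "V \<subseteq> smooth_germs_fix_0"
    "G = generate Diff_0 (A \<union> {F. \<exists>v\<in>V. \<exists>t. is_flow_germ v t F})"
    using assms(3) unfolding finitely_generated_def by blast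
  let ?S = "A \<union> {F. \<exists>v\<in>V. \<exists>t. is_flow_germ v t F}"
  have SG: "?S \<subseteq> G" using generate.incl[of _ ?S Diff_0] AV(5) by blast
  have "\<forall>v\<in>V. \<exists>w. v = germ_of w \<and> smooth_near_0 w \<and> w 0 = 0"
    using AV(4) by (auto simp: smooth_germs_fix_0_def)
  from bchoice[OF this]
  obtain w where w: "\<And>v. v \<in> V \<Longrightarrow> v = germ_of (w v) \<and> smooth_near_0 (w v) \<and> w v 0 = 0" by blast
  have power: "parametrized_submonoid G (range (germ_power a))" if "a \<in> G" for a
  proof -
    have a: "a \<in> smooth_germs_fix_0" using that G by blast
    have "germ_power a n \<in> G" for n
      by (induction n) (simp_all add: germ_power_def one closed that)
    moreover have "germ_power a 0 = id_germ" by (simp add: germ_power_def)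
    then have "id_germ \<in> range (germ_power a)" by (metis rangeI)
    moreover have "finitely_parametrized (range (germ_power a))"
      using Diff_0_inv[of a] GD that G inv by (intro finitely_parametrized_powers[OF a, of "inv\<^bsub>Diff_0\<^esub> a"]) auto
    ultimately show ?thesis unfolding parametrized_submonoid_def by (auto simp: germ_power_add[OF a])
  qed
  have flow: "parametrized_submonoid G (flow_germs v \<inter> G)" if "smooth_near_0 v" "v 0 = 0" for v
    unfolding parametrized_submonoid_def
  proof (intro conjI ballI)
    show "finitely_parametrized (flow_germs v \<inter> G)"
      by (rule finitely_parametrized_subset[OF finitely_parametrized_flow_germs[OF that]]) (use G in auto)
  qed (auto simp: one flow_germs_id closed flow_germs_comp[OF that])
  \<comment> \<open>Each generator contributes one submonoid for either direction. Flows are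
    intersected with \<open>G\<close>, where commutativity and smoothness are available.\<close>
  define \<B> where "\<B> = (\<lambda>a. range (germ_power a)) ` (A \<union> (\<lambda>a. inv\<^bsub>Diff_0\<^esub> a) ` A) \<union>
    (\<lambda>v. flow_germs (w v) \<inter> G) ` V \<union> (\<lambda>v. flow_germs (\<lambda>x. - w v x) \<inter> G) ` V"
  have neg: "smooth_near_0 (\<lambda>x. - w v x)" "- w v 0 = 0" if "v \<in> V" for v
    using w[OF that] smooth_near_0_bounded_linear_comp[OF bounded_linear_minus[OF bounded_linear_ident], of "w v"]
    by auto
  have fin: "finite \<B>" unfolding \<B>_def using AV by auto
  have sub: "parametrized_submonoid G K" if "K \<in> \<B>" for K
    using that unfolding \<B>_def
  proof (elim UnE imageE)
    fix a assume "K = range (germ_power a)" "a \<in> A"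
    moreover from this have "a \<in> G" using SG by blast
    ultimately show ?thesis using power by simp
  next
    fix a a' assume "K = range (germ_power a)" "a = inv\<^bsub>Diff_0\<^esub> a'" "a' \<in> A"
    moreover from this have "inv\<^bsub>Diff_0\<^esub> a' \<in> G" using SG by (intro inv) auto
    ultimately show ?thesis using power by simp
  qed (use flow w neg in auto)
  have "\<exists>P. parametrized_submonoid G P \<and> \<Union>\<B> \<subseteq> P"
    by (rule parametrized_submonoid_join[OF G closed comm one fin sub])
  then obtain P where P: "parametrized_submonoid G P" "\<Union>\<B> \<subseteq> P" by (elim exE conjE) (rule that)
  note P' = P(1)[unfolded parametrized_submonoid_def]
  \<comment> \<open>\<open>generate\<close> also adjoins the inverses of flow germs. Such an inverse
    is a forward flow germ of the opposite field, and it lies in \<open>G\<close>, so one of the two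
    submonoids contains it.\<close>
  have flow_P: "h \<in> P \<and> inv\<^bsub>Diff_0\<^esub> h \<in> P" if "v \<in> V" "is_flow_germ v t h" for v t h
  proof -
    have hG: "h \<in> G" using SG that by blast
    then have inv_h: "inv\<^bsub>Diff_0\<^esub> h \<in> smooth_germs_fix_0" "germ_comp h (inv\<^bsub>Diff_0\<^esub> h) = id_germ"
      using Diff_0_inv(2)[of h] GD G inv by auto
    have "h \<in> flow_germs (w v) \<union> flow_germs (\<lambda>x. - w v x)"
      using is_flow_germ_flow_germs[of "w v" t h] w[OF that(1)] that(2) by simp
    moreover from this have "inv\<^bsub>Diff_0\<^esub> h \<in> flow_germs (w v) \<union> flow_germs (\<lambda>x. - w v x)"
      using flow_germs_inverse[OF _ inv_h, of "w v"] flow_germs_inverse[OF _ inv_h, of "\<lambda>x. - w v x"] by auto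
    moreover have "flow_germs (w v) \<inter> G \<in> \<B>" "flow_germs (\<lambda>x. - w v x) \<inter> G \<in> \<B>"
      unfolding \<B>_def using that(1) by simp_all
    then have "flow_germs (w v) \<inter> G \<subseteq> P" "flow_germs (\<lambda>x. - w v x) \<inter> G \<subseteq> P"
      using P(2) by (meson Union_upper order_trans)+
    ultimately show ?thesis using hG inv[OF hG] by (meson IntI UnE subsetD)
  qed
  have power_P: "a \<in> P" if "a \<in> A \<union> (\<lambda>a. inv\<^bsub>Diff_0\<^esub> a) ` A" for a
  proof -
    have "a \<in> smooth_germs_fix_0" using that SG inv G by blast
    then have "germ_power a 1 = a" by (simp add: germ_power_def germ_id_comp)
    then have "a \<in> range (germ_power a)" by (metis rangeI)
    moreover have "range (germ_power a) \<in> \<B>" unfolding \<B>_def using that by simp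
    ultimately show ?thesis using P(2) by (meson UnionI subsetD)
  qed
  have "h \<in> P" if "h \<in> generate Diff_0 ?S" for h
    using that
  proof (induction rule: generate.induct)
    case one
    then show ?case using P' by (simp add: one_Diff_0)
  next
    case (incl h)
    then show ?case using flow_P power_P by blast
  next
    case (inv h)
    then show ?case using flow_P power_P by blast
  next
    case (eng h1 h2)
    then show ?case using P' by (simp add: mult_Diff_0)
  qed
  then have "G \<subseteq> P" using AV(5) by blast
  then show ?thesis using P' finitely_parametrized_subset by blast
qed

section \<open>Multiplicity\<close>

lemma E_simps [simp]:
  "carrier \<E> = smooth_germs" "x \<otimes>\<^bsub>\<E>\<^esub> y = x * y" "x \<oplus>\<^bsub>\<E>\<^esub> y = x + y" "\<one>\<^bsub>\<E>\<^esub> = 1" "\<zero>\<^bsub>\<E>\<^esub> = 0"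
  by (simp_all add: smooth_germ_ring_def smooth_germs_def)

lemma cring_E: "cring (\<E> :: (real ^ 'n, real) germ ring)"
proof (rule cringI)
  show "abelian_group (\<E> :: (real ^ 'n, real) germ ring)"
  proof (rule abelian_groupI)
    fix x :: "(real ^ 'n, real) germ" assume "x \<in> carrier \<E>"
    then show "\<exists>y\<in>carrier \<E>. y \<oplus>\<^bsub>\<E>\<^esub> x = \<zero>\<^bsub>\<E>\<^esub>"
      by (intro bexI[of _ "- x"]) (simp_all add: smooth_germs_uminus)
  qed (simp_all add: smooth_germs_add smooth_germs_0 algebra_simps)
  show "Group.comm_monoid (\<E> :: (real ^ 'n, real) germ ring)"
    by (rule comm_monoidI) (simp_all add: smooth_germs_mult smooth_germs_1 algebra_simps)
qed (simp add: algebra_simps)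

lemma ring_E: "ring \<E>"
  using cring_E by (rule cring.axioms)

lemma E_a_inv: "x \<in> smooth_germs \<Longrightarrow> \<ominus>\<^bsub>\<E>\<^esub> x = - x"
  by (rule abelian_group.minus_equality[OF ring.is_abelian_group[OF ring_E]]) (simp_all add: smooth_germs_uminus)

lemma E_a_minus: "x \<in> smooth_germs \<Longrightarrow> y \<in> smooth_germs \<Longrightarrow> x \<ominus>\<^bsub>\<E>\<^esub> y = x - y"
  by (simp add: a_minus_def E_a_inv)

lemma ideal_ED:
  fixes L :: "(real ^ 'n, real) germ set"
  assumes "ideal L \<E>"
  shows "L \<subseteq> smooth_germs" "0 \<in> L" "x \<in> L \<Longrightarrow> y \<in> L \<Longrightarrow> x + y \<in> L" "x \<in> L \<Longrightarrow> a \<in> smooth_germs \<Longrightarrow> a * x \<in> L"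
    "x \<in> L \<Longrightarrow> y \<in> L \<Longrightarrow> x - y \<in> L"
proof -
  interpret ideal L \<E> by fact
  show L: "L \<subseteq> smooth_germs" using a_subset by simp
  show "0 \<in> L" using additive_subgroup.zero_closed[OF additive_subgroup_axioms] by simp
  show add: "x \<in> L \<Longrightarrow> y \<in> L \<Longrightarrow> x + y \<in> L" for x y
    using additive_subgroup.a_closed[OF additive_subgroup_axioms, of x y] by simp
  show mult: "x \<in> L \<Longrightarrow> a \<in> smooth_germs \<Longrightarrow> a * x \<in> L" for x a
    using I_l_closed[of x a] by simp
  show "x - y \<in> L" if "x \<in> L" "y \<in> L"
    using add[OF that(1) mult[OF that(2) smooth_germs_uminus[OF smooth_germs_1]]] by simp
qed

lemma ideal_EI:
  assumes "L \<subseteq> smooth_germs" "0 \<in> L" "\<And>x y. x \<in> L \<Longrightarrow> y \<in> L \<Longrightarrow> x + y \<in> L"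
    and mult: "\<And>x a. x \<in> L \<Longrightarrow> a \<in> smooth_germs \<Longrightarrow> a * x \<in> L"
  shows "ideal L \<E>"
proof (rule idealI[OF ring_E])
  interpret add: Group.group "add_monoid \<E>"
    using abelian_group.a_group[OF ring.is_abelian_group[OF ring_E]] .
  have inv: "inv\<^bsub>add_monoid \<E>\<^esub> x = - x" if "x \<in> L" for x
    using E_a_inv[of x] assms(1) that by (auto simp: a_inv_def)
  have "- x \<in> L" if "x \<in> L" for x
    using mult[OF that smooth_germs_uminus[OF smooth_germs_1]] by simp
  then show "subgroup L (add_monoid \<E>)"
    using assms inv by (intro add.subgroupI) auto
qed (use assms in \<open>auto simp: mult.commute\<close>)

lemma ideal_E_sum: "ideal L \<E> \<Longrightarrow> (\<And>i. i \<in> I \<Longrightarrow> f i \<in> L) \<Longrightarrow> (\<Sum>i\<in>I. f i) \<in> L"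
  by (induction I rule: infinite_finite_induct) (auto intro: ideal_ED)

text \<open>A family that spans without being independent bounds the dimension from above. Therefore
  the family found at one \<open>g\<close> can be tested against the ideals of all other elements of
  \<open>G\<close>.\<close>

definition spans_modulo :: "(real ^ 'n, real) germ set \<Rightarrow> nat \<Rightarrow> (nat \<Rightarrow> (real ^ 'n, real) germ) \<Rightarrow> bool" where
  "spans_modulo L k b \<longleftrightarrow> (\<forall>i<k. b i \<in> smooth_germs) \<and>
    (\<forall>f\<in>smooth_germs. \<exists>c. f - (\<Sum>i<k. const (c i) * b i) \<in> L)"

section \<open>Dimension of the quotient by an ideal of germs\<close>

context
  fixes L :: "(real ^ 'n, real) germ set"
  assumes L: "ideal L \<E>"
begin

interpretation Q: ring "\<E> Quot L" by (rule ideal.quotient_is_ring[OF L])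

interpretation proj: ring_hom_ring \<E> "\<E> Quot L" "(+>\<^bsub>\<E>\<^esub>) L" by (rule ideal.rcos_ring_hom_ring[OF L])

abbreviation cls :: "(real ^ 'n, real) germ \<Rightarrow> (real ^ 'n, real) germ set" where "cls x \<equiv> L +>\<^bsub>\<E>\<^esub> x"

abbreviation scalars :: "(real ^ 'n, real) germ set set" where "scalars \<equiv> range (\<lambda>c. cls (germ_of (\<lambda>_. c)))"

lemma cls_add: "x \<in> smooth_germs \<Longrightarrow> y \<in> smooth_germs \<Longrightarrow> cls x \<oplus>\<^bsub>\<E> Quot L\<^esub> cls y = cls (x + y)"
  using proj.hom_add[of x y] by simp

lemma cls_mult: "x \<in> smooth_germs \<Longrightarrow> y \<in> smooth_germs \<Longrightarrow> cls x \<otimes>\<^bsub>\<E> Quot L\<^esub> cls y = cls (x * y)"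
  using proj.hom_mult[of x y] by simp

lemma cls_0: "\<zero>\<^bsub>\<E> Quot L\<^esub> = cls 0"
  using proj.hom_zero by simp

lemma carrier_quot: "carrier (\<E> Quot L) = cls ` smooth_germs"
  by (auto simp: FactRing_def A_RCOSETS_def')

lemma cls_eq_iff: "x \<in> smooth_germs \<Longrightarrow> y \<in> smooth_germs \<Longrightarrow> cls x = cls y \<longleftrightarrow> x - y \<in> L"
  using ring.quotient_eq_iff_same_a_r_cos[OF ring_E L, of x y] by (simp add: E_a_minus)

lemma dimension_spans:
  "Q.dimension n scalars S \<Longrightarrow> \<exists>b. (\<forall>i<n. b i \<in> smooth_germs) \<and> (\<forall>s\<in>S. \<exists>c. s = cls (\<Sum>i<n. const (c i) * b i))"
proof (induction n "scalars" S rule: Q.dimension.induct)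
  case zero_dim
  then show ?case using cls_0 by auto
next
  case (Suc_dim v E n)
  then obtain b where b: "\<And>i. i < n \<Longrightarrow> b i \<in> smooth_germs" "\<And>s. s \<in> E \<Longrightarrow> \<exists>c. s = cls (\<Sum>i<n. const (c i) * b i)"
    by blast
  obtain x where x: "x \<in> smooth_germs" "v = cls x" using Suc_dim(1) unfolding carrier_quot by blast
  let ?b = "\<lambda>i. if i < n then b i else x"
  have "\<exists>c. s = cls (\<Sum>i<Suc n. const (c i) * ?b i)" if "s \<in> Q.line_extension scalars v E" for s
  proof -
    obtain d e where de: "s = (cls (const d) \<otimes>\<^bsub>\<E> Quot L\<^esub> v) \<oplus>\<^bsub>\<E> Quot L\<^esub> e" "e \<in> E"
      using \<open>s \<in> Q.line_extension scalars v E\<close> unfolding Q.line_extension_def set_add_def' r_coset_def const_def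
      by auto
    obtain c where c: "e = cls (\<Sum>i<n. const (c i) * b i)" using b(2) de(2) by blast
    let ?c = "\<lambda>i. if i < n then c i else d"
    have sm: "(\<Sum>i<n. const (c i) * b i) \<in> smooth_germs"
      using b(1) by (intro smooth_germs_sum smooth_germs_mult smooth_germs_const) auto
    have "s = cls (const d * x + (\<Sum>i<n. const (c i) * b i))"
      unfolding de(1) c x(2) using x(1) sm
      by (simp add: cls_mult cls_add smooth_germs_const smooth_germs_mult)
    moreover have "(\<Sum>i<Suc n. const (?c i) * ?b i) = const d * x + (\<Sum>i<n. const (c i) * b i)"
      by (simp add: add.commute)
    ultimately show ?thesis by (intro exI[of _ ?c]) (simp only:)
  qed
  then show ?case using b(1) x(1) by (intro exI[of _ ?b]) auto
qed

lemma spans_modulo_of_finite_dimension: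
  assumes "Q.finite_dimension scalars (carrier (\<E> Quot L))"
  shows "\<exists>k b. spans_modulo L k b"
proof -
  obtain n where "Q.dimension n scalars (carrier (\<E> Quot L))" using assms unfolding Q.finite_dimension_def by blast
  from dimension_spans[OF this] obtain b where b: "\<forall>i<n. b i \<in> smooth_germs"
    "\<And>s. s \<in> carrier (\<E> Quot L) \<Longrightarrow> \<exists>c. s = cls (\<Sum>i<n. const (c i) * b i)" by blast
  have "\<exists>c. f - (\<Sum>i<n. const (c i) * b i) \<in> L" if "f \<in> smooth_germs" for f
  proof -
    have "cls f \<in> carrier (\<E> Quot L)" unfolding carrier_quot using that by (rule imageI)
    then obtain c where c: "cls f = cls (\<Sum>i<n. const (c i) * b i)" using b(2) by blast
    have "(\<Sum>i<n. const (c i) * b i) \<in> smooth_germs"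
      using b(1) by (intro smooth_germs_sum smooth_germs_mult smooth_germs_const) auto
    then show ?thesis using c cls_eq_iff[OF that] by blast
  qed
  then show ?thesis using b(1) unfolding spans_modulo_def by blast
qed

text \<open>In the zero ring \<open>scalars\<close> is not a subfield, so uniqueness of the
  dimension is obtained directly: there is no vector outside \<open>{0}\<close> by which the
  dimension could grow.\<close>

lemma dimension_trivial:
  assumes "carrier (\<E> Quot L) = {\<zero>\<^bsub>\<E> Quot L\<^esub>}"
  shows "Q.dimension n K S \<Longrightarrow> n = 0 \<and> S = {\<zero>\<^bsub>\<E> Quot L\<^esub>}"
  by (induction rule: Q.dimension.induct) (use assms in auto)

lemma subfield_scalars:
  assumes "1 \<notin> L"
  shows "subfield scalars (\<E> Quot L)"
proof -
  interpret E: cring \<E> by (rule cring_E)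
  let ?K = "range const :: (real ^ 'n, real) germ set"
  have K: "?K \<subseteq> smooth_germs" using smooth_germs_const by auto
  have sub: "subring ?K \<E>"
  proof (rule E.subringI)
    show "?K \<subseteq> carrier \<E>" using K by simp
    show "\<one>\<^bsub>\<E>\<^esub> \<in> ?K" using const_1 by (metis E_simps(4) rangeI)
    show "\<ominus>\<^bsub>\<E>\<^esub> h \<in> ?K" if h: "h \<in> ?K" for h
      using h K E_a_inv[of h] by (auto simp: const_uminus[symmetric] subset_iff)
    show "h1 \<otimes>\<^bsub>\<E>\<^esub> h2 \<in> ?K" if "h1 \<in> ?K" "h2 \<in> ?K" for h1 h2
      using that by (auto simp: const_mult[symmetric])
    show "h1 \<oplus>\<^bsub>\<E>\<^esub> h2 \<in> ?K" if "h1 \<in> ?K" "h2 \<in> ?K" for h1 h2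
      using that by (auto simp: const_add[symmetric])
  qed
  have ne: "(1 :: (real ^ 'n, real) germ) \<noteq> 0" using assms ideal_ED(2)[OF L] by metis
  have "subfield ?K \<E>"
  proof (rule E.subfieldI)
    show "subcring ?K \<E>"
      by (rule E.subcringI[OF sub]) (simp add: mult.commute)
    show "Units (\<E>\<lparr>carrier := ?K\<rparr>) = ?K - {\<zero>\<^bsub>\<E>\<^esub>}"
    proof (intro equalityI subsetI)
      fix x assume "x \<in> Units (\<E>\<lparr>carrier := ?K\<rparr>)"
      then show "x \<in> ?K - {\<zero>\<^bsub>\<E>\<^esub>}" using ne by (auto simp: Units_def)
    next
      fix x assume "x \<in> ?K - {\<zero>\<^bsub>\<E>\<^esub>}"
      then obtain c where c: "x = const c" "const c \<noteq> (0 :: (real ^ 'n, real) germ)" by auto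
      have "c \<noteq> 0" using c(2) const_0 by metis
      have "const (inverse c) * x = 1" "x * const (inverse c) = 1"
        using \<open>c \<noteq> 0\<close> unfolding c(1) by (simp_all add: const_mult[symmetric] const_1)
      then show "x \<in> Units (\<E>\<lparr>carrier := ?K\<rparr>)" using c by (auto simp: Units_def)
    qed
  qed
  moreover have "\<one>\<^bsub>\<E> Quot L\<^esub> \<noteq> \<zero>\<^bsub>\<E> Quot L\<^esub>"
    using cls_eq_iff[OF smooth_germs_1 smooth_germs_0] assms proj.hom_one cls_0 by auto
  ultimately have "subfield (cls ` ?K) (\<E> Quot L)" by (rule proj.img_is_subfield(2))
  moreover have "cls ` ?K = scalars" unfolding image_image const_def ..
  ultimately show ?thesis by simp
qed

text \<open>Each vector of the list either already lies in the span of those after it or raises the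
  dimension by exactly one.\<close>

lemma Span_dimension_le:
  assumes "subfield K (\<E> Quot L)" "set Us \<subseteq> carrier (\<E> Quot L)"
  shows "\<exists>n\<le>length Us. Q.dimension n K (Q.Span K Us)"
  using assms(2)
proof (induction Us)
  case Nil
  then show ?case by auto
next
  case (Cons u Us)
  then obtain n where n: "n \<le> length Us" "Q.dimension n K (Q.Span K Us)" by auto
  show ?case
  proof (cases "u \<in> Q.Span K Us")
    case True
    have "set (u # Us) \<subseteq> Q.Span K Us"
      using True Q.Span_base_incl[OF assms(1), of Us] Cons.prems by auto
    then have "Q.Span K (u # Us) = Q.Span K Us"
      using Q.mono_Span_subset[OF assms(1), of "u # Us" Us] Q.mono_Span[OF assms(1), of Us u] Cons.prems
      by (intro equalityI) auto
    then show ?thesis using n by (intro exI[of _ n]) auto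
  next
    case False
    then have "Q.dimension (Suc n) K (Q.line_extension K u (Q.Span K Us))"
      using n(2) Cons.prems by (intro Q.dimension.Suc_dim) auto
    then show ?thesis using n(1) by (intro exI[of _ "Suc n"]) simp
  qed
qed

lemma spans_modulo_dimension:
  assumes "spans_modulo L k b"
  shows "\<exists>n\<le>k. Q.finite_dimension scalars (carrier (\<E> Quot L)) \<and> Q.dim scalars (carrier (\<E> Quot L)) = n"
proof (cases "1 \<in> L")
  \<comment> \<open>The ideal is the whole ring and the quotient is zero, which the dimension theory
    over subfields does not cover.\<close>
  case True
  then have "L = smooth_germs"
    using ideal_ED(1)[OF L] ideal_ED(4)[OF L True] by auto
  then have "cls x = cls 0" if "x \<in> smooth_germs" for x
    using cls_eq_iff[OF that smooth_germs_0] that by simp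
  then have triv: "carrier (\<E> Quot L) = {\<zero>\<^bsub>\<E> Quot L\<^esub>}"
    unfolding carrier_quot cls_0 using smooth_germs_0 by blast
  have "Q.dimension 0 scalars (carrier (\<E> Quot L))" unfolding triv by (rule Q.zero_dim)
  moreover from this have "Q.dim scalars (carrier (\<E> Quot L)) = 0"
    unfolding Q.dim_def using dimension_trivial[OF triv] by (intro the_equality) auto
  ultimately show ?thesis using Q.finite_dimensionI by blast
next
  case False
  note K = subfield_scalars[OF False]
  let ?U = "map (\<lambda>i. cls (b i)) [0..<k]"
  have b: "b i \<in> smooth_germs" if "i < k" for i using assms that unfolding spans_modulo_def by blast
  have U: "set ?U \<subseteq> carrier (\<E> Quot L)" unfolding carrier_quot using b by auto
  have "cls (\<Sum>i<j. const (c i) * b i) \<in> Q.Span scalars ?U" if "j \<le> k" for j c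
    using that
  proof (induction j)
    case 0
    then show ?case using Q.Span_subgroup_props(2)[OF K U] cls_0 by simp
  next
    case (Suc j)
    have "cls (const (c j)) \<in> scalars" by (auto simp: const_def)
    moreover have "cls (b j) \<in> Q.Span scalars ?U"
      using Q.Span_base_incl[OF K U] Suc.prems by auto
    ultimately have "cls (const (c j)) \<otimes>\<^bsub>\<E> Quot L\<^esub> cls (b j) \<in> Q.Span scalars ?U"
      by (rule Q.Span_smult_closed[OF K U])
    then have "cls (const (c j) * b j) \<in> Q.Span scalars ?U"
      using b[of j] Suc.prems by (simp add: cls_mult smooth_germs_const)
    with Suc have "cls (\<Sum>i<j. const (c i) * b i) \<oplus>\<^bsub>\<E> Quot L\<^esub> cls (const (c j) * b j) \<in> Q.Span scalars ?U"
      by (intro Q.Span_subgroup_props(3)[OF K U]) auto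
    moreover have "(\<Sum>i<j. const (c i) * b i) \<in> smooth_germs"
      using b Suc.prems by (intro smooth_germs_sum smooth_germs_mult smooth_germs_const) auto
    ultimately show ?case
      using b[of j] Suc.prems by (simp add: cls_add smooth_germs_const smooth_germs_mult)
  qed
  note in_span = this[OF order_refl]
  have "carrier (\<E> Quot L) \<subseteq> Q.Span scalars ?U"
  proof
    fix s assume "s \<in> carrier (\<E> Quot L)"
    then obtain f where f: "f \<in> smooth_germs" "s = cls f" unfolding carrier_quot by blast
    then obtain c where c: "f - (\<Sum>i<k. const (c i) * b i) \<in> L" using assms unfolding spans_modulo_def by blast
    have "(\<Sum>i<k. const (c i) * b i) \<in> smooth_germs"
      using b by (intro smooth_germs_sum smooth_germs_mult smooth_germs_const) auto
    then have "s = cls (\<Sum>i<k. const (c i) * b i)" using c f cls_eq_iff[OF f(1)] by blast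
    then show "s \<in> Q.Span scalars ?U" using in_span by simp
  qed
  then have span: "Q.Span scalars ?U = carrier (\<E> Quot L)"
    using Q.Span_subgroup_props(1)[OF K U] by blast
  obtain n where n: "n \<le> length ?U" "Q.dimension n scalars (carrier (\<E> Quot L))"
    using Span_dimension_le[OF K U] unfolding span by blast
  have "Q.dim scalars (carrier (\<E> Quot L)) = n" using Q.dimI[OF K n(2)] by (simp add: over_def)
  then show ?thesis using n Q.finite_dimensionI by (intro exI[of _ n]) auto
qed

end

lemma intersection_multiplicity_finite:
  assumes "intersection_multiplicity I J < \<infinity>" "I \<subseteq> smooth_germs" "J \<subseteq> smooth_germs"
  shows "\<exists>k b. spans_modulo (Idl\<^bsub>\<E>\<^esub> (I \<union> J)) k b"
proof -
  have L: "ideal (Idl\<^bsub>\<E>\<^esub> (I \<union> J)) \<E>"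
    by (rule ring.genideal_ideal[OF ring_E]) (use assms(2,3) in simp)
  show ?thesis
    using assms(1) unfolding intersection_multiplicity_def Let_def
    by (intro spans_modulo_of_finite_dimension[OF L]) (auto split: if_splits)
qed

lemma intersection_multiplicity_le:
  assumes "spans_modulo (Idl\<^bsub>\<E>\<^esub> (I \<union> J)) k b" "I \<subseteq> smooth_germs" "J \<subseteq> smooth_germs"
  shows "intersection_multiplicity I J \<le> enat k"
proof -
  have L: "ideal (Idl\<^bsub>\<E>\<^esub> (I \<union> J)) \<E>"
    by (rule ring.genideal_ideal[OF ring_E]) (use assms(2,3) in simp)
  show ?thesis
    using spans_modulo_dimension[OF L assms(1)] unfolding intersection_multiplicity_def Let_def by auto
qed

text \<open>Elimination in a system whose matrix is the identity plus entries vanishing at the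
  origin. As \<open>1 - z p\<close> is a unit, \<open>w p\<close> is expressed modulo
  \<open>L\<close> by the other \<open>w j\<close>; substituting it keeps the remaining coefficients
  in \<open>vanishing 1\<close>.\<close>

lemma nakayama:
  fixes w :: "'i \<Rightarrow> (real ^ 'n, real) germ"
  assumes "ideal L \<E>" "finite W" "\<And>i. i \<in> W \<Longrightarrow> w i \<in> smooth_germs"
    and "\<And>i. i \<in> W \<Longrightarrow> \<exists>z. (\<forall>j\<in>W. z j \<in> vanishing 1) \<and> w i - (\<Sum>j\<in>W. z j * w j) \<in> L"
  shows "\<forall>i\<in>W. w i \<in> L"
  using assms(2-4)
proof (induction W)
  case (insert p W)
  note L = ideal_ED[OF assms(1)]
  obtain z where z: "\<And>j. j \<in> insert p W \<Longrightarrow> z j \<in> vanishing 1" "w p - (\<Sum>j\<in>insert p W. z j * w j) \<in> L"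
    using insert.prems(2)[of p] by blast
  have "- z p \<in> vanishing 1" using z(1) by (intro vanishing_uminus) simp
  from smooth_germ_inverse[OF this, of 1] obtain u where u: "u \<in> smooth_germs" "u * (1 - z p) = 1"
    by (auto simp: const_1)
  have "u * (w p - (\<Sum>j\<in>insert p W. z j * w j)) \<in> L" by (rule L(4)[OF z(2) u(1)])
  moreover have "u * (w p - (\<Sum>j\<in>insert p W. z j * w j)) = (u * (1 - z p)) * w p - (\<Sum>j\<in>W. (u * z j) * w j)"
    using insert.hyps by (simp add: sum_distrib_left algebra_simps)
  ultimately have p: "w p - (\<Sum>j\<in>W. (u * z j) * w j) \<in> L" by (simp add: u(2))
  have IH: "\<forall>i\<in>W. w i \<in> L"
  proof (rule insert.IH)
    show "w i \<in> smooth_germs" if "i \<in> W" for i using insert.prems(1) that by simp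
    fix i assume i: "i \<in> W"
    obtain y where y: "\<And>j. j \<in> insert p W \<Longrightarrow> y j \<in> vanishing 1" "w i - (\<Sum>j\<in>insert p W. y j * w j) \<in> L"
      using insert.prems(2)[of i] i by blast
    have yp: "y p \<in> smooth_germs" using y(1)[of p] vanishing_smooth by blast
    have "(w i - (\<Sum>j\<in>insert p W. y j * w j)) + y p * (w p - (\<Sum>j\<in>W. (u * z j) * w j)) \<in> L"
      by (intro L(3) y(2) L(4)[OF p yp])
    moreover have "(w i - (\<Sum>j\<in>insert p W. y j * w j)) + y p * (w p - (\<Sum>j\<in>W. (u * z j) * w j)) =
        w i - (\<Sum>j\<in>W. (y p * (u * z j) + y j) * w j)"
      using insert.hyps by (simp add: sum_distrib_left sum.distrib algebra_simps)
    moreover have "y p * (u * z j) + y j \<in> vanishing 1" if "j \<in> W" for j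
      using that by (intro vanishing_add vanishing_smooth_mult yp u(1) z(1) y(1)) auto
    ultimately show "\<exists>z. (\<forall>j\<in>W. z j \<in> vanishing 1) \<and> w i - (\<Sum>j\<in>W. z j * w j) \<in> L"
      by (intro exI[of _ "\<lambda>j. y p * (u * z j) + y j"]) auto
  qed
  have "(\<Sum>j\<in>W. (u * z j) * w j) \<in> L"
    using IH u(1) z(1) vanishing_smooth by (intro ideal_E_sum[OF assms(1)] L(4) smooth_germs_mult) auto
  from L(3)[OF p this] have "w p \<in> L" by simp
  then show ?case using IH by simp
qed simp

text \<open>\<open>vanishing (Suc i)\<close> is the maximal ideal times \<open>vanishing i\<close>,
  and the latter is generated by the words of length \<open>i\<close>, so Nakayama's lemma applies
  to these words.\<close>

lemma vanishing_subset_ideal: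
  fixes L :: "(real ^ 'n, real) germ set"
  assumes L: "ideal L \<E>" and "\<And>f. f \<in> vanishing i \<Longrightarrow> \<exists>l\<in>L. f - l \<in> vanishing (Suc i)"
  shows "vanishing i \<subseteq> L"
proof -
  have mono: "\<forall>l\<in>words i. wmono l \<in> L"
  proof (rule nakayama[OF L finite_words smooth_germs_wmono])
    fix l :: "'n list" assume "l \<in> words i"
    then have "wmono l \<in> (vanishing i :: (real ^ 'n, real) germ set)" using wmono_vanishing[of l] by simp
    then obtain q where q: "q \<in> L" "wmono l - q \<in> vanishing (Suc i)" using assms(2) by blast
    obtain y where y: "\<And>l. y l \<in> smooth_germs" "wmono l - q = (\<Sum>l\<in>words (Suc i). wmono l * y l)"
      using vanishing_hadamard[OF q(2)] by blast
    \<comment> \<open>The first letter of each word of length \<open>i + 1\<close> is moved into the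
      coefficient, which therefore vanishes at the origin.\<close>
    let ?z = "\<lambda>l. \<Sum>j\<in>UNIV. coord j * y (j # l)"
    have "(\<Sum>l\<in>words (Suc i). wmono l * y l) = (\<Sum>l\<in>words i. ?z l * wmono l)"
      unfolding sum_words_Suc by (intro sum.cong) (simp_all add: wmono_def sum_distrib_left sum_distrib_right mult_ac)
    then have "wmono l - (\<Sum>l\<in>words i. ?z l * wmono l) = q" using y(2) by (simp add: algebra_simps)
    moreover have "?z l \<in> vanishing 1" for l
      by (intro vanishing_sum vanishing_mult_smooth coord_vanishing y(1))
    ultimately show "\<exists>z. (\<forall>j\<in>words i. z j \<in> vanishing 1) \<and> wmono l - (\<Sum>j\<in>words i. z j * wmono j) \<in> L"
      using q(1) by (intro exI[of _ ?z]) simp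
  qed
  show ?thesis
  proof
    fix f :: "(real ^ 'n, real) germ" assume "f \<in> vanishing i"
    then obtain y where y: "\<And>l. y l \<in> smooth_germs" "f = (\<Sum>l\<in>words i. wmono l * y l)"
      using vanishing_hadamard by blast
    show "f \<in> L"
      unfolding y(2) using mono y(1) ideal_ED(4)[OF L]
      by (intro ideal_E_sum[OF L]) (metis mult.commute)
  qed
qed

text \<open>Were the inclusion \<open>vanishing i \<subseteq> L + vanishing (i + 1)\<close> to fail for all \<open>i \<le> k\<close>, the \<open>k + 1\<close> witnesses
  would be independent modulo \<open>L + vanishing (k + 1)\<close>. For an \<open>i\<close> where it holds, Nakayama's lemma
  gives \<open>vanishing i \<subseteq> L\<close>.\<close>

lemma spans_modulo_of_truncation:
  fixes L :: "(real ^ 'n, real) germ set"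
  assumes L: "ideal L \<E>" and b: "\<And>i. i < k \<Longrightarrow> b i \<in> smooth_germs"
    and span: "\<And>f. f \<in> smooth_germs \<Longrightarrow> \<exists>c. \<exists>l\<in>L. f - (\<Sum>i<k. const (c i) * b i) - l \<in> vanishing (Suc k)"
  shows "spans_modulo L k b"
proof -
  note LD = ideal_ED[OF L]
  have "\<exists>i\<le>k. \<forall>f\<in>vanishing i. \<exists>l\<in>L. f - l \<in> vanishing (Suc i)"
  proof (rule ccontr)
    assume "\<not> ?thesis"
    then have "\<forall>i. \<exists>f. i \<le> k \<longrightarrow> f \<in> vanishing i \<and> (\<forall>l\<in>L. f - l \<notin> vanishing (Suc i))" by blast
    from choice[OF this] obtain f where f: "\<And>i. i \<le> k \<Longrightarrow> f i \<in> vanishing i"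
      "\<And>i l. i \<le> k \<Longrightarrow> l \<in> L \<Longrightarrow> f i - l \<notin> vanishing (Suc i)" by blast
    have "\<forall>i. \<exists>c. i \<le> k \<longrightarrow> (\<exists>l\<in>L. f i - (\<Sum>j<k. const (c j) * b j) - l \<in> vanishing (Suc k))"
      using span f(1) vanishing_smooth by blast
    from choice[OF this] obtain c where
      "\<And>i. i \<le> k \<Longrightarrow> \<exists>l\<in>L. f i - (\<Sum>j<k. const (c i j) * b j) - l \<in> vanishing (Suc k)" by blast
    then have "\<forall>i. \<exists>l. i \<le> k \<longrightarrow> l \<in> L \<and> f i - (\<Sum>j<k. const (c i j) * b j) - l \<in> vanishing (Suc k)" by blast
    from choice[OF this] obtain l where l: "\<And>i. i \<le> k \<Longrightarrow> l i \<in> L"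
      "\<And>i. i \<le> k \<Longrightarrow> f i - (\<Sum>j<k. const (c i j) * b j) - l i \<in> vanishing (Suc k)" by blast
    obtain d where d: "\<exists>i\<le>k. d i \<noteq> 0" "\<And>j. j < k \<Longrightarrow> (\<Sum>i\<le>k. d i * c i j) = 0"
      using nontrivial_relation[of k c] by blast
    \<comment> \<open>At the least index with \<open>d m \<noteq> 0\<close>, all other terms of the
      relation have order at least \<open>m + 1\<close>. So \<open>f m\<close> agrees with an
      element of \<open>L\<close> up to that order, contrary to its choice.\<close>
    define m where "m = (LEAST i. i \<le> k \<and> d i \<noteq> 0)"
    have m: "m \<le> k" "d m \<noteq> 0" using LeastI_ex[of "\<lambda>i. i \<le> k \<and> d i \<noteq> 0"] d(1) unfolding m_def by auto
    have dm: "d i = 0" if "i < m" for i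
      using not_less_Least[of i "\<lambda>i. i \<le> k \<and> d i \<noteq> 0"] that m(1) unfolding m_def by auto
    let ?r = "\<Sum>i\<le>k. const (d i) * (f i - (\<Sum>j<k. const (c i j) * b j) - l i)"
    let ?l = "\<Sum>i\<le>k. const (d i) * l i"
    have r: "?r \<in> vanishing (Suc k)"
      by (intro vanishing_sum vanishing_smooth_mult[OF smooth_germs_const] l(2)) simp
    have lL: "?l \<in> L"
      by (intro ideal_E_sum[OF L] LD(4)[OF l(1) smooth_germs_const]) simp
    have "(\<Sum>i\<le>k. const (d i) * (\<Sum>j<k. const (c i j) * b j)) = (\<Sum>j<k. const (\<Sum>i\<le>k. d i * c i j) * b j)"
      unfolding const_sum sum_distrib_left sum_distrib_right const_mult mult.assoc by (rule sum.swap)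
    also have "\<dots> = 0" by (intro sum.neutral ballI) (simp add: d(2) const_0)
    finally have "(\<Sum>i\<le>k. const (d i) * f i) = ?r + ?l"
      by (simp add: sum_subtractf right_diff_distrib)
    moreover have "(\<Sum>i\<le>k. const (d i) * f i) = const (d m) * f m + (\<Sum>i\<in>{..k} - {m}. const (d i) * f i)"
      using m(1) by (intro sum.remove) auto
    ultimately have eq: "const (d m) * f m - ?l = ?r - (\<Sum>i\<in>{..k} - {m}. const (d i) * f i)"
      by (simp add: algebra_simps)
    have "(\<Sum>i\<in>{..k} - {m}. const (d i) * f i) \<in> vanishing (Suc m)"
    proof (rule vanishing_sum)
      fix i assume i: "i \<in> {..k} - {m}"
      show "const (d i) * f i \<in> vanishing (Suc m)"
      proof (cases "i < m")
        case True
        then show ?thesis by (simp add: dm const_0 vanishing_0)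
      next
        case False
        then have "vanishing i \<subseteq> (vanishing (Suc m) :: (real ^ 'n, real) germ set)" 
          using i by (intro vanishing_antimono) auto
        then have "f i \<in> vanishing (Suc m)" using f(1)[of i] i by auto
        then show ?thesis by (rule vanishing_smooth_mult[OF smooth_germs_const])
      qed
    qed
    moreover have "?r \<in> vanishing (Suc m)"
      using r vanishing_antimono[of "Suc m" "Suc k"] m(1) by auto
    ultimately have "const (d m) * f m - ?l \<in> vanishing (Suc m)"
      unfolding eq by (intro vanishing_diff)
    then have "const (inverse (d m)) * (const (d m) * f m - ?l) \<in> vanishing (Suc m)"
      by (rule vanishing_smooth_mult[OF smooth_germs_const])
    moreover have "const (inverse (d m)) * (const (d m) * f m - ?l) = f m - const (inverse (d m)) * ?l"
      using m(2) by (simp add: right_diff_distrib mult.assoc[symmetric] const_mult[symmetric] const_1)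
    ultimately show False
      using f(2)[OF m(1) LD(4)[OF lL smooth_germs_const[of "inverse (d m)"]]] by simp
  qed
  then obtain i where i: "i \<le> k" "\<And>f. f \<in> vanishing i \<Longrightarrow> \<exists>l\<in>L. f - l \<in> vanishing (Suc i)" by blast
  from vanishing_subset_ideal[OF L i(2)] have "vanishing i \<subseteq> L" .
  then have sub: "vanishing (Suc k) \<subseteq> L" using vanishing_antimono[of i "Suc k"] i(1) by auto
  have "\<exists>c. f - (\<Sum>i<k. const (c i) * b i) \<in> L" if f: "f \<in> smooth_germs" for f
  proof -
    obtain c l where cl: "l \<in> L" "f - (\<Sum>i<k. const (c i) * b i) - l \<in> vanishing (Suc k)" using span[OF f] by blast
    from LD(3)[OF subsetD[OF sub cl(2)] cl(1)] show ?thesis by (intro exI[of _ c]) simp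
  qed
  then show ?thesis using b unfolding spans_modulo_def by blast
qed

section \<open>Passage between real and complex germs\<close>

lift_definition cplx :: "('a::{topological_space,zero}, real) germ \<Rightarrow> ('a, complex) germ" is "\<lambda>f x. of_real (f x)"
  by (auto simp: eq_near_0_def elim: eventually_mono)

lift_definition re_part :: "('a::{topological_space,zero}, complex) germ \<Rightarrow> ('a, real) germ" is "\<lambda>f x. Re (f x)"
  by (auto simp: eq_near_0_def elim: eventually_mono)

lemma cplx_germ_of: "cplx (germ_of f) = germ_of (\<lambda>x. of_real (f x))"
  by (rule cplx.abs_eq)

lemma re_part_germ_of: "re_part (germ_of f) = germ_of (\<lambda>x. Re (f x))"
  by (rule re_part.abs_eq)

lemma cplx_add: "cplx (F + G) = cplx F + cplx G"
  by (rule germ_cases[of F], rule germ_cases[of G]) (simp add: germ_of_add cplx_germ_of)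

lemma cplx_mult: "cplx (F * G) = cplx F * cplx G"
  by (rule germ_cases[of F], rule germ_cases[of G]) (simp add: germ_of_mult cplx_germ_of)

lemma cplx_0: "cplx 0 = 0" and cplx_1: "cplx 1 = 1"
  by (simp_all add: germ_of_0[symmetric] germ_of_1[symmetric] cplx_germ_of)

lemma cplx_sum: "cplx (\<Sum>i\<in>I. F i) = (\<Sum>i\<in>I. cplx (F i))"
  by (induction I rule: infinite_finite_induct) (auto simp: cplx_0 cplx_add)

lemma cplx_wmono: "cplx (wmono l) = wmono l"
  by (induction l) (simp_all add: wmono_def cplx_1 cplx_mult coord_def cplx_germ_of)

lemma cplx_smooth: "F \<in> smooth_germs \<Longrightarrow> cplx F \<in> smooth_germs"
  by (erule smooth_germsE)
    (simp add: cplx_germ_of germ_of_in_smooth_germs_iff smooth_near_0_bounded_linear_comp[OF bounded_linear_of_real])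

lemma cplx_germ_comp:
  assumes "H \<in> smooth_germs_fix_0"
  shows "cplx (germ_comp F H) = germ_comp (cplx F) H"
  by (rule smooth_germs_fix_0E[OF assms], rule germ_cases[of F]) (simp add: germ_comp_germ_of cplx_germ_of)

lemma re_part_diff: "re_part (F - G) = re_part F - re_part G"
  by (rule germ_cases[of F], rule germ_cases[of G]) (simp add: germ_of_minus re_part_germ_of)

lemma re_part_add: "re_part (F + G) = re_part F + re_part G"
  by (rule germ_cases[of F], rule germ_cases[of G]) (simp add: germ_of_add re_part_germ_of)

lemma re_part_0: "re_part 0 = 0"
  by (simp add: germ_of_0[symmetric] re_part_germ_of)

lemma re_part_sum: "re_part (\<Sum>i\<in>I. F i) = (\<Sum>i\<in>I. re_part (F i))"
  by (induction I rule: infinite_finite_induct) (auto simp: re_part_0 re_part_add)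

lemma re_part_const_mult_cplx: "re_part (const c * cplx F) = const (Re c) * F"
  by (rule germ_cases[of F]) (simp add: const_def cplx_germ_of germ_of_mult re_part_germ_of)

lemma re_part_cplx: "re_part (cplx F) = F"
  by (rule germ_cases[of F]) (simp add: cplx_germ_of re_part_germ_of)

lemma re_part_vanishing: "F \<in> vanishing k \<Longrightarrow> re_part F \<in> vanishing k"
proof (erule vanishingE)
  fix f C assume f: "F = germ_of f" "smooth_near_0 f" "\<forall>\<^sub>F x in nhds 0. norm (f x) \<le> C * norm x ^ k"
  from f(3) have "\<forall>\<^sub>F x in nhds 0. norm (Re (f x)) \<le> C * norm x ^ k"
    by eventually_elim (metis abs_Re_le_cmod order_trans real_norm_def)
  then show ?thesis
    unfolding f(1) re_part_germ_of
    by (intro vanishingI smooth_near_0_bounded_linear_comp[OF bounded_linear_Re f(2)])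
qed

definition spanning_words :: "nat \<Rightarrow> 'n::finite list set \<Rightarrow> bool" where
  "spanning_words k B \<longleftrightarrow> finite B \<and> (\<forall>F\<in>(smooth_germs :: (real ^ 'n, complex) germ set).
    \<exists>c. F - (\<Sum>l\<in>B. const (c l) * wmono l) \<in> vanishing k)"

text \<open>A spanning set of words of least cardinality is free of redundancy: a nontrivial
  relation would express one of its words by the others, and that word could be dropped.\<close>

lemma independent_spanning_words:
  "\<exists>B :: 'n::finite list set. spanning_words k B \<and>
    (\<forall>c. (\<Sum>l\<in>B. const (c l) * wmono l) \<in> (vanishing k :: (real ^ 'n, complex) germ set) \<longrightarrow> (\<forall>l\<in>B. c l = 0))"
proof -
  have "spanning_words k (short_words k :: 'n list set)"
    unfolding spanning_words_def
  proof (intro conjI finite_short_words ballI)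
    fix F :: "(real ^ 'n, complex) germ" assume "F \<in> smooth_germs"
    then obtain c y where y: "\<And>l. y l \<in> smooth_germs"
      "F = (\<Sum>l\<in>short_words k. const (c l) * wmono l) + (\<Sum>l\<in>words k. wmono l * y l)"
      using smooth_germ_taylor by blast
    have "(\<Sum>l\<in>words k. wmono l * y l) \<in> vanishing k"
      using vanishing_mult_smooth[OF wmono_vanishing y(1)] by (intro vanishing_sum) force
    then show "\<exists>c. F - (\<Sum>l\<in>short_words k. const (c l) * wmono l) \<in> vanishing k"
      using y(2) by (intro exI[of _ c]) simp
  qed
  from ex_has_least_nat[of "spanning_words k", OF this, of card]
  obtain B :: "'n list set" where B: "spanning_words k B" "\<And>B' :: 'n list set. spanning_words k B' \<Longrightarrow> card B \<le> card B'" by blast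
  have fin: "finite B" using B(1) by (simp add: spanning_words_def)
  have "\<forall>l\<in>B. c l = 0" if c: "(\<Sum>l\<in>B. const (c l) * wmono l) \<in> (vanishing k :: (real ^ 'n, complex) germ set)" for c
  proof (rule ccontr)
    assume "\<not> ?thesis"
    then obtain p where p: "p \<in> B" "c p \<noteq> 0" by blast
    have "spanning_words k (B - {p})"
      unfolding spanning_words_def
    proof (intro conjI ballI)
      fix F :: "(real ^ 'n, complex) germ" assume "F \<in> smooth_germs"
      then obtain a where a: "F - (\<Sum>l\<in>B. const (a l) * wmono l) \<in> vanishing k"
        using B(1) unfolding spanning_words_def by blast
      let ?a = "\<lambda>l. a l - a p / c p * c l"
      have "(F - (\<Sum>l\<in>B. const (a l) * wmono l)) + const (a p / c p) * (\<Sum>l\<in>B. const (c l) * wmono l) \<in> vanishing k"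
        by (intro vanishing_add a vanishing_smooth_mult[OF smooth_germs_const] c)
      also have "(F - (\<Sum>l\<in>B. const (a l) * wmono l)) + const (a p / c p) * (\<Sum>l\<in>B. const (c l) * wmono l) =
          F - (\<Sum>l\<in>B. const (?a l) * wmono l)"
        unfolding const_minus const_mult[of "a p / c p"] left_diff_distrib sum_subtractf sum_distrib_left mult.assoc
        by simp
      also have "(\<Sum>l\<in>B. const (?a l) * wmono l) = (\<Sum>l\<in>B - {p}. const (?a l) * wmono l :: (real ^ 'n, complex) germ)"
        using p fin by (subst sum.remove[of B p]) (simp_all add: const_0)
      finally show "\<exists>c. F - (\<Sum>l\<in>B - {p}. const (c l) * wmono l) \<in> vanishing k"
        by (intro exI[of _ ?a])
    qed (use fin in simp)
    from B(2)[OF this] show False using p(1) fin card_Diff1_less[of B p] by auto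
  qed
  then show ?thesis using B(1) by blast
qed

text \<open>\<open>D\<close> is the product of the pivots of a division-free Gaussian elimination, which are all \<open>1\<close> at \<open>g\<close>.\<close>

lemma elimination:
  fixes A :: "'i \<Rightarrow> 'i \<Rightarrow> 'w \<Rightarrow> complex"
  assumes "finite B" "\<And>i j. i \<in> B \<Longrightarrow> j \<in> B \<Longrightarrow> A i j \<in> fun_alg \<Gamma>"
    and "\<And>i j. i \<in> B \<Longrightarrow> j \<in> B \<Longrightarrow> A i j g = (if i = j then 1 else 0)"
  shows "\<exists>D\<in>fun_alg \<Gamma>. D g \<noteq> 0 \<and>
    (\<forall>h. D h \<noteq> 0 \<longrightarrow> (\<forall>j\<in>B. \<exists>\<beta>. \<forall>l\<in>B. (\<Sum>i\<in>B. \<beta> i * A i l h) = (if l = j then 1 else 0)))"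
  using assms
proof (induction B arbitrary: A)
  case empty
  show ?case by (intro bexI[of _ "\<lambda>_. 1"]) (auto intro: fun_alg_const)
next
  case (insert p B)
  \<comment> \<open>Elimination of column \<open>p\<close>, multiplied by the pivot so that no
    division leads out of the algebra. At \<open>g\<close> the reduced matrix is again the
    identity.\<close>
  let ?A = "\<lambda>i j h. A p p h * A i j h + (- 1) * (A i p h * A p j h)"
  have pB: "p \<notin> B" "finite B" by fact+
  have "\<exists>D\<in>fun_alg \<Gamma>. D g \<noteq> 0 \<and>
    (\<forall>h. D h \<noteq> 0 \<longrightarrow> (\<forall>j\<in>B. \<exists>\<beta>. \<forall>l\<in>B. (\<Sum>i\<in>B. \<beta> i * ?A i l h) = (if l = j then 1 else 0)))"
  proof (rule insert.IH)
    show "?A i j \<in> fun_alg \<Gamma>" if "i \<in> B" "j \<in> B" for i j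
      using that by (intro fun_alg_add fun_alg_mult fun_alg_const insert.prems(1)) auto
    show "?A i j g = (if i = j then 1 else 0)" if "i \<in> B" "j \<in> B" for i j
      using that pB(1) by (auto simp: insert.prems(2))
  qed
  then obtain D where D: "D \<in> fun_alg \<Gamma>" "D g \<noteq> 0"
    "\<And>h j. D h \<noteq> 0 \<Longrightarrow> j \<in> B \<Longrightarrow> \<exists>\<beta>. \<forall>l\<in>B. (\<Sum>i\<in>B. \<beta> i * ?A i l h) = (if l = j then 1 else 0)" by blast
  show ?case
  proof (intro bexI[of _ "\<lambda>h. D h * A p p h"] conjI allI impI)
    show "(\<lambda>h. D h * A p p h) \<in> fun_alg \<Gamma>" by (intro fun_alg_mult D(1) insert.prems(1)) auto
    show "D g * A p p g \<noteq> 0" using D(2) by (simp add: insert.prems(2))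
    fix h assume h: "D h * A p p h \<noteq> 0"
    define rows where "rows = {v. \<exists>\<beta>. \<forall>l\<in>insert p B. (\<Sum>i\<in>insert p B. \<beta> i * A i l h) = v l}"
    have rowsI: "v \<in> rows" if "\<And>l. l \<in> insert p B \<Longrightarrow> (\<Sum>i\<in>insert p B. \<beta> i * A i l h) = v l" for \<beta> v
      using that unfolding rows_def by blast
    have B: "(\<lambda>l. if l = j then 1 else 0) \<in> rows" if j: "j \<in> B" for j
    proof -
      obtain \<beta> where \<beta>: "\<And>l. l \<in> B \<Longrightarrow> (\<Sum>i\<in>B. \<beta> i * ?A i l h) = (if l = j then 1 else 0)"
        using D(3)[OF _ j, of h] h by auto
      \<comment> \<open>This turns a combination of reduced rows into a combination of the original
        rows, row \<open>p\<close> receiving the total of the subtracted multiples.\<close>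
      define \<gamma> where "\<gamma> i = (if i = p then - (\<Sum>i\<in>B. \<beta> i * A i p h) else \<beta> i * A p p h)" for i
      have "(\<Sum>i\<in>insert p B. \<gamma> i * A i l h) = (\<Sum>i\<in>B. \<beta> i * ?A i l h)" for l
      proof -
        have "(\<Sum>i\<in>insert p B. \<gamma> i * A i l h) = \<gamma> p * A p l h + (\<Sum>i\<in>B. \<gamma> i * A i l h)"
          using pB by simp
        also have "(\<Sum>i\<in>B. \<gamma> i * A i l h) = (\<Sum>i\<in>B. \<beta> i * A p p h * A i l h)"
          using pB(1) by (intro sum.cong) (auto simp: \<gamma>_def)
        finally have eq: "(\<Sum>i\<in>insert p B. \<gamma> i * A i l h) =
            \<gamma> p * A p l h + (\<Sum>i\<in>B. \<beta> i * A p p h * A i l h)" .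
        have \<gamma>p: "\<gamma> p * A p l h = (\<Sum>i\<in>B. \<beta> i * ((- 1) * (A i p h * A p l h)))"
          by (simp add: \<gamma>_def sum_distrib_right sum_negf mult.assoc)
        show ?thesis
          unfolding eq \<gamma>p sum.distrib[symmetric] by (intro sum.cong) (simp_all add: algebra_simps)
      qed
      note sum_\<gamma> = this
      show ?thesis
      proof (rule rowsI[of \<gamma>])
        fix l assume l: "l \<in> insert p B"
        show "(\<Sum>i\<in>insert p B. \<gamma> i * A i l h) = (if l = j then 1 else 0)"
        proof (cases "l = p")
          case True
          \<comment> \<open>The reduced entries in column \<open>p\<close> are zero identically, by
            construction of \<open>?A\<close>.\<close>
          then show ?thesis unfolding sum_\<gamma> using j pB(1) by auto
        next
          case False
          then show ?thesis unfolding sum_\<gamma> using \<beta> l by auto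
        qed
      qed
    qed
    have "\<forall>j\<in>B. \<exists>\<beta>. \<forall>l\<in>insert p B. (\<Sum>i\<in>insert p B. \<beta> i * A i l h) = (if l = j then 1 else 0)"
    proof
      fix j assume "j \<in> B"
      from B[OF this] show "\<exists>\<beta>. \<forall>l\<in>insert p B. (\<Sum>i\<in>insert p B. \<beta> i * A i l h) = (if l = j then 1 else 0)"
        unfolding rows_def by (rule CollectD)
    qed
    from bchoice[OF this] obtain \<beta> where \<beta>: "\<And>j l. j \<in> B \<Longrightarrow> l \<in> insert p B \<Longrightarrow>
        (\<Sum>i\<in>insert p B. \<beta> j i * A i l h) = (if l = j then 1 else 0)" by blast
    \<comment> \<open>The unit row at \<open>p\<close> is row \<open>p\<close> less its entries in
      \<open>B\<close> times the unit rows already obtained, divided by the pivot.\<close>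
    have "(\<lambda>l. if l = p then 1 else 0) \<in> rows"
    proof (rule rowsI[of "\<lambda>i. ((if i = p then 1 else 0) - (\<Sum>j\<in>B. A p j h * \<beta> j i)) / A p p h"])
      fix l assume l: "l \<in> insert p B"
      have "(\<Sum>i\<in>insert p B. (\<Sum>j\<in>B. A p j h * \<beta> j i) * A i l h) = (\<Sum>j\<in>B. A p j h * (\<Sum>i\<in>insert p B. \<beta> j i * A i l h))"
        unfolding sum_distrib_left sum_distrib_right mult.assoc by (rule sum.swap)
      also have "\<dots> = (\<Sum>j\<in>B. A p j h * (if l = j then 1 else 0))"
        by (intro sum.cong arg_cong[where f = "\<lambda>x. _ * x"] \<beta> l refl)
      also have "\<dots> = (if l \<in> B then A p l h else 0)"
        using pB(2) by (simp add: if_distrib cong: if_cong)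
      finally have 1: "(\<Sum>i\<in>insert p B. (\<Sum>j\<in>B. A p j h * \<beta> j i) * A i l h) = (if l \<in> B then A p l h else 0)" .
      have 2: "(\<Sum>i\<in>insert p B. (if i = p then 1 else 0) * A i l h) = A p l h"
        using pB by (simp add: if_distrib[of "\<lambda>x. x * _"] cong: if_cong)
      have "(\<Sum>i\<in>insert p B. ((if i = p then 1 else 0) - (\<Sum>j\<in>B. A p j h * \<beta> j i)) / A p p h * A i l h) =
        ((\<Sum>i\<in>insert p B. (if i = p then 1 else 0) * A i l h) - (\<Sum>i\<in>insert p B. (\<Sum>j\<in>B. A p j h * \<beta> j i) * A i l h)) / A p p h"
        unfolding sum_subtractf[symmetric] sum_divide_distrib by (intro sum.cong) (auto simp: field_simps)
      also have "\<dots> = (if l = p then 1 else 0)"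
        unfolding 1 2 using l h pB(1) by auto
      finally show "(\<Sum>i\<in>insert p B. ((if i = p then 1 else 0) - (\<Sum>j\<in>B. A p j h * \<beta> j i)) / A p p h * A i l h) =
        (if l = p then 1 else 0)" .
    qed
    then show "\<forall>j\<in>insert p B. \<exists>\<beta>. \<forall>l\<in>insert p B. (\<Sum>i\<in>insert p B. \<beta> i * A i l h) = (if l = j then 1 else 0)"
      using B unfolding rows_def by blast
  qed
qed

section \<open>Generators of ideals and of their pullbacks\<close>

lemma smooth_ideal_generators:
  fixes S :: "(real ^ 'n, real) germ set"
  assumes S: "finite S" "S \<subseteq> smooth_germs"
  shows "ideal (Idl\<^bsub>\<E>\<^esub> S) \<E>" "S \<subseteq> Idl\<^bsub>\<E>\<^esub> S"
    and "x \<in> Idl\<^bsub>\<E>\<^esub> S \<Longrightarrow> \<exists>a. (\<forall>s. a s \<in> smooth_germs) \<and> x = (\<Sum>s\<in>S. a s * s)"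
proof -
  show "ideal (Idl\<^bsub>\<E>\<^esub> S) \<E>" by (rule ring.genideal_ideal[OF ring_E]) (use S in simp)
  show "S \<subseteq> Idl\<^bsub>\<E>\<^esub> S" by (rule ring.genideal_self[OF ring_E]) (use S in simp)
  let ?C = "{x. \<exists>a. (\<forall>s. a s \<in> smooth_germs) \<and> x = (\<Sum>s\<in>S. a s * s)}"
  have "ideal ?C \<E>"
  proof (rule ideal_EI)
    show "?C \<subseteq> smooth_germs" using S(2) by (auto intro!: smooth_germs_sum smooth_germs_mult)
    show "0 \<in> ?C" by (intro CollectI exI[of _ "\<lambda>_. 0"]) (simp add: smooth_germs_0)
  next
    fix x y assume "x \<in> ?C" "y \<in> ?C"
    then obtain a b where "\<forall>s. a s \<in> smooth_germs" "x = (\<Sum>s\<in>S. a s * s)"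
      "\<forall>s. b s \<in> smooth_germs" "y = (\<Sum>s\<in>S. b s * s)" by auto
    then show "x + y \<in> ?C"
      by (intro CollectI exI[of _ "\<lambda>s. a s + b s"]) (simp add: smooth_germs_add sum.distrib distrib_right)
  next
    fix x c :: "(real ^ 'n, real) germ" assume "x \<in> ?C" "c \<in> smooth_germs"
    then obtain a where "\<forall>s. a s \<in> smooth_germs" "x = (\<Sum>s\<in>S. a s * s)" by auto
    then show "c * x \<in> ?C" using \<open>c \<in> smooth_germs\<close>
      by (intro CollectI exI[of _ "\<lambda>s. c * a s"]) (simp add: smooth_germs_mult sum_distrib_left mult.assoc)
  qed
  moreover have "S \<subseteq> ?C"
  proof
    fix t assume t: "t \<in> S"
    have "t = (\<Sum>s\<in>S. (if s = t then 1 else 0) * s)"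
      using S(1) t by (simp add: if_distrib[of "\<lambda>x. x * _"] cong: if_cong)
    then show "t \<in> ?C"
      by (intro CollectI exI[of _ "\<lambda>s. if s = t then 1 else 0"]) (simp add: smooth_germs_0 smooth_germs_1)
  qed
  ultimately have "Idl\<^bsub>\<E>\<^esub> S \<subseteq> ?C" by (rule ring.genideal_minimal[OF ring_E])
  then show "x \<in> Idl\<^bsub>\<E>\<^esub> S \<Longrightarrow> \<exists>a. (\<forall>s. a s \<in> smooth_germs) \<and> x = (\<Sum>s\<in>S. a s * s)" by blast
qed

text \<open>Pulling back a combination of generators also pulls back its coefficients, which stay
  smooth; so the sum ideal is generated by \<open>T\<close> and the germs
  \<open>germ_comp s g\<close>. Only these finitely many germs depend on \<open>g\<close>.\<close>

lemma pullback_ideal_generators: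
  fixes S T :: "(real ^ 'n, real) germ set"
  assumes S: "finite S" "S \<subseteq> smooth_germs" and T: "finite T" "T \<subseteq> smooth_germs"
    and g: "g \<in> smooth_germs_fix_0"
  defines "P \<equiv> pullback g (Idl\<^bsub>\<E>\<^esub> S)" and "J \<equiv> Idl\<^bsub>\<E>\<^esub> T"
  shows "P \<subseteq> smooth_germs" "J \<subseteq> smooth_germs"
    and "(\<And>s. a s \<in> smooth_germs) \<Longrightarrow> (\<And>t. b t \<in> smooth_germs) \<Longrightarrow>
      (\<Sum>s\<in>S. a s * germ_comp s g) + (\<Sum>t\<in>T. b t * t) \<in> Idl\<^bsub>\<E>\<^esub> (P \<union> J)"
    and "x \<in> Idl\<^bsub>\<E>\<^esub> (P \<union> J) \<Longrightarrow> \<exists>a b. (\<forall>s. a s \<in> smooth_germs) \<and> (\<forall>t. b t \<in> smooth_germs) \<and>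
      x = (\<Sum>s\<in>S. a s * germ_comp s g) + (\<Sum>t\<in>T. b t * t)"
proof -
  note IS = smooth_ideal_generators[OF S] and IT = smooth_ideal_generators[OF T]
  have comp_smooth: "germ_comp s g \<in> smooth_germs" if "s \<in> smooth_germs" for s :: "(real ^ 'n, real) germ"
    using germ_comp_smooth[OF g that] .
  show P: "P \<subseteq> smooth_germs"
    unfolding P_def pullback_def using ideal_ED(1)[OF IS(1)] comp_smooth by auto
  show J: "J \<subseteq> smooth_germs" unfolding J_def by (rule ideal_ED(1)[OF IT(1)])
  have L: "ideal (Idl\<^bsub>\<E>\<^esub> (P \<union> J)) \<E>" by (rule ring.genideal_ideal[OF ring_E]) (use P J in simp)
  have PJ: "P \<union> J \<subseteq> Idl\<^bsub>\<E>\<^esub> (P \<union> J)" by (rule ring.genideal_self[OF ring_E]) (use P J in simp)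
  show "(\<Sum>s\<in>S. a s * germ_comp s g) + (\<Sum>t\<in>T. b t * t) \<in> Idl\<^bsub>\<E>\<^esub> (P \<union> J)"
    if "\<And>s. a s \<in> smooth_germs" "\<And>t. b t \<in> smooth_germs" for a b
  proof (intro ideal_ED(3)[OF L] ideal_E_sum[OF L] ideal_ED(4)[OF L] that)
    fix s assume "s \<in> S"
    then have "germ_comp s g \<in> P" unfolding P_def pullback_def using IS(2) by blast
    then show "germ_comp s g \<in> Idl\<^bsub>\<E>\<^esub> (P \<union> J)" using PJ by blast
  next
    fix t assume "t \<in> T"
    then have "t \<in> J" unfolding J_def using IT(2) by blast
    then show "t \<in> Idl\<^bsub>\<E>\<^esub> (P \<union> J)" using PJ by blast
  qed
  let ?C = "{x. \<exists>a b. (\<forall>s. a s \<in> smooth_germs) \<and> (\<forall>t. b t \<in> smooth_germs) \<and>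
      x = (\<Sum>s\<in>S. a s * germ_comp s g) + (\<Sum>t\<in>T. b t * t)}"
  have CI: "(\<Sum>s\<in>S. a s * germ_comp s g) + (\<Sum>t\<in>T. b t * t) \<in> ?C"
    if "\<And>s. a s \<in> smooth_germs" "\<And>t. b t \<in> smooth_germs" for a b
    using that by blast
  have "ideal ?C \<E>"
  proof (rule ideal_EI)
    show "?C \<subseteq> smooth_germs"
    proof
      fix x assume "x \<in> ?C"
      then obtain a b where "\<forall>s. a s \<in> smooth_germs" "\<forall>t. b t \<in> smooth_germs"
        "x = (\<Sum>s\<in>S. a s * germ_comp s g) + (\<Sum>t\<in>T. b t * t)" by blast
      then show "x \<in> smooth_germs"
        using S(2) T(2) comp_smooth by (auto intro!: smooth_germs_add smooth_germs_sum smooth_germs_mult)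
    qed
    show "0 \<in> ?C" using CI[of "\<lambda>_. 0" "\<lambda>_. 0"] by (simp add: smooth_germs_0)
  next
    fix x y assume "x \<in> ?C" "y \<in> ?C"
    then obtain a b a' b' where *: "\<And>s. a s \<in> smooth_germs" "\<And>t. b t \<in> smooth_germs"
      "x = (\<Sum>s\<in>S. a s * germ_comp s g) + (\<Sum>t\<in>T. b t * t)"
      "\<And>s. a' s \<in> smooth_germs" "\<And>t. b' t \<in> smooth_germs"
      "y = (\<Sum>s\<in>S. a' s * germ_comp s g) + (\<Sum>t\<in>T. b' t * t)" by blast
    have "x + y = (\<Sum>s\<in>S. (a s + a' s) * germ_comp s g) + (\<Sum>t\<in>T. (b t + b' t) * t)"
      unfolding *(3,6) distrib_right sum.distrib by (simp add: ac_simps)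
    also have "\<dots> \<in> ?C" using * by (intro CI smooth_germs_add)
    finally show "x + y \<in> ?C" .
  next
    fix x c :: "(real ^ 'n, real) germ" assume "x \<in> ?C" and c: "c \<in> smooth_germs"
    then obtain a b where *: "\<And>s. a s \<in> smooth_germs" "\<And>t. b t \<in> smooth_germs"
      "x = (\<Sum>s\<in>S. a s * germ_comp s g) + (\<Sum>t\<in>T. b t * t)" by blast
    have "c * x = (\<Sum>s\<in>S. (c * a s) * germ_comp s g) + (\<Sum>t\<in>T. (c * b t) * t)"
      unfolding *(3) distrib_left sum_distrib_left mult.assoc ..
    also have "\<dots> \<in> ?C" using * c by (intro CI smooth_germs_mult)
    finally show "c * x \<in> ?C" .
  qed
  moreover have "P \<union> J \<subseteq> ?C"
  proof
    fix x assume "x \<in> P \<union> J"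
    then show "x \<in> ?C"
    proof
      assume "x \<in> P"
      then obtain y where y: "y \<in> Idl\<^bsub>\<E>\<^esub> S" "x = germ_comp y g" unfolding P_def pullback_def by blast
      obtain a where a: "\<And>s. a s \<in> smooth_germs" "y = (\<Sum>s\<in>S. a s * s)" using IS(3)[OF y(1)] by blast
      have "germ_comp (\<Sum>s\<in>S'. a s * s) g = (\<Sum>s\<in>S'. germ_comp (a s) g * germ_comp s g)" for S'
        by (induction S' rule: infinite_finite_induct)
          (simp_all add: germ_comp_0[OF g] germ_comp_add[OF g] germ_comp_mult[OF g])
      then have "x = (\<Sum>s\<in>S. germ_comp (a s) g * germ_comp s g) + (\<Sum>t\<in>T. 0 * t)" using y(2) a(2) by simp
      also have "\<dots> \<in> ?C" using a(1) by (intro CI comp_smooth smooth_germs_0)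
      finally show ?thesis .
    next
      assume "x \<in> J"
      then obtain b where b: "\<And>t. b t \<in> smooth_germs" "x = (\<Sum>t\<in>T. b t * t)" using IT(3) unfolding J_def by blast
      have "x = (\<Sum>s\<in>S. 0 * germ_comp s g) + (\<Sum>t\<in>T. b t * t)" using b(2) by simp
      also have "\<dots> \<in> ?C" using b(1) by (intro CI smooth_germs_0)
      finally show ?thesis .
    qed
  qed
  ultimately have "Idl\<^bsub>\<E>\<^esub> (P \<union> J) \<subseteq> ?C" by (rule ring.genideal_minimal[OF ring_E])
  then show "x \<in> Idl\<^bsub>\<E>\<^esub> (P \<union> J) \<Longrightarrow> \<exists>a b. (\<forall>s. a s \<in> smooth_germs) \<and> (\<forall>t. b t \<in> smooth_germs) \<and>
      x = (\<Sum>s\<in>S. a s * germ_comp s g) + (\<Sum>t\<in>T. b t * t)" by blast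
qed

lemma families_smooth_mult:
  assumes "\<phi> \<in> families A" "F \<in> smooth_germs"
  shows "(\<lambda>w. F * \<phi> w) \<in> families A"
  using assms(1)
proof (induction rule: families.induct)
  case (families_step \<phi> u p)
  then have "(\<lambda>w. F * \<phi> w + const (u w) * (F * p)) \<in> families A"
    using assms(2) by (intro families.families_step smooth_germs_mult)
  then show ?case by (simp add: algebra_simps)
qed (simp add: families_0)

lemma families_sum:
  "(\<And>i. i \<in> I \<Longrightarrow> \<phi> i \<in> families A) \<Longrightarrow> (\<lambda>w. \<Sum>i\<in>I. \<phi> i w) \<in> families A"
  by (induction I rule: infinite_finite_induct) (auto intro: families_0 families_add)

lemma families_coefficients:
  fixes \<phi> :: "'w \<Rightarrow> (real ^ 'n, complex) germ" and B :: "'n list set"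
  assumes "\<phi> \<in> families (fun_alg \<Gamma>)" "spanning_words k B"
  shows "\<exists>A. (\<forall>l. A l \<in> fun_alg \<Gamma>) \<and> (\<forall>h. \<phi> h - (\<Sum>l\<in>B. const (A l h) * wmono l) \<in> vanishing k)"
  using assms(1)
proof (induction rule: families.induct)
  case families_0
  show ?case by (intro exI[of _ "\<lambda>_ _. 0"]) (simp add: fun_alg_const const_0 vanishing_0)
next
  case (families_step \<phi> u p)
  then obtain A where A: "\<And>l. A l \<in> fun_alg \<Gamma>" "\<And>h. \<phi> h - (\<Sum>l\<in>B. const (A l h) * wmono l) \<in> vanishing k" by blast
  obtain c where c: "p - (\<Sum>l\<in>B. const (c l) * wmono l) \<in> vanishing k"
    using assms(2) families_step(3) unfolding spanning_words_def by blast
  have "\<phi> h + const (u h) * p - (\<Sum>l\<in>B. const (A l h + u h * c l) * wmono l) \<in> vanishing k" for h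
  proof -
    have "\<phi> h + const (u h) * p - (\<Sum>l\<in>B. const (A l h + u h * c l) * wmono l) =
        (\<phi> h - (\<Sum>l\<in>B. const (A l h) * wmono l)) + const (u h) * (p - (\<Sum>l\<in>B. const (c l) * wmono l))"
      by (simp add: const_add const_mult distrib_right sum.distrib right_diff_distrib sum_distrib_left mult.assoc)
    also have "\<dots> \<in> vanishing k"
      by (intro vanishing_add A(2) vanishing_smooth_mult[OF smooth_germs_const c])
    finally show ?thesis .
  qed
  moreover have "(\<lambda>h. A l h + u h * c l) \<in> fun_alg \<Gamma>" for l
    by (intro fun_alg_add fun_alg_mult fun_alg_const A(1) families_step(2))
  ultimately show ?case by (intro exI[of _ "\<lambda>l h. A l h + u h * c l"]) simp
qed

text \<open>At \<open>g\<close> every monomial \<open>wmono l\<close> is a combination \<open>\<rho> l g\<close> of \<open>k\<close> fixed germs and of elements of the ideal.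
  Freezing the coefficients defines \<open>\<rho> l h\<close> for all \<open>h\<close>; as long as \<open>D h \<noteq> 0\<close>, these germs still span
  modulo \<open>vanishing (k + 1)\<close>.\<close>

lemma finite_multiplicity_open:
  fixes S T :: "(real ^ 'n, real) germ set" and G :: "(real ^ 'n, real ^ 'n) germ set"
  assumes S: "finite S" "S \<subseteq> smooth_germs" and T: "finite T" "T \<subseteq> smooth_germs"
    and G: "G \<subseteq> smooth_germs_fix_0"
    and \<Gamma>: "\<And>F k. F \<in> smooth_germs \<Longrightarrow> \<exists>\<phi>\<in>families (fun_alg \<Gamma>). \<forall>h\<in>G. germ_comp F h - \<phi> h \<in> vanishing k"
    and g: "g \<in> G" "intersection_multiplicity (pullback g (Idl\<^bsub>\<E>\<^esub> S)) (Idl\<^bsub>\<E>\<^esub> T) < \<infinity>"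
  shows "\<exists>D k. D \<in> fun_alg \<Gamma> \<and> D g \<noteq> 0 \<and>
    (\<forall>h\<in>G. D h \<noteq> 0 \<longrightarrow> intersection_multiplicity (pullback h (Idl\<^bsub>\<E>\<^esub> S)) (Idl\<^bsub>\<E>\<^esub> T) \<le> enat k)"
proof -
  have fix_0: "h \<in> smooth_germs_fix_0" if "h \<in> G" for h using G that by blast
  let ?L = "\<lambda>h. Idl\<^bsub>\<E>\<^esub> (pullback h (Idl\<^bsub>\<E>\<^esub> S) \<union> Idl\<^bsub>\<E>\<^esub> T)"
  note gens = pullback_ideal_generators[OF S T]
  have gP: "pullback h (Idl\<^bsub>\<E>\<^esub> S) \<subseteq> smooth_germs" "Idl\<^bsub>\<E>\<^esub> T \<subseteq> smooth_germs" if "h \<in> G" for h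
    using gens(1,2)[OF fix_0[OF that]] by blast+
  obtain k b where kb: "spans_modulo (?L g) k b"
    using intersection_multiplicity_finite[OF g(2) gP[OF g(1)]] by blast
  have b: "b i \<in> smooth_germs" if "i < k" for i using kb that unfolding spans_modulo_def by blast
  \<comment> \<open>For \<open>k\<close> spanning germs, \<open>spans_modulo_of_truncation\<close>
    works at order \<open>k + 1\<close>. Independence of the words will identify the coefficient
    matrix at \<open>g\<close>.\<close>
  obtain B :: "'n list set" where B: "spanning_words (Suc k) B"
    "\<And>c l. (\<Sum>l\<in>B. const (c l) * wmono l) \<in> (vanishing (Suc k) :: (real ^ 'n, complex) germ set) \<Longrightarrow> l \<in> B \<Longrightarrow> c l = 0"
    using independent_spanning_words by metis
  have finB: "finite B" using B(1) by (simp add: spanning_words_def)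
  have "\<forall>l. \<exists>c a a'. (\<forall>s. a s \<in> smooth_germs) \<and> (\<forall>t. a' t \<in> smooth_germs) \<and>
      wmono l = (\<Sum>i<k. const (c i) * b i) + ((\<Sum>s\<in>S. a s * germ_comp s g) + (\<Sum>t\<in>T. a' t * t))"
  proof
    fix l :: "'n list"
    obtain c where c: "wmono l - (\<Sum>i<k. const (c i) * b i) \<in> ?L g"
      using kb smooth_germs_wmono unfolding spans_modulo_def by blast
    obtain a a' where *: "\<forall>s. a s \<in> smooth_germs" "\<forall>t. a' t \<in> smooth_germs"
      "wmono l - (\<Sum>i<k. const (c i) * b i) = (\<Sum>s\<in>S. a s * germ_comp s g) + (\<Sum>t\<in>T. a' t * t)"
      using gens(4)[OF fix_0[OF g(1)] c] by blast
    have "wmono l = (\<Sum>i<k. const (c i) * b i) + ((\<Sum>s\<in>S. a s * germ_comp s g) + (\<Sum>t\<in>T. a' t * t))"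
      unfolding *(3)[symmetric] by simp
    with *(1,2) show "\<exists>c a a'. (\<forall>s. a s \<in> smooth_germs) \<and> (\<forall>t. a' t \<in> smooth_germs) \<and>
      wmono l = (\<Sum>i<k. const (c i) * b i) + ((\<Sum>s\<in>S. a s * germ_comp s g) + (\<Sum>t\<in>T. a' t * t))" by blast
  qed
  from choice[OF this] obtain c where "\<forall>l. \<exists>a a'. (\<forall>s. a s \<in> smooth_germs) \<and> (\<forall>t. a' t \<in> smooth_germs) \<and>
      wmono l = (\<Sum>i<k. const (c l i) * b i) + ((\<Sum>s\<in>S. a s * germ_comp s g) + (\<Sum>t\<in>T. a' t * t))" ..
  from choice[OF this] obtain a where "\<forall>l. \<exists>a'. (\<forall>s. a l s \<in> smooth_germs) \<and> (\<forall>t. a' t \<in> smooth_germs) \<and>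
      wmono l = (\<Sum>i<k. const (c l i) * b i) + ((\<Sum>s\<in>S. a l s * germ_comp s g) + (\<Sum>t\<in>T. a' t * t))" ..
  from choice[OF this] obtain a' where a: "\<And>l s. a l s \<in> smooth_germs" "\<And>l t. a' l t \<in> smooth_germs"
    and at_g: "\<And>l. wmono l = (\<Sum>i<k. const (c l i) * b i) +
      ((\<Sum>s\<in>S. a l s * germ_comp s g) + (\<Sum>t\<in>T. a' l t * t))" by blast
  define \<rho> where "\<rho> l h = (\<Sum>i<k. const (c l i) * b i) +
      ((\<Sum>s\<in>S. a l s * germ_comp s h) + (\<Sum>t\<in>T. a' l t * t))" for l h
  have "\<forall>l. \<exists>A. (\<forall>l'. A l' \<in> fun_alg \<Gamma>) \<and>
      (\<forall>h\<in>G. cplx (\<rho> l h) - (\<Sum>l'\<in>B. const (A l' h) * wmono l') \<in> vanishing (Suc k))"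
  proof
    fix l
    have "\<forall>s. \<exists>\<phi>. s \<in> S \<longrightarrow> \<phi> \<in> families (fun_alg \<Gamma>) \<and> (\<forall>h\<in>G. germ_comp (cplx s) h - \<phi> h \<in> vanishing (Suc k))"
      using \<Gamma>[OF cplx_smooth] S(2) by (meson subsetD)
    from choice[OF this] obtain \<phi> where \<phi>: "\<And>s. s \<in> S \<Longrightarrow> \<phi> s \<in> families (fun_alg \<Gamma>)"
      "\<And>s h. s \<in> S \<Longrightarrow> h \<in> G \<Longrightarrow> germ_comp (cplx s) h - \<phi> s h \<in> vanishing (Suc k)" by blast
    let ?c = "cplx ((\<Sum>i<k. const (c l i) * b i) + (\<Sum>t\<in>T. a' l t * t))"
    let ?\<psi> = "\<lambda>h. (0 + const 1 * ?c) + (\<Sum>s\<in>S. cplx (a l s) * \<phi> s h)"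
    have "(\<Sum>i<k. const (c l i) * b i) + (\<Sum>t\<in>T. a' l t * t) \<in> smooth_germs"
      using b a(2) T(2) by (intro smooth_germs_add smooth_germs_sum smooth_germs_mult smooth_germs_const) auto
    then have "(\<lambda>h. 0 + const 1 * ?c) \<in> families (fun_alg \<Gamma>)"
      by (intro families_step families_0 fun_alg_const cplx_smooth)
    then have "?\<psi> \<in> families (fun_alg \<Gamma>)"
      by (rule families_add[rotated]) (intro families_sum families_smooth_mult \<phi>(1) cplx_smooth a(1))
    from families_coefficients[OF this B(1)]
    obtain A where A: "\<And>l'. A l' \<in> fun_alg \<Gamma>"
      "\<And>h. ?\<psi> h - (\<Sum>l'\<in>B. const (A l' h) * wmono l') \<in> vanishing (Suc k)" by blast
    have "cplx (\<rho> l h) - (\<Sum>l'\<in>B. const (A l' h) * wmono l') \<in> vanishing (Suc k)" if h: "h \<in> G" for h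
    proof -
      have "cplx (\<rho> l h) - ?\<psi> h = (\<Sum>s\<in>S. cplx (a l s) * (germ_comp (cplx s) h - \<phi> s h))"
        by (simp add: \<rho>_def cplx_add cplx_sum cplx_mult cplx_germ_comp[OF fix_0[OF h]] const_1
            right_diff_distrib sum_subtractf)
      also have "\<dots> \<in> vanishing (Suc k)"
        using \<phi>(2) h by (intro vanishing_sum vanishing_smooth_mult[OF cplx_smooth[OF a(1)]]) auto
      finally have "(cplx (\<rho> l h) - ?\<psi> h) + (?\<psi> h - (\<Sum>l'\<in>B. const (A l' h) * wmono l')) \<in> vanishing (Suc k)"
        using A(2) by (rule vanishing_add)
      then show ?thesis by simp
    qed
    then show "\<exists>A. (\<forall>l'. A l' \<in> fun_alg \<Gamma>) \<and>
      (\<forall>h\<in>G. cplx (\<rho> l h) - (\<Sum>l'\<in>B. const (A l' h) * wmono l') \<in> vanishing (Suc k))" using A(1) by blast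
  qed
  from choice[OF this] obtain A where A: "\<And>l l'. A l l' \<in> fun_alg \<Gamma>"
    "\<And>l h. h \<in> G \<Longrightarrow> cplx (\<rho> l h) - (\<Sum>l'\<in>B. const (A l l' h) * wmono l') \<in> vanishing (Suc k)" by blast
  have A_g: "A l l' g = (if l = l' then 1 else 0)" if l: "l \<in> B" "l' \<in> B" for l l'
  proof -
    have "cplx (\<rho> l g) = wmono l" unfolding \<rho>_def at_g[symmetric] by (rule cplx_wmono)
    moreover have "wmono l = (\<Sum>l'\<in>B. const (if l = l' then 1 else 0) * wmono l' :: (real ^ 'n, complex) germ)"
      using finB l(1) by (simp add: if_distrib[of const] if_distrib[of "\<lambda>x. x * _"] const_0 const_1 cong: if_cong)
    ultimately have "(\<Sum>l'\<in>B. const ((if l = l' then 1 else 0) - A l l' g) * wmono l') =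
        cplx (\<rho> l g) - (\<Sum>l'\<in>B. const (A l l' g) * wmono l')"
      by (simp add: const_minus left_diff_distrib sum_subtractf)
    also have "\<dots> \<in> vanishing (Suc k)" by (rule A(2)[OF g(1)])
    finally show ?thesis using B(2)[OF _ l(2)] by fastforce
  qed
  obtain D where D: "D \<in> fun_alg \<Gamma>" "D g \<noteq> 0"
    "\<And>h j. D h \<noteq> 0 \<Longrightarrow> j \<in> B \<Longrightarrow> \<exists>\<beta>. \<forall>l\<in>B. (\<Sum>i\<in>B. \<beta> i * A i l h) = (if l = j then 1 else 0)"
    using elimination[of B A \<Gamma> g, OF finB A(1) A_g] by blast
  have "intersection_multiplicity (pullback h (Idl\<^bsub>\<E>\<^esub> S)) (Idl\<^bsub>\<E>\<^esub> T) \<le> enat k" if h: "h \<in> G" "D h \<noteq> 0" for h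
  proof (rule intersection_multiplicity_le[OF _ gP[OF h(1)]], rule spans_modulo_of_truncation)
    show "ideal (?L h) \<E>" by (rule ring.genideal_ideal[OF ring_E]) (use gP[OF h(1)] in simp)
    fix f :: "(real ^ 'n, real) germ" assume f: "f \<in> smooth_germs"
    have "\<forall>j. \<exists>\<beta>. j \<in> B \<longrightarrow> (\<forall>l\<in>B. (\<Sum>i\<in>B. \<beta> i * A i l h) = (if l = j then 1 else 0))"
      using D(3)[OF h(2)] by blast
    from choice[OF this] obtain \<beta> where
      \<beta>: "\<And>j l. j \<in> B \<Longrightarrow> l \<in> B \<Longrightarrow> (\<Sum>i\<in>B. \<beta> j i * A i l h) = (if l = j then 1 else 0)" by blast
    obtain d where d: "cplx f - (\<Sum>l\<in>B. const (d l) * wmono l) \<in> vanishing (Suc k)"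
      using B(1) cplx_smooth[OF f] unfolding spanning_words_def by blast
    \<comment> \<open>The inverse of the matrix at \<open>h\<close>, given row by row by
      \<open>\<beta>\<close>, finds the combination of the germs \<open>\<rho> i h\<close> that has
      the same jet as \<open>f\<close>.\<close>
    define e where "e i = (\<Sum>j\<in>B. d j * \<beta> j i)" for i
    have e: "(\<Sum>i\<in>B. e i * A i l h) = d l" if l: "l \<in> B" for l
    proof -
      have "(\<Sum>i\<in>B. e i * A i l h) = (\<Sum>j\<in>B. d j * (\<Sum>i\<in>B. \<beta> j i * A i l h))"
        unfolding e_def sum_distrib_left sum_distrib_right mult.assoc by (rule sum.swap)
      also have "\<dots> = (\<Sum>j\<in>B. d j * (if l = j then 1 else 0))"
        using \<beta> l by (intro sum.cong) auto
      also have "\<dots> = d l" using finB l by (simp add: if_distrib cong: if_cong)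
      finally show ?thesis .
    qed
    have "(\<Sum>i\<in>B. const (e i) * (\<Sum>l\<in>B. const (A i l h) * wmono l)) =
        (\<Sum>l\<in>B. const (\<Sum>i\<in>B. e i * A i l h) * wmono l :: (real ^ 'n, complex) germ)"
      unfolding const_sum sum_distrib_left sum_distrib_right const_mult mult.assoc by (rule sum.swap)
    also have "\<dots> = (\<Sum>l\<in>B. const (d l) * wmono l)" by (intro sum.cong) (simp_all add: e)
    finally have "cplx f - (\<Sum>i\<in>B. const (e i) * cplx (\<rho> i h)) = (cplx f - (\<Sum>l\<in>B. const (d l) * wmono l)) -
        (\<Sum>i\<in>B. const (e i) * (cplx (\<rho> i h) - (\<Sum>l\<in>B. const (A i l h) * wmono l)))"
      by (simp add: right_diff_distrib sum_subtractf)
    also have "\<dots> \<in> vanishing (Suc k)"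
      by (intro vanishing_diff d vanishing_sum vanishing_smooth_mult[OF smooth_germs_const] A(2) h(1))
    finally have "re_part (cplx f - (\<Sum>i\<in>B. const (e i) * cplx (\<rho> i h))) \<in> vanishing (Suc k)"
      by (rule re_part_vanishing)
    \<comment> \<open>\<open>f\<close> and all \<open>\<rho> i h\<close> are real, so taking real
      parts replaces the complex coefficients \<open>e i\<close> by \<open>Re (e i)\<close>.\<close>
    then have f_rep: "f - (\<Sum>i\<in>B. const (Re (e i)) * \<rho> i h) \<in> vanishing (Suc k)"
      by (simp add: re_part_diff re_part_cplx re_part_sum re_part_const_mult_cplx)
    \<comment> \<open>Each \<open>\<rho> j h\<close> consists of a combination of the same
      \<open>k\<close> germs \<open>b i\<close> and an element of the ideal at \<open>h\<close>; the
      latter parts are collected here.\<close>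
    let ?l = "\<Sum>j\<in>B. const (Re (e j)) * ((\<Sum>s\<in>S. a j s * germ_comp s h) + (\<Sum>t\<in>T. a' j t * t))"
    let ?c = "\<lambda>i. \<Sum>j\<in>B. Re (e j) * c j i"
    have L: "ideal (?L h) \<E>" by (rule ring.genideal_ideal[OF ring_E]) (use gP[OF h(1)] in simp)
    have "?l \<in> ?L h"
      by (intro ideal_E_sum[OF L] ideal_ED(4)[OF L] smooth_germs_const gens(3)[OF fix_0[OF h(1)]] a)
    moreover have "(\<Sum>j\<in>B. const (Re (e j)) * \<rho> j h) = (\<Sum>i<k. const (?c i) * b i) + ?l"
    proof -
      have "(\<Sum>j\<in>B. const (Re (e j)) * (\<Sum>i<k. const (c j i) * b i)) = (\<Sum>i<k. const (?c i) * b i)"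
        unfolding const_sum sum_distrib_left sum_distrib_right const_mult mult.assoc by (rule sum.swap)
      then show ?thesis unfolding \<rho>_def by (simp only: distrib_left[of "const _"] sum.distrib)
    qed
    then have "f - (\<Sum>i<k. const (?c i) * b i) - ?l \<in> vanishing (Suc k)"
      using f_rep by (simp only: diff_diff_add)
    ultimately show "\<exists>c. \<exists>l\<in>?L h. f - (\<Sum>i<k. const (c i) * b i) - l \<in> vanishing (Suc k)"
      by (intro exI[of _ ?c] bexI)
  qed (use b in blast)
  then show ?thesis using D(1,2) by blast
qed

theorem corollary2:
  fixes G :: "(real ^ 'n, real ^ 'n) germ set"
    and X Y :: "(real ^ 'n) set"
    and I\<^sub>X I\<^sub>Y :: "(real ^ 'n, real) germ set"
  assumes "subgroup G Diff_0"
    and "comm_group (Diff_0\<lparr>carrier := G\<rparr>)"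
    and "finitely_generated G"
    and "fp_smooth_subvariety X I\<^sub>X"
    and "fp_smooth_subvariety Y I\<^sub>Y"
  shows "\<exists>m::nat. \<forall>g\<in>G.
           intersection_multiplicity (pullback g I\<^sub>X) I\<^sub>Y < \<infinity> \<longrightarrow>
           intersection_multiplicity (pullback g I\<^sub>X) I\<^sub>Y \<le> enat m"
proof -
  let ?\<mu> = "\<lambda>g. intersection_multiplicity (pullback g I\<^sub>X) I\<^sub>Y"
  have G: "G \<subseteq> smooth_germs_fix_0"
    using subgroup.subset[OF assms(1)] carrier_Diff_0 by blast
  obtain \<Gamma> where \<Gamma>: "finite \<Gamma>" "\<And>F k. F \<in> smooth_germs \<Longrightarrow>
      \<exists>\<phi>\<in>families (fun_alg \<Gamma>). \<forall>h\<in>G. germ_comp F h - \<phi> h \<in> vanishing k"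
    using finitely_generated_parametrized[OF assms(1-3)] unfolding finitely_parametrized_def by blast
  obtain S where S: "finite S" "S \<subseteq> smooth_germs" "I\<^sub>X = Idl\<^bsub>\<E>\<^esub> S"
    using assms(4) unfolding fp_smooth_subvariety_def smooth_germs_def
    by (metis (no_types, lifting) finite_imageI image_mono mem_Collect_eq subsetI)
  obtain T where T: "finite T" "T \<subseteq> smooth_germs" "I\<^sub>Y = Idl\<^bsub>\<E>\<^esub> T"
    using assms(5) unfolding fp_smooth_subvariety_def smooth_germs_def
    by (metis (no_types, lifting) finite_imageI image_mono mem_Collect_eq subsetI)
  have "\<forall>g. \<exists>D k. g \<in> G \<and> ?\<mu> g < \<infinity> \<longrightarrow>
      D \<in> fun_alg \<Gamma> \<and> D g \<noteq> 0 \<and> (\<forall>h\<in>G. D h \<noteq> 0 \<longrightarrow> ?\<mu> h \<le> enat k)"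
    using finite_multiplicity_open[OF S(1,2) T(1,2) G \<Gamma>(2)] unfolding S(3) T(3) by blast
  from choice[OF this] obtain D where "\<forall>g. \<exists>k. g \<in> G \<and> ?\<mu> g < \<infinity> \<longrightarrow>
      D g \<in> fun_alg \<Gamma> \<and> D g g \<noteq> 0 \<and> (\<forall>h\<in>G. D g h \<noteq> 0 \<longrightarrow> ?\<mu> h \<le> enat k)" ..
  from choice[OF this] obtain k where D: "\<And>g. g \<in> G \<Longrightarrow> ?\<mu> g < \<infinity> \<Longrightarrow> D g \<in> fun_alg \<Gamma>"
    "\<And>g. g \<in> G \<Longrightarrow> ?\<mu> g < \<infinity> \<Longrightarrow> D g g \<noteq> 0"
    "\<And>g h. g \<in> G \<Longrightarrow> ?\<mu> g < \<infinity> \<Longrightarrow> h \<in> G \<Longrightarrow> D g h \<noteq> 0 \<Longrightarrow> ?\<mu> h \<le> enat (k g)" by blast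
  let ?G = "{g \<in> G. ?\<mu> g < \<infinity>}"
  have "D ` ?G \<subseteq> fun_alg \<Gamma>" using D(1) by blast
  from fun_alg_finite_common_zeros[OF \<Gamma>(1) this]
  obtain F where F: "finite F" "F \<subseteq> D ` ?G" "\<And>h. \<forall>d\<in>F. d h = 0 \<Longrightarrow> \<forall>d\<in>D ` ?G. d h = 0" by blast
  obtain M where M: "finite M" "M \<subseteq> ?G" "F = D ` M" using finite_subset_image[OF F(1,2)] by blast
  \<comment> \<open>Since \<open>D g g \<noteq> 0\<close>, some function in \<open>F\<close> is
    nonzero at \<open>g\<close>, and the element of \<open>M\<close> to which it belongs provides
    the bound. In particular \<open>M\<close> is nonempty whenever such a \<open>g\<close> exists,
    so the unspecified maximum of the empty set does no harm.\<close>
  have "?\<mu> g \<le> enat (Max (k ` M))" if g: "g \<in> G" "?\<mu> g < \<infinity>" for g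
  proof -
    have "\<exists>d\<in>F. d g \<noteq> 0" using F(3)[of g] D(2)[OF g] g by blast
    then obtain g' where g': "g' \<in> M" "D g' g \<noteq> 0" using M(3) by blast
    then have "?\<mu> g \<le> enat (k g')" using D(3)[of g' g] M(2) g(1) by blast
    also have "\<dots> \<le> enat (Max (k ` M))" using g'(1) M(1) by simp
    finally show ?thesis .
  qed
  then show ?thesis by blast
qed

end
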